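(* Let $R$ be a commutative noetherian semilocal ring and let $M$ be a finitely generated $R$-module giving an NCR of $R$. Let $\mathscr{C}_M$ be the full subcategory of $\operatorname{mod} R$ consisting of all $X$ satisfying $\operatorname{supp} X\subset\operatorname{NG}(M)$. Then $K_0(R)/\langle\mathscr{C}_M\rangle$ is a finitely generated abelian group.
   Context: For a commutative noetherian ring $R$, $\operatorname{mod} R$ is the category of finitely generated $R$-modules and $K_0(R)$ is the Grothendieck group of the abelian category $\operatorname{mod} R$. A finitely generated $R$-module $M$ gives a non-commutative resolution (NCR) of $R$ if $M$ is faithful and $\operatorname{End}_R(M)$ has finite global dimension. Put $M^*=\operatorname{Hom}_R(M,R)$ and $E=\operatorname{End}_R(M)$, and let $a_M: M\otimes_E M^*\to R$ be the natural map $m\otimes f\mapsto f(m)$. The non-generating locus $\operatorname{NG}(M)\subset\operatorname{Spec}(R)$ is the support of $\operatorname{Cok}(a_M)$. For a full subcategory $\mathscr{C}$ of $\operatorname{mod} R$, $\langle\mathscr{C}\rangle$ denotes the subgroup of $K_0(R)$ generated by the classes $[X]$ with $X\in\mathscr{C}$. *)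

theory Defs
  imports "HOL-Algebra.Module" "HOL-Algebra.Ring_Divisibility" "HOL-Algebra.Generated_Groups"
    "HOL-Algebra.Free_Abelian_Groups" "HOL-Library.Extended_Nat"
begin

section \<open>Modules\<close>

text \<open>
  \<^locale>\<open>module\<close> of HOL-Algebra is restricted to commutative rings; the endomorphism ring needs
  left modules over arbitrary rings. As in the library, the fields \<open>mult\<close> and \<open>one\<close> that the
  record type \<open>module\<close> inherits from \<open>ring\<close> carry no meaning for a module.
\<close>

locale left_module = E?: ring E + N?: abelian_group N
  for E :: "('e, 'c) ring_scheme" (structure) and N :: "('e, 'n, 'd) module_scheme" (structure) +
  assumes smult_closed: "\<lbrakk>a \<in> carrier E; x \<in> carrier N\<rbrakk> \<Longrightarrow> a \<odot>\<^bsub>N\<^esub> x \<in> carrier N"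
    and smult_l_distr: "\<lbrakk>a \<in> carrier E; b \<in> carrier E; x \<in> carrier N\<rbrakk> \<Longrightarrow>
      (a \<oplus>\<^bsub>E\<^esub> b) \<odot>\<^bsub>N\<^esub> x = a \<odot>\<^bsub>N\<^esub> x \<oplus>\<^bsub>N\<^esub> b \<odot>\<^bsub>N\<^esub> x"
    and smult_r_distr: "\<lbrakk>a \<in> carrier E; x \<in> carrier N; y \<in> carrier N\<rbrakk> \<Longrightarrow>
      a \<odot>\<^bsub>N\<^esub> (x \<oplus>\<^bsub>N\<^esub> y) = a \<odot>\<^bsub>N\<^esub> x \<oplus>\<^bsub>N\<^esub> a \<odot>\<^bsub>N\<^esub> y"
    and smult_assoc: "\<lbrakk>a \<in> carrier E; b \<in> carrier E; x \<in> carrier N\<rbrakk> \<Longrightarrow>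
      (a \<otimes>\<^bsub>E\<^esub> b) \<odot>\<^bsub>N\<^esub> x = a \<odot>\<^bsub>N\<^esub> (b \<odot>\<^bsub>N\<^esub> x)"
    and smult_one: "x \<in> carrier N \<Longrightarrow> \<one>\<^bsub>E\<^esub> \<odot>\<^bsub>N\<^esub> x = x"

text \<open>Linear maps are extensional, so that they are determined by their values on the carrier.\<close>

definition linear_maps ::
  "('a, 'c) ring_scheme \<Rightarrow> ('a, 'b, 'd) module_scheme \<Rightarrow> ('a, 'e, 'f) module_scheme \<Rightarrow> ('b \<Rightarrow> 'e) set"
  where "linear_maps R X Y = {f \<in> carrier X \<rightarrow>\<^sub>E carrier Y.
    (\<forall>x\<in>carrier X. \<forall>y\<in>carrier X. f (x \<oplus>\<^bsub>X\<^esub> y) = f x \<oplus>\<^bsub>Y\<^esub> f y) \<and>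
    (\<forall>r\<in>carrier R. \<forall>x\<in>carrier X. f (r \<odot>\<^bsub>X\<^esub> x) = r \<odot>\<^bsub>Y\<^esub> f x)}"

definition finitely_generated_module ::
  "('a, 'c) ring_scheme \<Rightarrow> ('a, 'b, 'd) module_scheme \<Rightarrow> bool"
  where "finitely_generated_module R X \<longleftrightarrow>
    (\<exists>A. finite A \<and> A \<subseteq> carrier X \<and> (\<forall>H. submodule H R X \<and> A \<subseteq> H \<longrightarrow> H = carrier X))"

definition faithful_module :: "('a, 'c) ring_scheme \<Rightarrow> ('a, 'b, 'd) module_scheme \<Rightarrow> bool"
  where "faithful_module R X \<longleftrightarrow>
    (\<forall>r\<in>carrier R. (\<forall>x\<in>carrier X. r \<odot>\<^bsub>X\<^esub> x = \<zero>\<^bsub>X\<^esub>) \<longrightarrow> r = \<zero>\<^bsub>R\<^esub>)"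

definition short_exact ::
  "('a, 'c) ring_scheme \<Rightarrow> ('a, 'b, 'd) module_scheme \<Rightarrow> ('a, 'e, 'f) module_scheme
    \<Rightarrow> ('a, 'g, 'h) module_scheme \<Rightarrow> ('b \<Rightarrow> 'e) \<Rightarrow> ('e \<Rightarrow> 'g) \<Rightarrow> bool"
  where "short_exact R X Y Z f g \<longleftrightarrow>
    f \<in> linear_maps R X Y \<and> g \<in> linear_maps R Y Z \<and>
    inj_on f (carrier X) \<and> f ` carrier X = {y \<in> carrier Y. g y = \<zero>\<^bsub>Z\<^esub>} \<and>
    g ` carrier Y = carrier Z"

definition regular_module :: "('a, 'c) ring_scheme \<Rightarrow> ('a, 'a) module"
  where "regular_module R = \<lparr>carrier = carrier R, monoid.mult = mult R, monoid.one = \<one>\<^bsub>R\<^esub>,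
    ring.zero = \<zero>\<^bsub>R\<^esub>, ring.add = add R, smult = mult R\<rparr>"

text \<open>The quotient of \<open>X\<close> by a submodule \<open>H\<close>. In the definition of scalar multiplication all the
  cosets over which the union is taken coincide.\<close>

definition quotient_module :: "('a, 'b, 'd) module_scheme \<Rightarrow> 'b set \<Rightarrow> ('a, 'b set) module"
  where "quotient_module X H = \<lparr>carrier = a_rcosets\<^bsub>X\<^esub> H,
    monoid.mult = undefined, monoid.one = undefined,
    ring.zero = H, ring.add = set_add X, smult = (\<lambda>r C. \<Union>x\<in>C. H +>\<^bsub>X\<^esub> (r \<odot>\<^bsub>X\<^esub> x))\<rparr>"


section \<open>Localization and support\<close>

definition fraction_rel ::
  "('a, 'c) ring_scheme \<Rightarrow> ('a, 'b, 'd) module_scheme \<Rightarrow> 'a set \<Rightarrow> (('b \<times> 'a) \<times> ('b \<times> 'a)) set"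
  where "fraction_rel R X P = {((x, s), (y, t)) | x s y t.
    x \<in> carrier X \<and> s \<in> carrier R - P \<and> y \<in> carrier X \<and> t \<in> carrier R - P \<and>
    (\<exists>u\<in>carrier R - P. u \<odot>\<^bsub>X\<^esub> (t \<odot>\<^bsub>X\<^esub> x) = u \<odot>\<^bsub>X\<^esub> (s \<odot>\<^bsub>X\<^esub> y))}"

text \<open>The localization \<open>X\<^sub>P\<close> at a prime ideal \<open>P\<close>, as an \<open>R\<close>-module: the class of \<open>(x, s)\<close> is the
  fraction \<open>x/s\<close>.\<close>

definition localized_module ::
  "('a, 'c) ring_scheme \<Rightarrow> ('a, 'b, 'd) module_scheme \<Rightarrow> 'a set \<Rightarrow> ('a, ('b \<times> 'a) set) module"
  where "localized_module R X P = \<lparr>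
    carrier = (carrier X \<times> (carrier R - P)) // fraction_rel R X P,
    monoid.mult = undefined, monoid.one = undefined,
    ring.zero = fraction_rel R X P `` {(\<zero>\<^bsub>X\<^esub>, \<one>\<^bsub>R\<^esub>)},
    ring.add = (\<lambda>C D. \<Union>(x, s)\<in>C. \<Union>(y, t)\<in>D.
      fraction_rel R X P `` {(t \<odot>\<^bsub>X\<^esub> x \<oplus>\<^bsub>X\<^esub> s \<odot>\<^bsub>X\<^esub> y, s \<otimes>\<^bsub>R\<^esub> t)}),
    smult = (\<lambda>r C. \<Union>(x, s)\<in>C. fraction_rel R X P `` {(r \<odot>\<^bsub>X\<^esub> x, s)})\<rparr>"

definition Spec :: "('a, 'c) ring_scheme \<Rightarrow> 'a set set"
  where "Spec R = {P. primeideal P R}"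

definition supp :: "('a, 'c) ring_scheme \<Rightarrow> ('a, 'b, 'd) module_scheme \<Rightarrow> 'a set set"
  where "supp R X = {P \<in> Spec R.
    carrier (localized_module R X P) \<noteq> {\<zero>\<^bsub>localized_module R X P\<^esub>}}"

definition semilocal :: "('a, 'c) ring_scheme \<Rightarrow> bool"
  where "semilocal R \<longleftrightarrow> finite {I. maximalideal I R}"


section \<open>Endomorphism ring and dual\<close>

text \<open>
  The product of \<open>End\<^sub>R(M)\<close> is ``first \<open>e\<close>, then \<open>e'\<close>''. With this convention \<open>M\<close> is a right
  \<open>E\<close>-module and \<open>M\<^sup>*\<close> a left one, as the expression \<open>M \<otimes>\<^sub>E M\<^sup>*\<close> requires. (For \<open>R\<close> noetherian and \<open>M\<close>
  finitely generated the ring is noetherian on both sides, so that its global dimension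
  is the same for either order of composition.)
\<close>

definition End_ring :: "('a, 'c) ring_scheme \<Rightarrow> ('a, 'b, 'd) module_scheme \<Rightarrow> ('b \<Rightarrow> 'b) ring"
  where "End_ring R M = \<lparr>carrier = linear_maps R M M,
    monoid.mult = (\<lambda>e e'. \<lambda>m\<in>carrier M. e' (e m)),
    monoid.one = (\<lambda>m\<in>carrier M. m),
    ring.zero = (\<lambda>m\<in>carrier M. \<zero>\<^bsub>M\<^esub>),
    ring.add = (\<lambda>e e'. \<lambda>m\<in>carrier M. e m \<oplus>\<^bsub>M\<^esub> e' m)\<rparr>"

text \<open>\<open>M\<close> as a right module over \<open>End_ring R M\<close>; \<open>smult\<close> then stands for the action from the right.\<close>

definition End_right_module :: "('a, 'b, 'd) module_scheme \<Rightarrow> ('b \<Rightarrow> 'b, 'b) module"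
  where "End_right_module M = \<lparr>carrier = carrier M,
    monoid.mult = undefined, monoid.one = undefined,
    ring.zero = \<zero>\<^bsub>M\<^esub>, ring.add = add M, smult = (\<lambda>e m. e m)\<rparr>"

text \<open>\<open>M\<^sup>* = Hom\<^sub>R(M,R)\<close> as a left module over \<open>End_ring R M\<close>: \<open>(e f)(m) = f(m e)\<close>.\<close>

definition dual_module ::
  "('a, 'c) ring_scheme \<Rightarrow> ('a, 'b, 'd) module_scheme \<Rightarrow> ('b \<Rightarrow> 'b, 'b \<Rightarrow> 'a) module"
  where "dual_module R M = \<lparr>carrier = linear_maps R M (regular_module R),
    monoid.mult = undefined, monoid.one = undefined,
    ring.zero = (\<lambda>m\<in>carrier M. \<zero>\<^bsub>R\<^esub>),
    ring.add = (\<lambda>f g. \<lambda>m\<in>carrier M. f m \<oplus>\<^bsub>R\<^esub> g m),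
    smult = (\<lambda>e f. \<lambda>m\<in>carrier M. f (e m))\<rparr>"


section \<open>Tensor product over a possibly noncommutative ring\<close>

text \<open>Here \<open>M\<close> is a right module (its \<open>smult\<close> being the right action) and \<open>N\<close> a left module.\<close>

definition tensor_relators ::
  "('e, 'c) ring_scheme \<Rightarrow> ('e, 'm, 'd) module_scheme \<Rightarrow> ('e, 'n, 'f) module_scheme
    \<Rightarrow> ('m \<times> 'n \<Rightarrow>\<^sub>0 int) set"
  where "tensor_relators E M N =
    {frag_of (m \<oplus>\<^bsub>M\<^esub> m', n) - frag_of (m, n) - frag_of (m', n) | m m' n.
      m \<in> carrier M \<and> m' \<in> carrier M \<and> n \<in> carrier N} \<union>
    {frag_of (m, n \<oplus>\<^bsub>N\<^esub> n') - frag_of (m, n) - frag_of (m, n') | m n n'.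
      m \<in> carrier M \<and> n \<in> carrier N \<and> n' \<in> carrier N} \<union>
    {frag_of (e \<odot>\<^bsub>M\<^esub> m, n) - frag_of (m, e \<odot>\<^bsub>N\<^esub> n) | e m n.
      e \<in> carrier E \<and> m \<in> carrier M \<and> n \<in> carrier N}"

definition tensor_kernel ::
  "('e, 'c) ring_scheme \<Rightarrow> ('e, 'm, 'd) module_scheme \<Rightarrow> ('e, 'n, 'f) module_scheme
    \<Rightarrow> ('m \<times> 'n \<Rightarrow>\<^sub>0 int) set"
  where "tensor_kernel E M N =
    generate (free_Abelian_group (carrier M \<times> carrier N)) (tensor_relators E M N)"

definition tensor_product ::
  "('e, 'c) ring_scheme \<Rightarrow> ('e, 'm, 'd) module_scheme \<Rightarrow> ('e, 'n, 'f) module_scheme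
    \<Rightarrow> ('m \<times> 'n \<Rightarrow>\<^sub>0 int) set monoid"
  where "tensor_product E M N =
    free_Abelian_group (carrier M \<times> carrier N) Mod tensor_kernel E M N"

definition pure_tensor ::
  "('e, 'c) ring_scheme \<Rightarrow> ('e, 'm, 'd) module_scheme \<Rightarrow> ('e, 'n, 'f) module_scheme
    \<Rightarrow> 'm \<Rightarrow> 'n \<Rightarrow> ('m \<times> 'n \<Rightarrow>\<^sub>0 int) set"
  where "pure_tensor E M N m n =
    tensor_kernel E M N #>\<^bsub>free_Abelian_group (carrier M \<times> carrier N)\<^esub> frag_of (m, n)"


section \<open>The natural map and the non-generating locus\<close>

definition dual_tensor ::
  "('a, 'c) ring_scheme \<Rightarrow> ('a, 'b, 'd) module_scheme \<Rightarrow> ('b \<times> ('b \<Rightarrow> 'a) \<Rightarrow>\<^sub>0 int) set monoid"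
  where "dual_tensor R M =
    tensor_product (End_ring R M) (End_right_module M) (dual_module R M)"

definition is_natural_map ::
  "('a, 'c) ring_scheme \<Rightarrow> ('a, 'b, 'd) module_scheme
    \<Rightarrow> (('b \<times> ('b \<Rightarrow> 'a) \<Rightarrow>\<^sub>0 int) set \<Rightarrow> 'a) \<Rightarrow> bool"
  where "is_natural_map R M a \<longleftrightarrow>
    a \<in> hom (dual_tensor R M) (add_monoid R) \<and> a \<in> extensional (carrier (dual_tensor R M)) \<and>
    (\<forall>m\<in>carrier M. \<forall>f\<in>carrier (dual_module R M).
      a (pure_tensor (End_ring R M) (End_right_module M) (dual_module R M) m f) = f m)"

text \<open>The map \<open>a\<^sub>M : M \<otimes>\<^sub>E M\<^sup>* \<rightarrow> R\<close> with \<open>m \<otimes> f \<mapsto> f(m)\<close>; see \<open>ex1_natural_map\<close> below.\<close>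

definition natural_map ::
  "('a, 'c) ring_scheme \<Rightarrow> ('a, 'b, 'd) module_scheme
    \<Rightarrow> ('b \<times> ('b \<Rightarrow> 'a) \<Rightarrow>\<^sub>0 int) set \<Rightarrow> 'a"
  where "natural_map R M = (THE a. is_natural_map R M a)"

definition Cok_natural_map ::
  "('a, 'c) ring_scheme \<Rightarrow> ('a, 'b, 'd) module_scheme \<Rightarrow> ('a, 'a set) module"
  where "Cok_natural_map R M =
    quotient_module (regular_module R) (natural_map R M ` carrier (dual_tensor R M))"

definition NG :: "('a, 'c) ring_scheme \<Rightarrow> ('a, 'b, 'd) module_scheme \<Rightarrow> 'a set set"
  where "NG R M = supp R (Cok_natural_map R M)"


section \<open>Global dimension and non-commutative resolutions\<close>

text \<open>
  A formula cannot quantify over types, so modules over a ring with element type \<open>'e\<close> are taken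
  with elements in one fixed type. It contains an isomorphic copy of every finitely (even
  countably) generated module (see \<open>finitely_generated_module_in_universe\<close>). Unless
  \<open>'e\<close> has only one element, when all modules vanish anyway, it is an infinite type with at least
  as many elements as \<open>'e\<close>; hence the modules in it are closed, up to isomorphism,
  under submodules, quotients and free covers. So projectivity and projective dimension
  computed inside it are the usual ones. The global dimension is the usual one because it is
  attained on cyclic modules (Auslander).
\<close>

type_synonym 'e module_univ = "(nat \<Rightarrow> 'e) set"

definition projective_module :: "('e, 'c) ring_scheme \<Rightarrow> ('e, 'u) module \<Rightarrow> bool"
  where "projective_module E P \<longleftrightarrow> left_module E P \<and>
    (\<forall>(X :: ('e, 'u) module) (Y :: ('e, 'u) module) g f.
      left_module E X \<and> left_module E Y \<and> g \<in> linear_maps E X Y \<and> g ` carrier X = carrier Y \<and>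
      f \<in> linear_maps E P Y \<longrightarrow>
      (\<exists>h\<in>linear_maps E P X. \<forall>p\<in>carrier P. g (h p) = f p))"

text \<open>A projective resolution \<open>0 \<rightarrow> P\<^sub>n \<rightarrow> \<dots> \<rightarrow> P\<^sub>0 \<rightarrow> N \<rightarrow> 0\<close>, extended by zero modules.\<close>

definition has_projective_resolution :: "('e, 'c) ring_scheme \<Rightarrow> nat \<Rightarrow> ('e, 'u) module \<Rightarrow> bool"
  where "has_projective_resolution E n N \<longleftrightarrow>
    (\<exists>(P :: nat \<Rightarrow> ('e, 'u) module) d.
      (\<forall>i. projective_module E (P i)) \<and>
      (\<forall>i>n. carrier (P i) = {\<zero>\<^bsub>P i\<^esub>}) \<and>
      d 0 \<in> linear_maps E (P 0) N \<and> d 0 ` carrier (P 0) = carrier N \<and>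
      d 1 ` carrier (P 1) = {x \<in> carrier (P 0). d 0 x = \<zero>\<^bsub>N\<^esub>} \<and>
      (\<forall>i. d (Suc i) \<in> linear_maps E (P (Suc i)) (P i)) \<and>
      (\<forall>i. d (Suc (Suc i)) ` carrier (P (Suc (Suc i))) =
        {x \<in> carrier (P (Suc i)). d (Suc i) x = \<zero>\<^bsub>P i\<^esub>}))"

definition proj_dim :: "('e, 'c) ring_scheme \<Rightarrow> ('e, 'u) module \<Rightarrow> enat"
  where "proj_dim E N = Inf {enat n | n. has_projective_resolution E n N}"

definition gl_dim :: "('e, 'c) ring_scheme \<Rightarrow> enat"
  where "gl_dim E = Sup {proj_dim E N | N :: ('e, 'e module_univ) module. left_module E N}"

definition NCR :: "('a, 'c) ring_scheme \<Rightarrow> ('a, 'b, 'd) module_scheme \<Rightarrow> bool"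
  where "NCR R M \<longleftrightarrow> faithful_module R M \<and> gl_dim (End_ring R M) < \<infinity>"


section \<open>The Grothendieck group\<close>

text \<open>Up to isomorphism, these are all the finitely generated modules
  (see \<open>finitely_generated_module_in_universe\<close>), so \<open>K0\<close> is the Grothendieck group of \<open>mod R\<close>.
  Isomorphic modules have equal classes, by the exact sequences with a zero module.\<close>

definition fg_modules :: "('a, 'c) ring_scheme \<Rightarrow> ('a, 'a module_univ) module set"
  where "fg_modules R = {X. module R X \<and> finitely_generated_module R X}"

definition K0_relators :: "('a, 'c) ring_scheme \<Rightarrow> (('a, 'a module_univ) module \<Rightarrow>\<^sub>0 int) set"
  where "K0_relators R = {frag_of Y - frag_of X - frag_of Z | X Y Z.
    X \<in> fg_modules R \<and> Y \<in> fg_modules R \<and> Z \<in> fg_modules R \<and> (\<exists>f g. short_exact R X Y Z f g)}"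

definition K0_kernel :: "('a, 'c) ring_scheme \<Rightarrow> (('a, 'a module_univ) module \<Rightarrow>\<^sub>0 int) set"
  where "K0_kernel R = generate (free_Abelian_group (fg_modules R)) (K0_relators R)"

definition K0 :: "('a, 'c) ring_scheme \<Rightarrow> (('a, 'a module_univ) module \<Rightarrow>\<^sub>0 int) set monoid"
  where "K0 R = free_Abelian_group (fg_modules R) Mod K0_kernel R"

definition K0_class ::
  "('a, 'c) ring_scheme \<Rightarrow> ('a, 'a module_univ) module \<Rightarrow> (('a, 'a module_univ) module \<Rightarrow>\<^sub>0 int) set"
  where "K0_class R X = K0_kernel R #>\<^bsub>free_Abelian_group (fg_modules R)\<^esub> frag_of X"

definition K0_span ::
  "('a, 'c) ring_scheme \<Rightarrow> ('a, 'a module_univ) module set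
    \<Rightarrow> (('a, 'a module_univ) module \<Rightarrow>\<^sub>0 int) set set"
  where "K0_span R \<C> = generate (K0 R) (K0_class R ` \<C>)"

definition C_NG ::
  "('a, 'c) ring_scheme \<Rightarrow> ('a, 'b, 'd) module_scheme \<Rightarrow> ('a, 'a module_univ) module set"
  where "C_NG R M = {X \<in> fg_modules R. supp R X \<subseteq> NG R M}"

definition finitely_generated_abelian_group :: "('g, 'h) monoid_scheme \<Rightarrow> bool"
  where "finitely_generated_abelian_group G \<longleftrightarrow>
    comm_group G \<and> (\<exists>A. finite A \<and> A \<subseteq> carrier G \<and> generate G A = carrier G)"


section \<open>Well-definedness\<close>

context left_module
begin

lemma smult_zero_left: "x \<in> carrier N \<Longrightarrow> \<zero> \<odot>\<^bsub>N\<^esub> x = \<zero>\<^bsub>N\<^esub>"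
  by (metis E.l_zero E.zero_closed N.add.r_cancel_one' smult_closed smult_l_distr)

lemma smult_zero_right: "a \<in> carrier E \<Longrightarrow> a \<odot>\<^bsub>N\<^esub> \<zero>\<^bsub>N\<^esub> = \<zero>\<^bsub>N\<^esub>"
  by (metis N.l_zero N.zero_closed N.add.r_cancel_one' smult_closed smult_r_distr)

lemma smult_minus_one: "x \<in> carrier N \<Longrightarrow> (\<ominus> \<one>) \<odot>\<^bsub>N\<^esub> x = \<ominus>\<^bsub>N\<^esub> x"
  by (metis E.a_inv_closed E.l_neg E.one_closed N.minus_equality smult_closed smult_l_distr
      smult_one smult_zero_left)

lemma smult_finsum:
  "\<lbrakk>finite I; a \<in> carrier E; f \<in> I \<rightarrow> carrier N\<rbrakk> \<Longrightarrow>
    a \<odot>\<^bsub>N\<^esub> (\<Oplus>\<^bsub>N\<^esub>i\<in>I. f i) = (\<Oplus>\<^bsub>N\<^esub>i\<in>I. a \<odot>\<^bsub>N\<^esub> f i)"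
proof (induct set: finite)
  case empty then show ?case by (simp add: smult_zero_right)
next
  case (insert x F)
  then show ?case by (simp add: Pi_def smult_r_distr smult_closed N.finsum_closed)
qed

lemma submodule_combinations:
  assumes e: "\<And>i. i < n \<Longrightarrow> e i \<in> carrier N"
  shows "submodule {\<Oplus>\<^bsub>N\<^esub>i\<in>{..<n}. c i \<odot>\<^bsub>N\<^esub> e i | c. c \<in> {..<n::nat} \<rightarrow> carrier E} E N"
    (is "submodule ?H E N")
proof -
  have sub: "?H \<subseteq> carrier N"
    using e by (auto intro!: N.finsum_closed smult_closed)
  have sm: "a \<odot>\<^bsub>N\<^esub> x \<in> ?H" if a: "a \<in> carrier E" and x: "x \<in> ?H" for a x
  proof -
    from x obtain c where c: "c \<in> {..<n} \<rightarrow> carrier E" "x = (\<Oplus>\<^bsub>N\<^esub>i\<in>{..<n}. c i \<odot>\<^bsub>N\<^esub> e i)"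
      by blast
    have "a \<odot>\<^bsub>N\<^esub> x = (\<Oplus>\<^bsub>N\<^esub>i\<in>{..<n}. a \<odot>\<^bsub>N\<^esub> (c i \<odot>\<^bsub>N\<^esub> e i))"
      unfolding c(2) using c(1) a e by (intro smult_finsum) (auto intro!: smult_closed)
    also have "\<dots> = (\<Oplus>\<^bsub>N\<^esub>i\<in>{..<n}. (a \<otimes> c i) \<odot>\<^bsub>N\<^esub> e i)"
      using c(1) a e by (intro N.finsum_cong') (auto intro!: smult_closed smult_assoc[symmetric])
    finally show ?thesis using a c(1)
      by (intro CollectI exI[of _ "\<lambda>i. a \<otimes> c i"]) auto
  qed
  have ad: "x \<oplus>\<^bsub>N\<^esub> y \<in> ?H" if x: "x \<in> ?H" and y: "y \<in> ?H" for x y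
  proof -
    from x obtain c where c: "c \<in> {..<n} \<rightarrow> carrier E" "x = (\<Oplus>\<^bsub>N\<^esub>i\<in>{..<n}. c i \<odot>\<^bsub>N\<^esub> e i)"
      by blast
    from y obtain d where d: "d \<in> {..<n} \<rightarrow> carrier E" "y = (\<Oplus>\<^bsub>N\<^esub>i\<in>{..<n}. d i \<odot>\<^bsub>N\<^esub> e i)"
      by blast
    have "x \<oplus>\<^bsub>N\<^esub> y = (\<Oplus>\<^bsub>N\<^esub>i\<in>{..<n}. c i \<odot>\<^bsub>N\<^esub> e i \<oplus>\<^bsub>N\<^esub> d i \<odot>\<^bsub>N\<^esub> e i)"
      unfolding c(2) d(2) using c(1) d(1) e
      by (intro N.finsum_addf[symmetric]) (auto intro!: smult_closed)
    also have "\<dots> = (\<Oplus>\<^bsub>N\<^esub>i\<in>{..<n}. (c i \<oplus> d i) \<odot>\<^bsub>N\<^esub> e i)"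
      using c(1) d(1) e
      by (intro N.finsum_cong') (auto intro!: smult_closed smult_l_distr[symmetric])
    finally show ?thesis using c(1) d(1)
      by (intro CollectI exI[of _ "\<lambda>i. c i \<oplus> d i"]) auto
  qed
  have "(\<Oplus>\<^bsub>N\<^esub>i\<in>{..<n}. \<zero> \<odot>\<^bsub>N\<^esub> e i) = (\<Oplus>\<^bsub>N\<^esub>i\<in>{..<n}. \<zero>\<^bsub>N\<^esub>)"
    using e by (intro N.finsum_cong') (auto simp: smult_zero_left)
  then have ze: "\<zero>\<^bsub>N\<^esub> \<in> ?H"
    by (intro CollectI exI[of _ "\<lambda>_. \<zero>"]) auto
  have mi: "\<ominus>\<^bsub>N\<^esub> x \<in> ?H" if "x \<in> ?H" for x
  proof -
    have "\<ominus>\<^bsub>N\<^esub> x = (\<ominus> \<one>) \<odot>\<^bsub>N\<^esub> x"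
      using sub that by (intro smult_minus_one[symmetric]) blast
    then show ?thesis using sm[OF _ that, of "\<ominus> \<one>"] by simp
  qed
  show ?thesis
    by (intro submodule.intro subgroup.intro submodule_axioms.intro)
      (use sub ad ze mi sm in \<open>auto simp flip: a_inv_def\<close>)
qed

lemma finitely_generated_imp_combinations:
  assumes "finitely_generated_module E N"
  obtains n :: nat and e where "\<And>i. i < n \<Longrightarrow> e i \<in> carrier N"
    "carrier N = {\<Oplus>\<^bsub>N\<^esub>i\<in>{..<n}. c i \<odot>\<^bsub>N\<^esub> e i | c. c \<in> {..<n} \<rightarrow> carrier E}"
proof -
  obtain A where A: "finite A" "A \<subseteq> carrier N"
    "\<And>H. submodule H E N \<Longrightarrow> A \<subseteq> H \<Longrightarrow> H = carrier N"
    using assms unfolding finitely_generated_module_def by blast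
  obtain e where "bij_betw e {0..<card A} A"
    using ex_bij_betw_nat_finite[OF A(1)] by blast
  then have e: "e ` {..<card A} = A"
    by (simp add: bij_betw_def atLeast0LessThan)
  let ?H = "{\<Oplus>\<^bsub>N\<^esub>i\<in>{..<card A}. c i \<odot>\<^bsub>N\<^esub> e i | c. c \<in> {..<card A} \<rightarrow> carrier E}"
  have eN: "e i \<in> carrier N" if "i < card A" for i
    using e A(2) that by blast
  have "A \<subseteq> ?H"
  proof
    fix a assume "a \<in> A"
    then obtain j where j: "j < card A" "a = e j" using e by blast
    have "(\<Oplus>\<^bsub>N\<^esub>i\<in>{..<card A}. (if i = j then \<one> else \<zero>) \<odot>\<^bsub>N\<^esub> e i)
      = (\<Oplus>\<^bsub>N\<^esub>i\<in>{..<card A}. if j = i then e i else \<zero>\<^bsub>N\<^esub>)"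
      using eN by (intro N.finsum_cong') (auto simp: smult_one smult_zero_left)
    also have "\<dots> = a"
      using j eN by (subst N.finsum_singleton) auto
    finally show "a \<in> ?H"
      by (intro CollectI exI[of _ "\<lambda>i. if i = j then \<one> else \<zero>"]) auto
  qed
  then have "?H = carrier N"
    by (intro A(3)[OF submodule_combinations]) (rule eN)
  then show thesis
    by (intro that[of "card A" e]) (rule eN, assumption, rule sym)
qed

end

lemma left_module_transport:
  fixes E :: "('e, 'c) ring_scheme" and X :: "('e, 'b, 'd) module_scheme" and \<phi> :: "'b \<Rightarrow> 'u"
  assumes X: "left_module E X" and inj: "inj_on \<phi> (carrier X)"
  obtains Y :: "('e, 'u) module" where "left_module E Y"
    "restrict \<phi> (carrier X) \<in> linear_maps E X Y" "\<phi> ` carrier X = carrier Y"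
    "finitely_generated_module E X \<Longrightarrow> finitely_generated_module E Y"
proof -
  interpret left_module E X by fact
  define \<psi> where "\<psi> = inv_into (carrier X) \<phi>"
  have \<psi>\<phi> [simp]: "\<psi> (\<phi> x) = x" if "x \<in> carrier X" for x
    unfolding \<psi>_def using inj that by simp
  define Y :: "('e, 'u) module" where "Y = \<lparr>carrier = \<phi> ` carrier X,
    monoid.mult = undefined, monoid.one = undefined, ring.zero = \<phi> \<zero>\<^bsub>X\<^esub>,
    ring.add = (\<lambda>u v. \<phi> (\<psi> u \<oplus>\<^bsub>X\<^esub> \<psi> v)), smult = (\<lambda>r u. \<phi> (r \<odot>\<^bsub>X\<^esub> \<psi> u))\<rparr>"
  have Y [simp]: "carrier Y = \<phi> ` carrier X" "\<zero>\<^bsub>Y\<^esub> = \<phi> \<zero>\<^bsub>X\<^esub>"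
    "\<And>u v. u \<oplus>\<^bsub>Y\<^esub> v = \<phi> (\<psi> u \<oplus>\<^bsub>X\<^esub> \<psi> v)" "\<And>r u. r \<odot>\<^bsub>Y\<^esub> u = \<phi> (r \<odot>\<^bsub>X\<^esub> \<psi> u)"
    by (auto simp: Y_def)
  have abY: "abelian_group Y"
  proof (rule abelian_groupI, goal_cases)
    case (6 x)
    then obtain u where u: "x = \<phi> u" "u \<in> carrier X" by auto
    then show ?case
      by (intro bexI[of _ "\<phi> (\<ominus>\<^bsub>X\<^esub> u)"]) (auto simp: N.l_neg)
  qed (auto simp: N.a_assoc intro: arg_cong[OF N.a_comm])
  have lmY: "left_module E Y"
    by (intro left_module.intro left_module_axioms.intro abY)
      (auto simp: smult_closed smult_l_distr smult_r_distr smult_assoc smult_one E.ring_axioms)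
  have lin: "restrict \<phi> (carrier X) \<in> linear_maps E X Y"
    unfolding linear_maps_def by (auto simp: smult_closed)
  have fg: "finitely_generated_module E Y" if fgX: "finitely_generated_module E X"
  proof -
    obtain A where A: "finite A" "A \<subseteq> carrier X"
      "\<And>H. submodule H E X \<Longrightarrow> A \<subseteq> H \<Longrightarrow> H = carrier X"
      using fgX unfolding finitely_generated_module_def by blast
    have "H = carrier Y" if H: "submodule H E Y" and AH: "\<phi> ` A \<subseteq> H" for H
    proof -
      interpret Y: left_module E Y by fact
      interpret H: submodule H E Y by fact
      let ?K = "{x \<in> carrier X. \<phi> x \<in> H}"
      have hy: "\<ominus>\<^bsub>Y\<^esub> \<phi> x = \<phi> (\<ominus>\<^bsub>X\<^esub> x)" if "x \<in> carrier X" for x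
        using that by (intro Y.N.minus_equality) (auto simp: N.l_neg)
      have K: "submodule ?K E X"
      proof (intro submodule.intro subgroup.intro submodule_axioms.intro, goal_cases)
        case 1 show ?case by auto
      next
        case (2 x y) then show ?case using H.m_closed[of "\<phi> x" "\<phi> y"] by auto
      next
        case 3 show ?case using H.one_closed by auto
      next
        case (4 x)
        then have "\<ominus>\<^bsub>Y\<^esub> \<phi> x \<in> H"
          using H.m_inv_closed[of "\<phi> x"] by (simp only: a_inv_def mem_Collect_eq)
        moreover have "inv\<^bsub>add_monoid X\<^esub> x = \<ominus>\<^bsub>X\<^esub> x" by (simp only: a_inv_def)
        ultimately show ?case using 4 hy[of x] by simp
      next
        case (5 a x) then show ?case using H.smult_closed[of a "\<phi> x"]
          by (auto simp: smult_closed)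
      qed
      have "?K = carrier X" using A AH by (intro A(3)[OF K]) auto
      then have "carrier Y \<subseteq> H" by auto
      then show ?thesis using H.subset by auto
    qed
    then show ?thesis unfolding finitely_generated_module_def
      using A by (intro exI[of _ "\<phi> ` A"]) auto
  qed
  show thesis using that[OF lmY lin _ fg] by simp
qed

lemma finitely_generated_module_in_universe:
  fixes E :: "('e, 'c) ring_scheme" and X :: "('e, 'b, 'd) module_scheme"
  assumes X: "left_module E X" and fg: "finitely_generated_module E X"
  obtains Y :: "('e, 'e module_univ) module" and \<phi> where
    "left_module E Y" "finitely_generated_module E Y"
    "\<phi> \<in> linear_maps E X Y" "bij_betw \<phi> (carrier X) (carrier Y)"
proof -
  interpret left_module E X by fact
  obtain n :: nat and e where e: "\<And>i. i < n \<Longrightarrow> e i \<in> carrier X"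
    "carrier X = {\<Oplus>\<^bsub>X\<^esub>i\<in>{..<n}. c i \<odot>\<^bsub>X\<^esub> e i | c. c \<in> {..<n} \<rightarrow> carrier E}"
    using finitely_generated_imp_combinations[OF fg] by blast
  define \<phi> :: "'b \<Rightarrow> 'e module_univ"
    where "\<phi> x = {c \<in> {..<n} \<rightarrow> carrier E. (\<Oplus>\<^bsub>X\<^esub>i\<in>{..<n}. c i \<odot>\<^bsub>X\<^esub> e i) = x}" for x
  have "inj_on \<phi> (carrier X)"
  proof (rule inj_onI)
    fix x y assume x: "x \<in> carrier X" and eq: "\<phi> x = \<phi> y"
    obtain c where "c \<in> \<phi> x" using x unfolding e(2) \<phi>_def by blast
    then have "c \<in> \<phi> x" "c \<in> \<phi> y" using eq by auto
    then show "x = y" by (simp add: \<phi>_def)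
  qed
  from left_module_transport[OF X this] obtain Y :: "('e, 'e module_univ) module" where
    "left_module E Y" "restrict \<phi> (carrier X) \<in> linear_maps E X Y" "\<phi> ` carrier X = carrier Y"
    "finitely_generated_module E Y"
    using fg by metis
  with \<open>inj_on \<phi> (carrier X)\<close> show thesis
    by (intro that[of Y "restrict \<phi> (carrier X)"]) (auto simp: bij_betw_def inj_on_def)
qed

lemma module_iff_left_module: "cring R \<Longrightarrow> module R X \<longleftrightarrow> left_module R X"
  unfolding module_def left_module_def module_axioms_def left_module_axioms_def
  by (auto simp: cring_def)

lemma ring_End_ring:
  assumes M: "module R M"
  shows "ring (End_ring R M)"
proof -
  interpret module R M by fact
  have ab: "abelian_group (End_ring R M)"
  proof (rule abelian_groupI, goal_cases)
    case (6 f)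
    have "(\<lambda>m\<in>carrier M. \<ominus>\<^bsub>M\<^esub> f m) \<in> carrier (End_ring R M)"
      using 6 by (auto simp: End_ring_def linear_maps_def PiE_def Pi_def M.minus_add smult_r_minus)
    moreover have "(\<lambda>m\<in>carrier M. \<ominus>\<^bsub>M\<^esub> f m) \<oplus>\<^bsub>End_ring R M\<^esub> f = \<zero>\<^bsub>End_ring R M\<^esub>"
      using 6 by (auto simp: End_ring_def linear_maps_def PiE_def Pi_def M.l_neg fun_eq_iff)
    ultimately show ?case by blast
  qed (auto simp: End_ring_def linear_maps_def PiE_def Pi_def fun_eq_iff extensional_def
      restrict_def M.a_ac smult_r_distr M.minus_add)
  have mon: "monoid (End_ring R M)"
    by (rule monoidI)
      (auto simp: End_ring_def linear_maps_def PiE_def Pi_def fun_eq_iff extensional_def restrict_def)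
  show ?thesis
    by (rule ringI[OF ab mon])
      (auto simp: End_ring_def linear_maps_def PiE_def Pi_def fun_eq_iff extensional_def
      restrict_def)
qed

lemma left_module_dual:
  assumes M: "module R M"
  shows "left_module (End_ring R M) (dual_module R M)"
proof -
  interpret module R M by fact
  have ab: "abelian_group (dual_module R M)"
  proof (rule abelian_groupI, goal_cases)
    case (6 f)
    have "(\<lambda>m\<in>carrier M. \<ominus>\<^bsub>R\<^esub> f m) \<in> carrier (dual_module R M)"
      using 6 by (auto simp: dual_module_def regular_module_def linear_maps_def PiE_def Pi_def
          R.minus_add R.r_minus)
    moreover have "(\<lambda>m\<in>carrier M. \<ominus>\<^bsub>R\<^esub> f m) \<oplus>\<^bsub>dual_module R M\<^esub> f = \<zero>\<^bsub>dual_module R M\<^esub>"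
      using 6 by (auto simp: dual_module_def regular_module_def linear_maps_def PiE_def Pi_def
          R.l_neg fun_eq_iff)
    ultimately show ?case by blast
  qed (auto simp: dual_module_def regular_module_def linear_maps_def PiE_def Pi_def fun_eq_iff
      extensional_def restrict_def R.a_ac R.r_distr)
  show ?thesis
    by (intro left_module.intro left_module_axioms.intro ring_End_ring M ab)
      (auto simp: dual_module_def regular_module_def End_ring_def linear_maps_def PiE_def Pi_def
      fun_eq_iff extensional_def restrict_def)
qed

lemma free_Abelian_group_diff_closed:
  "\<lbrakk>x \<in> carrier (free_Abelian_group S); y \<in> carrier (free_Abelian_group S)\<rbrakk> \<Longrightarrow>
    x - y \<in> carrier (free_Abelian_group S)"
  using keys_diff[of x y] by auto

lemma tensor_relators_subset:
  assumes "\<And>m m'. \<lbrakk>m \<in> carrier M; m' \<in> carrier M\<rbrakk> \<Longrightarrow> m \<oplus>\<^bsub>M\<^esub> m' \<in> carrier M"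
    and "\<And>n n'. \<lbrakk>n \<in> carrier N; n' \<in> carrier N\<rbrakk> \<Longrightarrow> n \<oplus>\<^bsub>N\<^esub> n' \<in> carrier N"
    and "\<And>e m. \<lbrakk>e \<in> carrier E; m \<in> carrier M\<rbrakk> \<Longrightarrow> e \<odot>\<^bsub>M\<^esub> m \<in> carrier M"
    and "\<And>e n. \<lbrakk>e \<in> carrier E; n \<in> carrier N\<rbrakk> \<Longrightarrow> e \<odot>\<^bsub>N\<^esub> n \<in> carrier N"
  shows "tensor_relators E M N \<subseteq> carrier (free_Abelian_group (carrier M \<times> carrier N))"
  unfolding tensor_relators_def
  by (intro Un_least subsetI; elim CollectE exE conjE; hypsubst)
    (intro free_Abelian_group_diff_closed; simp add: assms)+

lemma ex1_natural_map:
  assumes M: "module R M"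
  shows "\<exists>!a. is_natural_map R M a"
proof -
  interpret module R M by fact
  let ?E = "End_ring R M" and ?M = "End_right_module M" and ?D = "dual_module R M"
  let ?S = "carrier ?M \<times> carrier ?D"
  let ?F = "free_Abelian_group ?S" and ?N = "tensor_kernel ?E ?M ?D"
  interpret D: left_module ?E ?D by (rule left_module_dual[OF M])
  interpret F: comm_group ?F by (rule abelian_free_Abelian_group)
  have cM [simp]: "carrier ?M = carrier M" "add ?M = add M" "\<And>e m. e \<odot>\<^bsub>?M\<^esub> m = e m"
    by (auto simp: End_right_module_def)
  have eM: "e m \<in> carrier M" if "e \<in> carrier ?E" "m \<in> carrier M" for e m
    using that by (auto simp: End_ring_def linear_maps_def)
  have fR: "f m \<in> carrier R" if "f \<in> carrier ?D" "m \<in> carrier M" for f m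
    using that by (auto simp: dual_module_def linear_maps_def regular_module_def)
  have rel: "tensor_relators ?E ?M ?D \<subseteq> carrier ?F"
    by (rule tensor_relators_subset) (auto simp: eM D.smult_closed)
  have sub: "subgroup ?N ?F"
    unfolding tensor_kernel_def by (rule F.generate_is_subgroup[OF rel])
  have nrm: "?N \<lhd> ?F" by (rule F.subgroup_imp_normal[OF sub])
  have "(\<lambda>(m, f). f m) ` ?S \<subseteq> carrier (add_monoid R)"
    using fR by auto
  then obtain h where h: "h \<in> hom ?F (add_monoid R)"
    "\<And>x. x \<in> ?S \<Longrightarrow> h (frag_of x) = (\<lambda>(m, f). f m) x"
    by (rule comm_group.free_Abelian_group_universal[OF R.a_comm_group]) blast
  interpret h: group_hom ?F "add_monoid R" h
    using h(1) by (simp add: group_hom_def group_hom_axioms_def R.a_group)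
  have hf: "h (frag_of (m, f)) = f m" if "m \<in> carrier M" "f \<in> carrier ?D" for m f
    using h(2)[of "(m, f)"] that by simp
  have hdiff: "h (x - y) = h x \<ominus>\<^bsub>R\<^esub> h y" if "x \<in> carrier ?F" "y \<in> carrier ?F" for x y
  proof -
    have "h (x \<otimes>\<^bsub>?F\<^esub> inv\<^bsub>?F\<^esub> y) = h x \<oplus>\<^bsub>R\<^esub> \<ominus>\<^bsub>R\<^esub> h y"
      using that h.hom_mult[of x "inv\<^bsub>?F\<^esub> y"] h.hom_inv[of y] F.inv_closed[of y]
      by (simp add: a_inv_def)
    then show ?thesis using that by (simp add: a_minus_def)
  qed
  have cd: "x - y \<in> carrier ?F" if "x \<in> carrier ?F" "y \<in> carrier ?F" for x y
    using that by (rule free_Abelian_group_diff_closed)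
  have fl: "f (m \<oplus>\<^bsub>M\<^esub> m') = f m \<oplus>\<^bsub>R\<^esub> f m'"
    if "f \<in> carrier ?D" "m \<in> carrier M" "m' \<in> carrier M" for f m m'
    using that by (auto simp: dual_module_def linear_maps_def regular_module_def)
  have da: "(f \<oplus>\<^bsub>?D\<^esub> g) m = f m \<oplus>\<^bsub>R\<^esub> g m" if "m \<in> carrier M" for f g m
    using that by (auto simp: dual_module_def)
  have ds: "(e \<odot>\<^bsub>?D\<^esub> f) m = f (e m)" if "m \<in> carrier M" for e f m
    using that by (auto simp: dual_module_def)
  have can: "a \<oplus>\<^bsub>R\<^esub> b \<ominus>\<^bsub>R\<^esub> a \<ominus>\<^bsub>R\<^esub> b = \<zero>\<^bsub>R\<^esub>" if "a \<in> carrier R" "b \<in> carrier R" for a b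
    using that by algebra
  have can2: "a \<ominus>\<^bsub>R\<^esub> a = \<zero>\<^bsub>R\<^esub>" if "a \<in> carrier R" for a
    using that by algebra
  have fc: "frag_of (m, f) \<in> carrier ?F" if "m \<in> carrier M" "f \<in> carrier ?D" for m f
    using that by simp
  have hd2: "h (x - y) = h x \<ominus>\<^bsub>R\<^esub> h y" "h (x - y - z) = h x \<ominus>\<^bsub>R\<^esub> h y \<ominus>\<^bsub>R\<^esub> h z"
    if "x = frag_of (m, f)" "m \<in> carrier M" "f \<in> carrier ?D"
      "y = frag_of (m', f')" "m' \<in> carrier M" "f' \<in> carrier ?D"
      "z = frag_of (m'', f'')" "m'' \<in> carrier M" "f'' \<in> carrier ?D" for x y z m f m' f' m'' f''
    using hdiff[of x y] hdiff[of "x - y" z] cd[of x y] fc that by auto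
  have "h x = \<zero>\<^bsub>R\<^esub>" if "x \<in> tensor_relators ?E ?M ?D" for x
    using that unfolding tensor_relators_def cM
  proof (elim UnE CollectE exE conjE, goal_cases)
    case (1 m m' f)
    then have "h x = h (frag_of (m \<oplus>\<^bsub>M\<^esub> m', f)) \<ominus>\<^bsub>R\<^esub> h (frag_of (m, f)) \<ominus>\<^bsub>R\<^esub> h (frag_of (m', f))"
      by (simp only: 1(1)) (rule hd2(2)[OF refl _ _ refl _ _ refl]; simp)
    then show ?case using 1 by (simp add: hf fl can fR)
  next
    case (2 m f f')
    then have "h x = h (frag_of (m, f \<oplus>\<^bsub>?D\<^esub> f')) \<ominus>\<^bsub>R\<^esub> h (frag_of (m, f)) \<ominus>\<^bsub>R\<^esub> h (frag_of (m, f'))"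
      by (simp only: 2(1)) (rule hd2(2)[OF refl _ _ refl _ _ refl]; simp)
    then show ?case using 2 by (simp add: hf da can fR)
  next
    case (3 e m f)
    then have "h x = h (frag_of (e m, f)) \<ominus>\<^bsub>R\<^esub> h (frag_of (m, e \<odot>\<^bsub>?D\<^esub> f))"
      by (simp only: 3(1)) (rule hd2(1)[OF refl _ _ refl _ _ refl]; simp add: eM D.smult_closed)
    then show ?case using 3 by (simp add: hf ds can2 fR eM D.smult_closed)
  qed
  then have "tensor_relators ?E ?M ?D \<subseteq> kernel ?F (add_monoid R) h"
    using rel unfolding kernel_def by (auto simp del: carrier_free_Abelian_group_iff cM)
  then have "?N \<subseteq> kernel ?F (add_monoid R) h"
    unfolding tensor_kernel_def by (rule F.generate_subgroup_incl[OF _ h.subgroup_kernel])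
  from h.FactGroup_universal_kernel[OF nrm this] obtain g where
    g: "g \<in> hom (?F Mod ?N) (add_monoid R)" "\<And>x. x \<in> carrier ?F \<Longrightarrow> g (?N #>\<^bsub>?F\<^esub> x) = h x"
    by metis
  let ?T = "dual_tensor R M"
  have T: "?T = ?F Mod ?N" by (simp add: dual_tensor_def tensor_product_def)
  have gT: "group ?T" unfolding T by (rule normal.factorgroup_is_group[OF nrm])
  show ?thesis
  proof (rule ex1I)
    have "restrict g (carrier ?T) \<in> hom ?T (add_monoid R)"
      using g(1) group.is_monoid[OF gT] unfolding T[symmetric]
      by (auto simp: hom_def Pi_def monoid.m_closed)
    moreover have "restrict g (carrier ?T) (pure_tensor ?E ?M ?D m f) = f m"
      if "m \<in> carrier M" "f \<in> carrier ?D" for m f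
    proof -
      have "pure_tensor ?E ?M ?D m f \<in> carrier ?T"
        unfolding T pure_tensor_def carrier_FactGroup using fc[OF that] by blast
      then show ?thesis using g(2)[OF fc[OF that]] hf[OF that] by (simp add: pure_tensor_def)
    qed
    ultimately show "is_natural_map R M (restrict g (carrier ?T))"
      by (simp add: is_natural_map_def)
  next
    fix a assume a: "is_natural_map R M a"
    interpret a: group_hom ?T "add_monoid R" a
      using a gT by (simp add: is_natural_map_def group_hom_def group_hom_axioms_def R.a_group)
    interpret g: group_hom ?T "add_monoid R" g
      using g(1) gT by (simp add: T group_hom_def group_hom_axioms_def R.a_group)
    have hm: "(\<lambda>x. ?N #>\<^bsub>?F\<^esub> x) \<in> hom ?F ?T"
      unfolding T by (rule normal.r_coset_hom_Mod[OF nrm])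
    interpret q: group_hom ?F ?T "\<lambda>x. ?N #>\<^bsub>?F\<^esub> x"
      using hm gT by (simp add: group_hom_def group_hom_axioms_def)
    have "a (?N #>\<^bsub>?F\<^esub> x) = h x" if "Poly_Mapping.keys x \<subseteq> ?S" for x
      using that
    proof (induction rule: free_Abelian_group_induct [consumes 1, case_names zero diff gen])
      case zero then show ?case using q.hom_one a.hom_one h.hom_one by simp
    next
      case (diff x y)
      have "a (?N #>\<^bsub>?F\<^esub> (x \<otimes>\<^bsub>?F\<^esub> inv\<^bsub>?F\<^esub> y)) = h (x \<otimes>\<^bsub>?F\<^esub> inv\<^bsub>?F\<^esub> y)"
      proof -
        have c: "x \<in> carrier ?F" "y \<in> carrier ?F" using diff by simp_all
        have qc: "?N #>\<^bsub>?F\<^esub> x \<in> carrier ?T" "?N #>\<^bsub>?F\<^esub> y \<in> carrier ?T"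
          using q.hom_closed c by blast+
        have "a (?N #>\<^bsub>?F\<^esub> (x \<otimes>\<^bsub>?F\<^esub> inv\<^bsub>?F\<^esub> y))
          = a (?N #>\<^bsub>?F\<^esub> x) \<otimes>\<^bsub>add_monoid R\<^esub> inv\<^bsub>add_monoid R\<^esub> a (?N #>\<^bsub>?F\<^esub> y)"
          using c qc by (metis F.inv_closed q.hom_mult q.hom_inv a.hom_mult a.hom_inv a.G.inv_closed)
        also have "\<dots> = h x \<otimes>\<^bsub>add_monoid R\<^esub> inv\<^bsub>add_monoid R\<^esub> h y" using diff by simp
        also have "\<dots> = h (x \<otimes>\<^bsub>?F\<^esub> inv\<^bsub>?F\<^esub> y)"
          using c by (metis F.inv_closed h.hom_mult h.hom_inv)
        finally show ?thesis .
      qed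
      then show ?case using diff by simp
    next
      case (gen p)
      obtain m f where p: "p = (m, f)" by (cases p)
      with gen have mf: "m \<in> carrier M" "f \<in> carrier ?D" by auto
      then have "a (pure_tensor ?E ?M ?D m f) = f m" using a by (simp add: is_natural_map_def)
      then show ?case using hf[OF mf] by (simp add: p pure_tensor_def)
    qed
    then have "a t = g t" if "t \<in> carrier ?T" for t
      using that g(2) by (auto simp: T carrier_FactGroup)
    then show "a = restrict g (carrier ?T)"
      using a by (intro extensionalityI[of _ "carrier ?T"]) (auto simp: is_natural_map_def)
  qed
qed

lemma comm_group_K0:
  assumes "cring R"
  shows "comm_group (K0 R)"
proof -
  interpret F: comm_group "free_Abelian_group (fg_modules R)"
    by (rule abelian_free_Abelian_group)
  have "K0_relators R \<subseteq> carrier (free_Abelian_group (fg_modules R))"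
  proof
    fix x assume "x \<in> K0_relators R"
    then obtain X Y Z where "x = frag_of Y - frag_of X - frag_of Z"
      "X \<in> fg_modules R" "Y \<in> fg_modules R" "Z \<in> fg_modules R"
      unfolding K0_relators_def by blast
    then show "x \<in> carrier (free_Abelian_group (fg_modules R))"
      using keys_diff[of "frag_of Y - frag_of X" "frag_of Z"] keys_diff[of "frag_of Y" "frag_of X"]
      by auto
  qed
  then show ?thesis
    unfolding K0_def K0_kernel_def by (intro F.abelian_FactGroup F.generate_is_subgroup)
qed

end

theory Submission
  imports Defs
begin

text \<open>
  Write \<open>E = End\<^sub>R(M)\<close>, let \<open>G\<close> be the quotient of \<open>K\<^sub>0(R)\<close> by the classes of the modules supported in the
  non-generating locus, and write \<open>[X]\<close> for the class of \<open>X\<close> in \<open>G\<close>. For every module \<open>X\<close>, the group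
  \<open>Hom\<^sub>R(M,X)\<close> is a left \<open>E\<close>-module. Let \<open>add M\<close> consist of the direct summands of the powers of \<open>M\<close>.

  The locus enters through one fact. A finitely generated module killed by the trace ideal of \<open>M\<close>, which is
  the image of \<open>a\<^sub>M\<close>, is supported in the locus, so that its class in \<open>G\<close> vanishes
  (\<open>trace_annihilates_C_NG\<close>). If \<open>p : Y \<rightarrow> X\<close> induces a surjection on \<open>Hom\<^sub>R(M,_)\<close>, then the trace ideal
  kills the cokernel of \<open>p\<close>, because for \<open>f : M \<rightarrow> R\<close> and \<open>x\<close> in \<open>X\<close> the map \<open>m \<mapsto> f(m)x\<close> lifts along \<open>p\<close>.
  Hence \<open>[Y] = [ker p] + [X]\<close>, as if \<open>p\<close> were surjective (\<open>cl_approximation\<close>).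

  The group \<open>G\<close> is generated by the classes of modules in \<open>add M\<close>. Over a noetherian ring every finitely
  generated \<open>X\<close> receives such a map \<open>p\<close> from a module \<open>Y\<close> of \<open>add M\<close>. Iterating this with kernels
  resolves \<open>Hom\<^sub>R(M,X)\<close> by modules \<open>Hom\<^sub>R(M,Y)\<close>, which are projective. As the global dimension of \<open>E\<close> is
  finite, after finitely many steps the approximation splits after applying \<open>Hom\<^sub>R(M,_)\<close>, and the last kernel
  has the class of a module in \<open>add M\<close> (\<open>cl_in_subgroup_if_resolution\<close>).

  Finitely many modules in \<open>add M\<close> suffice. Since \<open>R\<close> is semilocal and \<open>E\<close> is finite over \<open>R\<close>, there are only
  finitely many simple \<open>E\<close>-modules up to isomorphism, and the largest semisimple quotient of \<open>Hom\<^sub>R(M,W)\<close> is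
  described by a vector of finitely many multiplicities. If the vector of \<open>V\<close> is bounded by that of \<open>W\<close>,
  then the semisimple quotient of \<open>Hom\<^sub>R(M,W)\<close> maps onto that of \<open>Hom\<^sub>R(M,V)\<close>. This map lifts to a map
  \<open>W \<rightarrow> V\<close> that is surjective on \<open>Hom\<^sub>R(M,_)\<close> by Nakayama and hence splits
  (\<open>surjection_if_types_match\<close>, \<open>section_if_Hom_surjective\<close>). By Dickson's lemma there are finitely many
  modules one of which splits off from any given nonzero module in \<open>add M\<close>; splitting off repeatedly
  ends because \<open>W\<close> is noetherian (\<open>cl_add_M_finitely_generated\<close>).
\<close>


section \<open>Linear maps, submodules and quotients\<close>

text \<open>
  Without the extensionality of \<open>linear_maps\<close>, linear maps can be written as plain \<open>\<lambda>\<close>-terms and composed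
  without restricting them to carriers.
\<close>

definition linear_map ::
  "('a, 'c) ring_scheme \<Rightarrow> ('a, 'b, 'd) module_scheme \<Rightarrow> ('a, 'e, 'f) module_scheme \<Rightarrow> ('b \<Rightarrow> 'e) \<Rightarrow> bool"
  where "linear_map R X Y f \<longleftrightarrow>
    (\<forall>x\<in>carrier X. f x \<in> carrier Y) \<and>
    (\<forall>x\<in>carrier X. \<forall>y\<in>carrier X. f (x \<oplus>\<^bsub>X\<^esub> y) = f x \<oplus>\<^bsub>Y\<^esub> f y) \<and>
    (\<forall>r\<in>carrier R. \<forall>x\<in>carrier X. f (r \<odot>\<^bsub>X\<^esub> x) = r \<odot>\<^bsub>Y\<^esub> f x)"

lemma linear_mapI:
  assumes "\<And>x. x \<in> carrier X \<Longrightarrow> f x \<in> carrier Y"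
    and "\<And>x y. \<lbrakk>x \<in> carrier X; y \<in> carrier X\<rbrakk> \<Longrightarrow> f (x \<oplus>\<^bsub>X\<^esub> y) = f x \<oplus>\<^bsub>Y\<^esub> f y"
    and "\<And>r x. \<lbrakk>r \<in> carrier R; x \<in> carrier X\<rbrakk> \<Longrightarrow> f (r \<odot>\<^bsub>X\<^esub> x) = r \<odot>\<^bsub>Y\<^esub> f x"
  shows "linear_map R X Y f"
  using assms by (simp add: linear_map_def)

lemma linear_mapD:
  assumes "linear_map R X Y f"
  shows "x \<in> carrier X \<Longrightarrow> f x \<in> carrier Y"
    and "\<lbrakk>x \<in> carrier X; y \<in> carrier X\<rbrakk> \<Longrightarrow> f (x \<oplus>\<^bsub>X\<^esub> y) = f x \<oplus>\<^bsub>Y\<^esub> f y"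
    and "\<lbrakk>r \<in> carrier R; x \<in> carrier X\<rbrakk> \<Longrightarrow> f (r \<odot>\<^bsub>X\<^esub> x) = r \<odot>\<^bsub>Y\<^esub> f x"
  using assms by (simp_all add: linear_map_def)

lemma linear_maps_iff:
  "f \<in> linear_maps R X Y \<longleftrightarrow> linear_map R X Y f \<and> f \<in> extensional (carrier X)"
  by (auto simp: linear_maps_def linear_map_def PiE_def)

lemma linear_maps_imp_linear_map: "f \<in> linear_maps R X Y \<Longrightarrow> linear_map R X Y f"
  by (simp add: linear_maps_iff)

context left_module
begin

text \<open>
  Closure under negation follows, as negation is multiplication by \<open>-1\<close>.
\<close>

lemma submodule_iff:
  "submodule H E N \<longleftrightarrow> H \<subseteq> carrier N \<and> \<zero>\<^bsub>N\<^esub> \<in> H \<and> (\<forall>x\<in>H. \<forall>y\<in>H. x \<oplus>\<^bsub>N\<^esub> y \<in> H) \<and>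
    (\<forall>a\<in>carrier E. \<forall>x\<in>H. a \<odot>\<^bsub>N\<^esub> x \<in> H)" (is "?L \<longleftrightarrow> ?R")
proof
  assume ?L
  then interpret submodule H E N .
  show ?R using subset one_closed m_closed smult_closed by auto
next
  assume R: ?R
  have "inv\<^bsub>add_monoid N\<^esub> x \<in> H" if "x \<in> H" for x
  proof -
    have "inv\<^bsub>add_monoid N\<^esub> x = (\<ominus> \<one>) \<odot>\<^bsub>N\<^esub> x"
      using R that smult_minus_one[of x] by (auto simp: a_inv_def)
    then show ?thesis using R that by simp
  qed
  then show ?L
    using R by (intro submodule.intro subgroup.intro submodule_axioms.intro) auto
qed

lemma submoduleI:
  assumes "H \<subseteq> carrier N" "\<zero>\<^bsub>N\<^esub> \<in> H" "\<And>x y. \<lbrakk>x \<in> H; y \<in> H\<rbrakk> \<Longrightarrow> x \<oplus>\<^bsub>N\<^esub> y \<in> H"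
    "\<And>a x. \<lbrakk>a \<in> carrier E; x \<in> H\<rbrakk> \<Longrightarrow> a \<odot>\<^bsub>N\<^esub> x \<in> H"
  shows "submodule H E N"
  using assms by (simp add: submodule_iff)

lemma submoduleD:
  assumes "submodule H E N"
  shows "H \<subseteq> carrier N" "x \<in> H \<Longrightarrow> x \<in> carrier N" "\<zero>\<^bsub>N\<^esub> \<in> H" "\<lbrakk>x \<in> H; y \<in> H\<rbrakk> \<Longrightarrow> x \<oplus>\<^bsub>N\<^esub> y \<in> H"
    "\<lbrakk>a \<in> carrier E; x \<in> H\<rbrakk> \<Longrightarrow> a \<odot>\<^bsub>N\<^esub> x \<in> H" "x \<in> H \<Longrightarrow> \<ominus>\<^bsub>N\<^esub> x \<in> H"
    "\<lbrakk>x \<in> H; y \<in> H\<rbrakk> \<Longrightarrow> x \<ominus>\<^bsub>N\<^esub> y \<in> H"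
proof -
  show *: "H \<subseteq> carrier N" "\<zero>\<^bsub>N\<^esub> \<in> H" "\<lbrakk>x \<in> H; y \<in> H\<rbrakk> \<Longrightarrow> x \<oplus>\<^bsub>N\<^esub> y \<in> H"
    "\<lbrakk>a \<in> carrier E; x \<in> H\<rbrakk> \<Longrightarrow> a \<odot>\<^bsub>N\<^esub> x \<in> H" "x \<in> H \<Longrightarrow> x \<in> carrier N" for x y a
    using assms by (auto simp: submodule_iff)
  show n: "\<ominus>\<^bsub>N\<^esub> x \<in> H" if "x \<in> H" for x
    using *(4)[of "\<ominus> \<one>" x] *(1) that smult_minus_one[of x] by auto
  show "x \<ominus>\<^bsub>N\<^esub> y \<in> H" if "x \<in> H" "y \<in> H" for x y
    using *(3)[OF that(1) n[OF that(2)]] by (simp add: a_minus_def)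
qed

lemma submodule_carrier: "submodule (carrier N) E N"
  by (rule submoduleI) (auto simp: smult_closed)

lemma submodule_zero: "submodule {\<zero>\<^bsub>N\<^esub>} E N"
  by (rule submoduleI) (auto simp: smult_zero_right)

lemma submodule_Inter:
  assumes "\<And>H. H \<in> S \<Longrightarrow> submodule H E N"
  shows "submodule (carrier N \<inter> \<Inter>S) E N"
  by (rule submoduleI) (use assms submoduleD in \<open>auto simp: smult_closed\<close>)

lemma submodule_Int: "\<lbrakk>submodule H E N; submodule K E N\<rbrakk> \<Longrightarrow> submodule (H \<inter> K) E N"
  by (rule submoduleI) (use submoduleD in \<open>auto simp: smult_closed\<close>)

lemma submodule_sum:
  assumes "submodule H E N" "submodule K E N"
  shows "submodule {x \<oplus>\<^bsub>N\<^esub> y | x y. x \<in> H \<and> y \<in> K} E N"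
proof (rule submoduleI, goal_cases)
  case 1 then show ?case using submoduleD(2)[OF assms(1)] submoduleD(2)[OF assms(2)] by auto
next
  case 2 then show ?case
    using submoduleD(3)[OF assms(1)] submoduleD(3)[OF assms(2)] N.l_zero[OF N.zero_closed] by force
next
  case (3 x y)
  then obtain a b c d where *: "x = a \<oplus>\<^bsub>N\<^esub> b" "y = c \<oplus>\<^bsub>N\<^esub> d" "a \<in> H" "c \<in> H" "b \<in> K" "d \<in> K" by blast
  then have "a \<in> carrier N" "b \<in> carrier N" "c \<in> carrier N" "d \<in> carrier N"
    using submoduleD(2)[OF assms(1)] submoduleD(2)[OF assms(2)] by auto
  then have "x \<oplus>\<^bsub>N\<^esub> y = (a \<oplus>\<^bsub>N\<^esub> c) \<oplus>\<^bsub>N\<^esub> (b \<oplus>\<^bsub>N\<^esub> d)" by (simp add: * N.a_ac)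
  then show ?case using * submoduleD(4)[OF assms(1)] submoduleD(4)[OF assms(2)] by blast
next
  case (4 e x)
  then obtain a b where *: "x = a \<oplus>\<^bsub>N\<^esub> b" "a \<in> H" "b \<in> K" by blast
  then have "e \<odot>\<^bsub>N\<^esub> x = e \<odot>\<^bsub>N\<^esub> a \<oplus>\<^bsub>N\<^esub> e \<odot>\<^bsub>N\<^esub> b"
    using 4 submoduleD(2)[OF assms(1)] submoduleD(2)[OF assms(2)] by (simp add: smult_r_distr)
  then show ?case using * 4 submoduleD(5)[OF assms(1)] submoduleD(5)[OF assms(2)] by blast
qed

lemma left_module_submodule:
  assumes H: "submodule H E N"
  shows "left_module E (N\<lparr>carrier := H\<rparr>)"
proof -
  have "abelian_group (N\<lparr>carrier := H\<rparr>)"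
  proof (rule abelian_groupI, goal_cases)
    case (6 x) then show ?case
      using submoduleD[OF H] by (intro bexI[of _ "\<ominus>\<^bsub>N\<^esub> x"]) (auto simp: N.l_neg)
  qed (use submoduleD[OF H] in \<open>auto simp: N.a_ac\<close>)
  then show ?thesis
    by (intro left_module.intro left_module_axioms.intro E.ring_axioms)
      (use submoduleD[OF H] in \<open>auto simp: smult_l_distr smult_r_distr smult_assoc smult_one\<close>)
qed

lemma submodule_submodule_iff:
  assumes H: "submodule H E N"
  shows "submodule K E (N\<lparr>carrier := H\<rparr>) \<longleftrightarrow> submodule K E N \<and> K \<subseteq> H"
  using left_module.submodule_iff[OF left_module_submodule[OF H], of K] submodule_iff[of K]
    submoduleD[OF H] by auto

lemma add_neg_cancel: "\<lbrakk>x \<in> carrier N; y \<in> carrier N\<rbrakk> \<Longrightarrow> x \<oplus>\<^bsub>N\<^esub> (y \<oplus>\<^bsub>N\<^esub> \<ominus>\<^bsub>N\<^esub> x) = y"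
  by (subst N.a_lcomm) (simp_all add: N.r_neg)

lemma minus_add_cancel: "\<lbrakk>x \<in> carrier N; y \<in> carrier N\<rbrakk> \<Longrightarrow> x \<ominus>\<^bsub>N\<^esub> y \<oplus>\<^bsub>N\<^esub> y = x"
  by (simp add: a_minus_def N.a_assoc N.l_neg)

lemma minus_eq_zero_iff: "\<lbrakk>x \<in> carrier N; y \<in> carrier N\<rbrakk> \<Longrightarrow> x \<ominus>\<^bsub>N\<^esub> y = \<zero>\<^bsub>N\<^esub> \<longleftrightarrow> x = y"
  using minus_add_cancel[of x y] by (auto simp: a_minus_def N.r_neg)

lemma add_minus_cancel: "\<lbrakk>x \<in> carrier N; y \<in> carrier N\<rbrakk> \<Longrightarrow> y \<oplus>\<^bsub>N\<^esub> (x \<ominus>\<^bsub>N\<^esub> y) = x"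
  by (metis minus_add_cancel N.a_comm N.minus_closed)

lemma add_diff_left: "\<lbrakk>x \<in> carrier N; y \<in> carrier N\<rbrakk> \<Longrightarrow> x \<oplus>\<^bsub>N\<^esub> y \<ominus>\<^bsub>N\<^esub> x = y"
  by (simp add: a_minus_def N.a_assoc add_neg_cancel)

lemma smult_minus_right:
  "\<lbrakk>a \<in> carrier E; x \<in> carrier N\<rbrakk> \<Longrightarrow> a \<odot>\<^bsub>N\<^esub> (\<ominus>\<^bsub>N\<^esub> x) = \<ominus>\<^bsub>N\<^esub> (a \<odot>\<^bsub>N\<^esub> x)"
  by (rule N.minus_equality[symmetric])
    (simp_all add: smult_closed N.l_neg smult_zero_right flip: smult_r_distr)

lemma smult_minus_left:
  "\<lbrakk>a \<in> carrier E; x \<in> carrier N\<rbrakk> \<Longrightarrow> (\<ominus> a) \<odot>\<^bsub>N\<^esub> x = \<ominus>\<^bsub>N\<^esub> (a \<odot>\<^bsub>N\<^esub> x)"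
  by (rule N.minus_equality[symmetric])
    (simp_all add: smult_closed E.l_neg smult_zero_left flip: smult_l_distr)

lemma smult_diff_right:
  "\<lbrakk>a \<in> carrier E; x \<in> carrier N; y \<in> carrier N\<rbrakk> \<Longrightarrow>
    a \<odot>\<^bsub>N\<^esub> (x \<ominus>\<^bsub>N\<^esub> y) = a \<odot>\<^bsub>N\<^esub> x \<ominus>\<^bsub>N\<^esub> a \<odot>\<^bsub>N\<^esub> y"
  by (simp add: a_minus_def smult_r_distr smult_minus_right)

lemma smult_diff_left:
  "\<lbrakk>a \<in> carrier E; b \<in> carrier E; x \<in> carrier N\<rbrakk> \<Longrightarrow>
    (a \<ominus> b) \<odot>\<^bsub>N\<^esub> x = a \<odot>\<^bsub>N\<^esub> x \<ominus>\<^bsub>N\<^esub> b \<odot>\<^bsub>N\<^esub> x"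
  by (simp add: a_minus_def smult_l_distr smult_minus_left)

text \<open>
  The condition \<open>x \<ominus> y \<in> B\<close> is the equation of \<open>x\<close> and \<open>y\<close> in \<open>N/B\<close>. The following rules replace computations
  in the quotient module.
\<close>

lemma cong_sym:
  assumes "submodule B E N" "x \<in> carrier N" "y \<in> carrier N" "x \<ominus>\<^bsub>N\<^esub> y \<in> B"
  shows "y \<ominus>\<^bsub>N\<^esub> x \<in> B"
proof -
  have "\<ominus>\<^bsub>N\<^esub> (x \<ominus>\<^bsub>N\<^esub> y) = y \<ominus>\<^bsub>N\<^esub> x"
    using assms by (simp add: a_minus_def N.minus_add N.a_comm)
  then show ?thesis using submoduleD(6)[OF assms(1,4)] by simp
qed

lemma cong_trans:
  assumes "submodule B E N" "x \<in> carrier N" "y \<in> carrier N" "u \<in> carrier N"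
    "x \<ominus>\<^bsub>N\<^esub> y \<in> B" "y \<ominus>\<^bsub>N\<^esub> u \<in> B"
  shows "x \<ominus>\<^bsub>N\<^esub> u \<in> B"
proof -
  have "(x \<ominus>\<^bsub>N\<^esub> y) \<oplus>\<^bsub>N\<^esub> (y \<ominus>\<^bsub>N\<^esub> u) = x \<ominus>\<^bsub>N\<^esub> u"
    using assms(2-4) by (simp add: a_minus_def N.a_assoc N.r_neg1 N.r_neg2)
  then show ?thesis using submoduleD(4)[OF assms(1,5,6)] by simp
qed

lemma cong_add:
  assumes "submodule B E N" "x \<in> carrier N" "y \<in> carrier N" "u \<in> carrier N" "v \<in> carrier N"
    "x \<ominus>\<^bsub>N\<^esub> y \<in> B" "u \<ominus>\<^bsub>N\<^esub> v \<in> B"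
  shows "(x \<oplus>\<^bsub>N\<^esub> u) \<ominus>\<^bsub>N\<^esub> (y \<oplus>\<^bsub>N\<^esub> v) \<in> B"
proof -
  have "(x \<ominus>\<^bsub>N\<^esub> y) \<oplus>\<^bsub>N\<^esub> (u \<ominus>\<^bsub>N\<^esub> v) = (x \<oplus>\<^bsub>N\<^esub> u) \<ominus>\<^bsub>N\<^esub> (y \<oplus>\<^bsub>N\<^esub> v)"
    using assms(2-5) by (simp add: a_minus_def N.a_ac N.minus_add)
  then show ?thesis using submoduleD(4)[OF assms(1,6,7)] by simp
qed

lemma cong_mem:
  assumes "submodule B E N" "x \<in> carrier N" "y \<in> carrier N" "x \<ominus>\<^bsub>N\<^esub> y \<in> B"
  shows "x \<in> B \<longleftrightarrow> y \<in> B"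
proof
  assume "x \<in> B"
  then have "x \<ominus>\<^bsub>N\<^esub> (x \<ominus>\<^bsub>N\<^esub> y) \<in> B" by (rule submoduleD(7)[OF assms(1) _ assms(4)])
  moreover have "x \<ominus>\<^bsub>N\<^esub> (x \<ominus>\<^bsub>N\<^esub> y) = y"
    using assms(2,3) by (simp add: a_minus_def N.minus_add flip: N.a_assoc) (simp add: N.r_neg)
  ultimately show "y \<in> B" by simp
next
  assume "y \<in> B"
  then show "x \<in> B" using submoduleD(4)[OF assms(1,4)] minus_add_cancel[OF assms(2,3)] by metis
qed

lemma cong_smult:
  assumes "submodule B E N" "x \<in> carrier N" "y \<in> carrier N" "a \<in> carrier E" "x \<ominus>\<^bsub>N\<^esub> y \<in> B"
  shows "a \<odot>\<^bsub>N\<^esub> x \<ominus>\<^bsub>N\<^esub> a \<odot>\<^bsub>N\<^esub> y \<in> B"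
  using submoduleD(5)[OF assms(1) assms(4,5)] assms(2-4) by (simp add: smult_diff_right)

lemma cong_refl: "\<lbrakk>submodule B E N; x \<in> carrier N\<rbrakk> \<Longrightarrow> x \<ominus>\<^bsub>N\<^esub> x \<in> B"
  by (simp add: a_minus_def N.r_neg submoduleD(3))

text \<open>
  Realising \<open>N/H\<close> on representatives keeps the type of elements, so that quotients do not leave a fixed universe
  of modules.
\<close>

lemma ex_quotient:
  assumes H: "submodule H E N"
  obtains Q :: "('e, 'n) module" and q where "left_module E Q" "linear_map E N Q q"
    "q ` carrier N = carrier Q" "\<And>x. x \<in> carrier N \<Longrightarrow> q x = \<zero>\<^bsub>Q\<^esub> \<longleftrightarrow> x \<in> H"
proof -
  define q where "q x = (SOME y. y \<in> carrier N \<and> y \<ominus>\<^bsub>N\<^esub> x \<in> H)" for x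
  have q: "q x \<in> carrier N" "q x \<ominus>\<^bsub>N\<^esub> x \<in> H" if "x \<in> carrier N" for x
    using someI[of "\<lambda>y. y \<in> carrier N \<and> y \<ominus>\<^bsub>N\<^esub> x \<in> H" x] that cong_refl[OF H that]
    by (auto simp: q_def)
  have qe: "q x = q y" if "x \<in> carrier N" "y \<in> carrier N" "x \<ominus>\<^bsub>N\<^esub> y \<in> H" for x y
  proof -
    have "(u \<in> carrier N \<and> u \<ominus>\<^bsub>N\<^esub> x \<in> H) = (u \<in> carrier N \<and> u \<ominus>\<^bsub>N\<^esub> y \<in> H)" for u
      using cong_trans[OF H, of u x y] cong_trans[OF H, of u y x] cong_sym[OF H, of x y] that by auto
    then show ?thesis by (simp add: q_def)
  qed
  have qq: "q (q x \<oplus>\<^bsub>N\<^esub> q y) = q (x \<oplus>\<^bsub>N\<^esub> y)" if "x \<in> carrier N" "y \<in> carrier N" for x y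
    using that q cong_add[OF H, of "q x" x "q y" y] by (intro qe) auto
  have qs: "q (a \<odot>\<^bsub>N\<^esub> q x) = q (a \<odot>\<^bsub>N\<^esub> x)" if "x \<in> carrier N" "a \<in> carrier E" for x a
    using that q cong_smult[OF H, of "q x" x a] by (intro qe) (auto simp: smult_closed)
  have qid: "q (q x) = q x" if "x \<in> carrier N" for x using that q by (intro qe) auto
  define Q :: "('e, 'n) module" where "Q = \<lparr>carrier = q ` carrier N,
    monoid.mult = undefined, monoid.one = undefined, ring.zero = q \<zero>\<^bsub>N\<^esub>,
    ring.add = (\<lambda>u v. q (u \<oplus>\<^bsub>N\<^esub> v)), smult = (\<lambda>r u. q (r \<odot>\<^bsub>N\<^esub> u))\<rparr>"
  have Q [simp]: "carrier Q = q ` carrier N" "\<zero>\<^bsub>Q\<^esub> = q \<zero>\<^bsub>N\<^esub>"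
    "\<And>u v. u \<oplus>\<^bsub>Q\<^esub> v = q (u \<oplus>\<^bsub>N\<^esub> v)" "\<And>r u. r \<odot>\<^bsub>Q\<^esub> u = q (r \<odot>\<^bsub>N\<^esub> u)"
    by (auto simp: Q_def)
  have qss: "q (a \<odot>\<^bsub>N\<^esub> q x \<oplus>\<^bsub>N\<^esub> b \<odot>\<^bsub>N\<^esub> q x) = q (a \<odot>\<^bsub>N\<^esub> x \<oplus>\<^bsub>N\<^esub> b \<odot>\<^bsub>N\<^esub> x)"
    "q (a \<odot>\<^bsub>N\<^esub> (b \<odot>\<^bsub>N\<^esub> q x)) = q (a \<odot>\<^bsub>N\<^esub> (b \<odot>\<^bsub>N\<^esub> x))"
    if "x \<in> carrier N" "a \<in> carrier E" "b \<in> carrier E" for x a b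
    using that q qs[of x "a \<oplus> b"] qs[of x "a \<otimes> b"]
    by (auto simp: smult_l_distr smult_assoc)
  have qqr: "q (x \<oplus>\<^bsub>N\<^esub> q y) = q (x \<oplus>\<^bsub>N\<^esub> y)" "q (q x \<oplus>\<^bsub>N\<^esub> y) = q (x \<oplus>\<^bsub>N\<^esub> y)"
    if "x \<in> carrier N" "y \<in> carrier N" for x y
    using that qq[of x "q y"] qq[of x y] qq[of "q x" y] q qid by auto
  have "abelian_group Q"
  proof (rule abelian_groupI, goal_cases)
    case (6 x)
    then obtain u where u: "x = q u" "u \<in> carrier N" by auto
    then show ?case
      using q qq by (intro bexI[of _ "q (\<ominus>\<^bsub>N\<^esub> u)"]) (auto simp: N.l_neg)
  next
    case (3 x y z)
    then show ?case using q by (auto simp: qqr N.a_assoc)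
  qed (use q qid qqr in \<open>auto simp: N.a_comm\<close>)
  then have "left_module E Q"
    by (intro left_module.intro left_module_axioms.intro E.ring_axioms)
      (use q in \<open>auto simp: smult_closed qqr qid qs qss smult_l_distr smult_r_distr smult_assoc smult_one\<close>)
  moreover have "linear_map E N Q q"
    by (rule linear_mapI) (auto simp: qqr qs q)
  moreover have "q x = \<zero>\<^bsub>Q\<^esub> \<longleftrightarrow> x \<in> H" if x: "x \<in> carrier N" for x
  proof
    assume "q x = \<zero>\<^bsub>Q\<^esub>"
    then have "q \<zero>\<^bsub>N\<^esub> \<ominus>\<^bsub>N\<^esub> x \<in> H" using q[OF x] by simp
    then have "q \<zero>\<^bsub>N\<^esub> \<in> H \<longleftrightarrow> x \<in> H" using x q by (intro cong_mem[OF H]) auto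
    moreover have "q \<zero>\<^bsub>N\<^esub> \<in> H \<longleftrightarrow> \<zero>\<^bsub>N\<^esub> \<in> H" using q by (intro cong_mem[OF H]) auto
    ultimately show "x \<in> H" using submoduleD(3)[OF H] by simp
  next
    assume "x \<in> H"
    then have "x \<ominus>\<^bsub>N\<^esub> \<zero>\<^bsub>N\<^esub> \<in> H" using submoduleD(3,7)[OF H] by blast
    then show "q x = \<zero>\<^bsub>Q\<^esub>" using x qe[of x "\<zero>\<^bsub>N\<^esub>"] by simp
  qed
  ultimately show thesis using that[of Q q] by simp
qed

end

lemma linear_map_zero:
  assumes "left_module R X" "left_module R Y" "linear_map R X Y f"
  shows "f \<zero>\<^bsub>X\<^esub> = \<zero>\<^bsub>Y\<^esub>"
proof -
  interpret X: left_module R X by fact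
  interpret Y: left_module R Y by fact
  have "f (\<zero>\<^bsub>R\<^esub> \<odot>\<^bsub>X\<^esub> \<zero>\<^bsub>X\<^esub>) = \<zero>\<^bsub>R\<^esub> \<odot>\<^bsub>Y\<^esub> f \<zero>\<^bsub>X\<^esub>"
    by (rule linear_mapD(3)[OF assms(3)]) auto
  then show ?thesis using linear_mapD(1)[OF assms(3)]
    by (simp add: X.smult_zero_left Y.smult_zero_left)
qed

lemma linear_map_minus:
  assumes "left_module R X" "left_module R Y" "linear_map R X Y f" "x \<in> carrier X"
  shows "f (\<ominus>\<^bsub>X\<^esub> x) = \<ominus>\<^bsub>Y\<^esub> f x"
proof -
  interpret X: left_module R X by fact
  interpret Y: left_module R Y by fact
  have "f ((\<ominus>\<^bsub>R\<^esub> \<one>\<^bsub>R\<^esub>) \<odot>\<^bsub>X\<^esub> x) = (\<ominus>\<^bsub>R\<^esub> \<one>\<^bsub>R\<^esub>) \<odot>\<^bsub>Y\<^esub> f x"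
    by (rule linear_mapD(3)[OF assms(3) _ assms(4)]) auto
  then show ?thesis using linear_mapD(1)[OF assms(3)] assms(4)
    by (simp add: X.smult_minus_one Y.smult_minus_one)
qed

lemma linear_map_diff:
  assumes "left_module R X" "left_module R Y" "linear_map R X Y f" "x \<in> carrier X" "y \<in> carrier X"
  shows "f (x \<ominus>\<^bsub>X\<^esub> y) = f x \<ominus>\<^bsub>Y\<^esub> f y"
proof -
  interpret X: left_module R X by fact
  show ?thesis
    using assms(4,5) by (simp add: a_minus_def linear_mapD(2)[OF assms(3)] linear_map_minus[OF assms(1-3)])
qed

lemma linear_map_comp:
  "\<lbrakk>linear_map R X Y f; linear_map R Y Z g\<rbrakk> \<Longrightarrow> linear_map R X Z (\<lambda>x. g (f x))"
  by (simp add: linear_map_def)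

lemma linear_map_cong:
  assumes "left_module R X" "linear_map R X Y f" "\<And>x. x \<in> carrier X \<Longrightarrow> g x = f x"
  shows "linear_map R X Y g"
proof -
  interpret X: left_module R X by fact
  show ?thesis using assms(2,3) by (simp add: linear_map_def X.smult_closed)
qed

lemma restrict_in_linear_maps:
  assumes "left_module R X" "linear_map R X Y f"
  shows "restrict f (carrier X) \<in> linear_maps R X Y"
  using linear_map_cong[OF assms, of "restrict f (carrier X)"] by (simp add: linear_maps_iff)

lemma linear_map_add:
  assumes "left_module R Y" "linear_map R X Y f" "linear_map R X Y g"
  shows "linear_map R X Y (\<lambda>x. f x \<oplus>\<^bsub>Y\<^esub> g x)"
proof -
  interpret Y: left_module R Y by fact
  show ?thesis using assms(2,3) by (auto simp: linear_map_def Y.smult_r_distr Y.N.a_ac)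
qed

lemma linear_map_diff_map:
  assumes "left_module R Y" "linear_map R X Y f" "linear_map R X Y g"
  shows "linear_map R X Y (\<lambda>x. f x \<ominus>\<^bsub>Y\<^esub> g x)"
proof -
  interpret Y: left_module R Y by fact
  show ?thesis using assms(2,3)
    by (auto simp: linear_map_def a_minus_def Y.smult_r_distr Y.smult_minus_right Y.N.a_ac Y.N.minus_add)
qed

lemma linear_map_zero_map:
  "left_module R Y \<Longrightarrow> linear_map R X Y (\<lambda>x. \<zero>\<^bsub>Y\<^esub>)"
proof -
  assume "left_module R Y"
  then interpret Y: left_module R Y .
  show ?thesis by (simp add: linear_map_def Y.smult_zero_right)
qed

lemma linear_map_id: "linear_map R X X (\<lambda>x. x)"
  by (simp add: linear_map_def)

lemma linear_map_subset:
  assumes "linear_map R X Y f" "H \<subseteq> carrier X" "\<And>x. x \<in> H \<Longrightarrow> f x \<in> K"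
  shows "linear_map R (X\<lparr>carrier := H\<rparr>) (Y\<lparr>carrier := K\<rparr>) f"
  using assms by (auto simp: linear_map_def subset_iff)

lemma linear_map_dom_subset:
  assumes "linear_map R X Y f" "H \<subseteq> carrier X"
  shows "linear_map R (X\<lparr>carrier := H\<rparr>) Y f"
  using assms by (auto simp: linear_map_def subset_iff)

lemma linear_map_cod_subset:
  assumes "linear_map R X Y f" "\<And>x. x \<in> carrier X \<Longrightarrow> f x \<in> K"
  shows "linear_map R X (Y\<lparr>carrier := K\<rparr>) f"
  using assms by (auto simp: linear_map_def)

lemma linear_map_cod_superset:
  assumes "linear_map R X (Y\<lparr>carrier := K\<rparr>) f" "K \<subseteq> carrier Y"
  shows "linear_map R X Y f"
  using assms by (auto simp: linear_map_def)

lemma submodule_preimage: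
  assumes "left_module R X" "left_module R Y" "linear_map R X Y f" "submodule K R Y"
  shows "submodule {x \<in> carrier X. f x \<in> K} R X"
proof -
  interpret X: left_module R X by fact
  interpret Y: left_module R Y by fact
  show ?thesis
    by (rule X.submoduleI)
      (use Y.submoduleD[OF assms(4)] linear_mapD[OF assms(3)] linear_map_zero[OF assms(1-3)] in
        \<open>auto simp: X.smult_closed\<close>)
qed

lemma submodule_kernel:
  assumes "left_module R X" "left_module R Y" "linear_map R X Y f"
  shows "submodule {x \<in> carrier X. f x = \<zero>\<^bsub>Y\<^esub>} R X"
  using submodule_preimage[OF assms left_module.submodule_zero[OF assms(2)]] by simp

lemma submodule_image:
  assumes "left_module R X" "left_module R Y" "linear_map R X Y f" "submodule H R X"
  shows "submodule (f ` H) R Y"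
proof -
  interpret X: left_module R X by fact
  interpret Y: left_module R Y by fact
  note H = X.submoduleD[OF assms(4)]
  show ?thesis
  proof (rule Y.submoduleI, goal_cases)
    case 1 then show ?case using H linear_mapD[OF assms(3)] by auto
  next
    case 2 then show ?case using H(3) linear_map_zero[OF assms(1-3)] by (metis imageI)
  next
    case (3 x y)
    then obtain a b where "x = f a" "y = f b" "a \<in> H" "b \<in> H" by blast
    then show ?case
      using H linear_mapD(2)[OF assms(3), of a b] by (intro image_eqI[of _ _ "a \<oplus>\<^bsub>X\<^esub> b"]) auto
  next
    case (4 r x)
    then obtain a where "x = f a" "a \<in> H" by blast
    then show ?case
      using 4 H linear_mapD(3)[OF assms(3), of r a] by (intro image_eqI[of _ _ "r \<odot>\<^bsub>X\<^esub> a"]) auto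
  qed
qed


section \<open>Finite generation over noetherian rings\<close>

text \<open>
  The linear span, by recursion on the generators: the inductions below remove one generator at a time.
\<close>

primrec lspan :: "('e, 'c) ring_scheme \<Rightarrow> ('e, 'n, 'd) module_scheme \<Rightarrow> 'n list \<Rightarrow> 'n set" where
  "lspan E N [] = {\<zero>\<^bsub>N\<^esub>}"
| "lspan E N (x # xs) = {a \<odot>\<^bsub>N\<^esub> x \<oplus>\<^bsub>N\<^esub> v | a v. a \<in> carrier E \<and> v \<in> lspan E N xs}"

text \<open>
  For a submodule \<open>Q\<close> this is finite generation of \<open>Q\<close> as a module (see \<open>finitely_generated_submodule_iff\<close>),
  expressed by submodules of the ambient module.
\<close>

definition fg_subset :: "('e, 'c) ring_scheme \<Rightarrow> ('e, 'n, 'd) module_scheme \<Rightarrow> 'n set \<Rightarrow> bool"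
  where "fg_subset E N Q \<longleftrightarrow>
    (\<exists>A. finite A \<and> A \<subseteq> Q \<and> (\<forall>H. submodule H E N \<and> A \<subseteq> H \<longrightarrow> Q \<subseteq> H))"

lemma fg_subsetI:
  "\<lbrakk>finite A; A \<subseteq> Q; \<And>H. \<lbrakk>submodule H E N; A \<subseteq> H\<rbrakk> \<Longrightarrow> Q \<subseteq> H\<rbrakk> \<Longrightarrow> fg_subset E N Q"
  unfolding fg_subset_def by (intro exI[of _ A]) simp

lemma fg_subsetE:
  assumes "fg_subset E N Q"
  obtains A where "finite A" "A \<subseteq> Q" "\<And>H. \<lbrakk>submodule H E N; A \<subseteq> H\<rbrakk> \<Longrightarrow> Q \<subseteq> H"
  using assms unfolding fg_subset_def by (elim exE conjE) (rule that, assumption, assumption, simp)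

context left_module
begin

lemma submodule_lspan:
  assumes "set xs \<subseteq> carrier N"
  shows "submodule (lspan E N xs) E N"
  using assms
proof (induction xs)
  case Nil then show ?case by (simp add: submodule_zero)
next
  case (Cons x xs)
  then have V: "submodule (lspan E N xs) E N" and x: "x \<in> carrier N" by auto
  have "submodule {a \<odot>\<^bsub>N\<^esub> x | a. a \<in> carrier E} E N"
  proof (rule submoduleI, goal_cases)
    case 2 show ?case using x smult_zero_left[OF x] by (intro CollectI exI[of _ \<zero>]) auto
  next
    case (3 u v) then show ?case using x by (auto simp flip: smult_l_distr)
  next
    case (4 u v) then show ?case using x by (auto simp flip: smult_assoc)
  qed (use x smult_closed in auto)
  from submodule_sum[OF this V] show ?case
    by (rule back_subst[of "\<lambda>H. submodule H E N"]) auto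
qed

lemma lspan_subset:
  assumes "submodule H E N" "set xs \<subseteq> H"
  shows "lspan E N xs \<subseteq> H"
  using assms(2)
proof (induction xs)
  case Nil then show ?case using submoduleD[OF assms(1)] by simp
next
  case (Cons x xs) then show ?case using submoduleD[OF assms(1)] by auto
qed

lemma set_subset_lspan:
  assumes "set xs \<subseteq> carrier N"
  shows "set xs \<subseteq> lspan E N xs"
  using assms
proof (induction xs)
  case (Cons x xs)
  then have V: "submodule (lspan E N xs) E N" and x: "x \<in> carrier N" by (auto intro: submodule_lspan)
  have "x = \<one> \<odot>\<^bsub>N\<^esub> x \<oplus>\<^bsub>N\<^esub> \<zero>\<^bsub>N\<^esub>" using x by (simp add: smult_one)
  then have "x \<in> lspan E N (x # xs)" using submoduleD(3)[OF V] by auto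
  moreover have "y \<in> lspan E N (x # xs)" if "y \<in> lspan E N xs" for y
  proof -
    have "y = \<zero> \<odot>\<^bsub>N\<^esub> x \<oplus>\<^bsub>N\<^esub> y"
      using x submoduleD(2)[OF V that] by (simp add: smult_zero_left)
    then show ?thesis using that by auto
  qed
  ultimately show ?case using Cons by auto
qed simp

lemma finitely_generated_module_lspan:
  assumes "finitely_generated_module E N"
  obtains xs where "set xs \<subseteq> carrier N" "lspan E N xs = carrier N"
proof -
  obtain A where A: "finite A" "A \<subseteq> carrier N" "\<And>H. submodule H E N \<Longrightarrow> A \<subseteq> H \<Longrightarrow> H = carrier N"
    using assms unfolding finitely_generated_module_def by blast
  obtain xs where "set xs = A" using finite_list[OF A(1)] by blast
  then show thesis using that[of xs] A submodule_lspan[of xs] set_subset_lspan[of xs] by auto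
qed

lemma finitely_generated_module_iff_fg_subset:
  "finitely_generated_module E N \<longleftrightarrow> fg_subset E N (carrier N)"
proof -
  have "H = carrier N \<longleftrightarrow> carrier N \<subseteq> H" if "submodule H E N" for H
    using submoduleD(1)[OF that] by auto
  then show ?thesis unfolding finitely_generated_module_def fg_subset_def by (metis (no_types, lifting))
qed

lemma finitely_generated_submodule_iff:
  assumes Q: "submodule Q E N"
  shows "finitely_generated_module E (N\<lparr>carrier := Q\<rparr>) \<longleftrightarrow> fg_subset E N Q"
proof -
  interpret Q: left_module E "N\<lparr>carrier := Q\<rparr>" by (rule left_module_submodule[OF Q])
  have "fg_subset E (N\<lparr>carrier := Q\<rparr>) Q \<longleftrightarrow> fg_subset E N Q"
  proof
    assume "fg_subset E (N\<lparr>carrier := Q\<rparr>) Q"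
    then obtain A where A: "finite A" "A \<subseteq> Q"
      "\<And>H. submodule H E (N\<lparr>carrier := Q\<rparr>) \<Longrightarrow> A \<subseteq> H \<Longrightarrow> Q \<subseteq> H" by (rule fg_subsetE) iprover
    show "fg_subset E N Q"
    proof (rule fg_subsetI[OF A(1,2)])
      fix H assume H: "submodule H E N" "A \<subseteq> H"
      have "Q \<subseteq> H \<inter> Q"
        by (rule A(3)) (use submodule_Int[OF H(1) Q] H A(2) in \<open>auto simp: submodule_submodule_iff[OF Q]\<close>)
      then show "Q \<subseteq> H" by blast
    qed
  next
    assume "fg_subset E N Q"
    then obtain A where A: "finite A" "A \<subseteq> Q"
      "\<And>H. submodule H E N \<Longrightarrow> A \<subseteq> H \<Longrightarrow> Q \<subseteq> H" by (rule fg_subsetE) iprover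
    show "fg_subset E (N\<lparr>carrier := Q\<rparr>) Q"
    proof (rule fg_subsetI[OF A(1,2)])
      fix H assume H: "submodule H E (N\<lparr>carrier := Q\<rparr>)" "A \<subseteq> H"
      show "Q \<subseteq> H" by (rule A(3)) (use H in \<open>simp_all add: submodule_submodule_iff[OF Q]\<close>)
    qed
  qed
  then show ?thesis by (simp add: Q.finitely_generated_module_iff_fg_subset)
qed

text \<open>
  The ideal of leading coefficients at \<open>x\<close> of the elements of \<open>Q\<close> that lie in \<open>Rx + V\<close>.
\<close>

lemma submodule_coefficients:
  assumes V: "submodule V E N" and Q: "submodule Q E N" and x: "x \<in> carrier N"
    and comm: "cring E"
  shows "ideal {r \<in> carrier E. \<exists>v\<in>V. r \<odot>\<^bsub>N\<^esub> x \<oplus>\<^bsub>N\<^esub> v \<in> Q} E" (is "ideal ?I E")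
proof -
  interpret cring E by fact
  have "\<zero> \<odot>\<^bsub>N\<^esub> x \<oplus>\<^bsub>N\<^esub> \<zero>\<^bsub>N\<^esub> \<in> Q"
    using submoduleD(3)[OF Q] x by (simp add: smult_zero_left)
  then have zero: "\<zero> \<in> ?I" using submoduleD(3)[OF V] by blast
  have add: "r \<oplus> s \<in> ?I" if r: "r \<in> ?I" and s: "s \<in> ?I" for r s
  proof -
    obtain v w where vw: "v \<in> V" "r \<odot>\<^bsub>N\<^esub> x \<oplus>\<^bsub>N\<^esub> v \<in> Q" "w \<in> V" "s \<odot>\<^bsub>N\<^esub> x \<oplus>\<^bsub>N\<^esub> w \<in> Q"
      using r s by blast
    have "v \<in> carrier N" "w \<in> carrier N" using vw submoduleD(2)[OF V] by auto
    then have "(r \<oplus> s) \<odot>\<^bsub>N\<^esub> x \<oplus>\<^bsub>N\<^esub> (v \<oplus>\<^bsub>N\<^esub> w) = (r \<odot>\<^bsub>N\<^esub> x \<oplus>\<^bsub>N\<^esub> v) \<oplus>\<^bsub>N\<^esub> (s \<odot>\<^bsub>N\<^esub> x \<oplus>\<^bsub>N\<^esub> w)"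
      using r s x by (simp add: smult_l_distr smult_closed N.a_ac)
    then show ?thesis using vw r s submoduleD(4)[OF V vw(1,3)] submoduleD(4)[OF Q vw(2,4)]
      by (intro CollectI conjI bexI[of _ "v \<oplus>\<^bsub>N\<^esub> w"]) auto
  qed
  have mult: "s \<otimes> r \<in> ?I" if r: "r \<in> ?I" and s: "s \<in> carrier E" for r s
  proof -
    obtain v where v: "v \<in> V" "r \<odot>\<^bsub>N\<^esub> x \<oplus>\<^bsub>N\<^esub> v \<in> Q" using r by blast
    have "v \<in> carrier N" using v submoduleD(2)[OF V] by auto
    then have "(s \<otimes> r) \<odot>\<^bsub>N\<^esub> x \<oplus>\<^bsub>N\<^esub> s \<odot>\<^bsub>N\<^esub> v = s \<odot>\<^bsub>N\<^esub> (r \<odot>\<^bsub>N\<^esub> x \<oplus>\<^bsub>N\<^esub> v)"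
      using r s x by (simp add: smult_r_distr smult_closed smult_assoc)
    then show ?thesis using v r s submoduleD(5)[OF V s v(1)] submoduleD(5)[OF Q s v(2)]
      by (intro CollectI conjI bexI[of _ "s \<odot>\<^bsub>N\<^esub> v"]) auto
  qed
  have neg: "\<ominus> r \<in> ?I" if "r \<in> ?I" for r
    using mult[OF that, of "\<ominus> \<one>"] that by (auto simp: l_minus)
  show ?thesis
  proof (rule idealI[OF E.ring_axioms])
    show "subgroup ?I (add_monoid E)"
      using zero add neg by (intro subgroup.intro) (auto simp: a_inv_def)
  qed (use mult in \<open>auto simp: m_comm\<close>)
qed

text \<open>
  As in Hilbert's basis theorem: the leading coefficients at the first generator \<open>x\<close> of elements of \<open>Q\<close> form an
  ideal, hence come from finitely many elements of \<open>Q\<close>. Subtracting a combination of these reduces an element of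
  \<open>Q\<close> to the intersection of \<open>Q\<close> with the span of the remaining generators.
\<close>

lemma submodule_lspan_fg_subset:
  assumes comm: "cring E" and noeth: "noetherian_ring E"
    and xs: "set xs \<subseteq> carrier N" and Q: "submodule Q E N" "Q \<subseteq> lspan E N xs"
  shows "fg_subset E N Q"
  using xs Q
proof (induction xs arbitrary: Q)
  case Nil
  then show ?case using submoduleD(3) by (intro fg_subsetI[of "{}"]) auto
next
  case (Cons x xs)
  interpret E: cring E by fact
  interpret E: noetherian_ring E by fact
  let ?V = "lspan E N xs"
  have x: "x \<in> carrier N" and V: "submodule ?V E N" using Cons.prems submodule_lspan by auto
  note Q = Cons.prems(2)
  let ?I = "\<lambda>Q. {r \<in> carrier E. \<exists>v\<in>?V. r \<odot>\<^bsub>N\<^esub> x \<oplus>\<^bsub>N\<^esub> v \<in> Q}"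
  obtain C where C: "C \<subseteq> carrier E" "finite C" "?I Q = Idl C"
    using E.finetely_gen[OF submodule_coefficients[OF V Q x comm]] by blast
  have "\<forall>r\<in>C. \<exists>v\<in>?V. r \<odot>\<^bsub>N\<^esub> x \<oplus>\<^bsub>N\<^esub> v \<in> Q"
    using E.genideal_self[OF C(1)] C(3) by blast
  then obtain w where w: "\<And>r. r \<in> C \<Longrightarrow> w r \<in> ?V \<and> r \<odot>\<^bsub>N\<^esub> x \<oplus>\<^bsub>N\<^esub> w r \<in> Q" by metis
  have "fg_subset E N (Q \<inter> ?V)"
    using Cons.prems by (intro Cons.IH submodule_Int V Q) auto
  then obtain A where A: "finite A" "A \<subseteq> Q \<inter> ?V" "\<And>H. submodule H E N \<Longrightarrow> A \<subseteq> H \<Longrightarrow> Q \<inter> ?V \<subseteq> H"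
    by (rule fg_subsetE) iprover
  let ?A = "A \<union> (\<lambda>r. r \<odot>\<^bsub>N\<^esub> x \<oplus>\<^bsub>N\<^esub> w r) ` C"
  have "Q \<subseteq> H" if H: "submodule H E N" "?A \<subseteq> H" for H
  proof
    fix y assume y: "y \<in> Q"
    then obtain r v where rv: "r \<in> carrier E" "v \<in> ?V" "y = r \<odot>\<^bsub>N\<^esub> x \<oplus>\<^bsub>N\<^esub> v"
      using Cons.prems(3) by auto
    have QH: "submodule (Q \<inter> H) E N" by (rule submodule_Int[OF Q H(1)])
    \<comment> \<open>The coefficients realised within \<open>H\<close> form an ideal containing the generators \<open>C\<close>.\<close>
    have "C \<subseteq> ?I (Q \<inter> H)" using w C(1) H(2) by blast
    then have "?I Q \<subseteq> ?I (Q \<inter> H)"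
      unfolding C(3) by (rule E.genideal_minimal[OF submodule_coefficients[OF V QH x comm]])
    moreover have "r \<in> ?I Q" using rv y by blast
    ultimately obtain v' where v': "v' \<in> ?V" "r \<odot>\<^bsub>N\<^esub> x \<oplus>\<^bsub>N\<^esub> v' \<in> Q" "r \<odot>\<^bsub>N\<^esub> x \<oplus>\<^bsub>N\<^esub> v' \<in> H"
      by blast
    have c: "v \<in> carrier N" "v' \<in> carrier N" "r \<odot>\<^bsub>N\<^esub> x \<in> carrier N"
      using submoduleD(2)[OF V] rv v' x by (auto simp: smult_closed)
    have e: "y \<ominus>\<^bsub>N\<^esub> (r \<odot>\<^bsub>N\<^esub> x \<oplus>\<^bsub>N\<^esub> v') = v \<ominus>\<^bsub>N\<^esub> v'"
      using c unfolding rv(3)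
      by (simp add: a_minus_def N.minus_add N.a_ac) (simp add: N.r_neg1 N.r_neg2 add_neg_cancel N.r_neg)
    have "v \<ominus>\<^bsub>N\<^esub> v' \<in> Q \<inter> ?V"
      using submoduleD(7)[OF Q y v'(2)] submoduleD(7)[OF V rv(2) v'(1)] e by simp
    then have "y \<ominus>\<^bsub>N\<^esub> (r \<odot>\<^bsub>N\<^esub> x \<oplus>\<^bsub>N\<^esub> v') \<in> H" using A(3)[OF H(1)] H(2) e by auto
    then show "y \<in> H"
      using cong_mem[OF H(1), of y "r \<odot>\<^bsub>N\<^esub> x \<oplus>\<^bsub>N\<^esub> v'"] v'(3) c rv(3) by simp
  qed
  moreover have "finite ?A" "?A \<subseteq> Q" using A C w by auto
  ultimately show ?case by (intro fg_subsetI[of ?A])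
qed

lemma noetherian_module:
  assumes "cring E" "noetherian_ring E" "finitely_generated_module E N" "submodule Q E N"
  shows "fg_subset E N Q"
proof -
  obtain xs where "set xs \<subseteq> carrier N" "lspan E N xs = carrier N"
    using finitely_generated_module_lspan[OF assms(3)] .
  then show ?thesis using submodule_lspan_fg_subset[OF assms(1,2), of xs Q] assms(4) submoduleD(1) by auto
qed

lemma submodule_Union_chain:
  assumes "\<C> \<noteq> {}" "\<And>H. H \<in> \<C> \<Longrightarrow> submodule H E N" "\<And>H K. \<lbrakk>H \<in> \<C>; K \<in> \<C>\<rbrakk> \<Longrightarrow> H \<subseteq> K \<or> K \<subseteq> H"
  shows "submodule (\<Union>\<C>) E N"
proof (rule submoduleI, goal_cases)
  case (3 x y)
  then obtain H K where "H \<in> \<C>" "K \<in> \<C>" "x \<in> H" "y \<in> K" by blast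
  then show ?case using assms(3)[of H K] submoduleD(4)[OF assms(2)] by blast
next
  case (4 a x)
  then show ?case using submoduleD(5)[OF assms(2)] by blast
qed (use assms(1) submoduleD(2,3)[OF assms(2)] in blast)+

text \<open>
  The union of a chain is finitely generated, hence already a member of the chain; Zorn's lemma applies.
\<close>

lemma noetherian_maximal:
  assumes fg: "\<And>Q. submodule Q E N \<Longrightarrow> fg_subset E N Q"
    and S: "S \<noteq> {}" "\<And>H. H \<in> S \<Longrightarrow> submodule H E N"
  obtains H where "H \<in> S" "\<And>K. \<lbrakk>K \<in> S; H \<subseteq> K\<rbrakk> \<Longrightarrow> K = H"
proof -
  have "\<Union>\<C> \<in> S" if ne: "\<C> \<noteq> {}" and ch: "subset.chain S \<C>" for \<C>
  proof -
    have sub: "\<C> \<subseteq> S" and lin: "\<And>H K. \<lbrakk>H \<in> \<C>; K \<in> \<C>\<rbrakk> \<Longrightarrow> H \<subseteq> K \<or> K \<subseteq> H"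
      using ch unfolding subset_chain_def by blast+
    have "submodule (\<Union>\<C>) E N" using sub S by (intro submodule_Union_chain ne lin) auto
    from fg[OF this] obtain A where A: "finite A" "A \<subseteq> \<Union>\<C>"
      "\<And>H. submodule H E N \<Longrightarrow> A \<subseteq> H \<Longrightarrow> \<Union>\<C> \<subseteq> H"
      by (rule fg_subsetE) iprover
    have "\<exists>H\<in>\<C>. A \<subseteq> H" using A(1,2)
    proof (induction A)
      case empty then show ?case using ne by auto
    next
      case (insert a A)
      then obtain H K where "H \<in> \<C>" "A \<subseteq> H" "K \<in> \<C>" "a \<in> K" by auto
      then show ?case using lin[of H K] by blast
    qed
    then obtain H where "H \<in> \<C>" "\<Union>\<C> \<subseteq> H" using A(3) sub S by blast
    then have "\<Union>\<C> = H" by blast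
    then show ?thesis using \<open>H \<in> \<C>\<close> sub by auto
  qed
  from subset_Zorn_nonempty[OF S(1) this] show thesis using that by blast
qed

end

text \<open>
  Generators of the kernel together with preimages of generators of the image.
\<close>

lemma fg_subset_extension:
  assumes N: "left_module E N" and N': "left_module E N'" and g: "linear_map E N N' g"
    and Q: "submodule Q E N"
    and ker: "fg_subset E N {x \<in> Q. g x = \<zero>\<^bsub>N'\<^esub>}" and im: "fg_subset E N' (g ` Q)"
  shows "fg_subset E N Q"
proof -
  interpret N: left_module E N by fact
  interpret N': left_module E N' by fact
  obtain A where A: "finite A" "A \<subseteq> {x \<in> Q. g x = \<zero>\<^bsub>N'\<^esub>}"
    "\<And>H. submodule H E N \<Longrightarrow> A \<subseteq> H \<Longrightarrow> {x \<in> Q. g x = \<zero>\<^bsub>N'\<^esub>} \<subseteq> H"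
    using ker by (rule fg_subsetE) iprover
  obtain B where B: "finite B" "B \<subseteq> g ` Q" "\<And>H. submodule H E N' \<Longrightarrow> B \<subseteq> H \<Longrightarrow> g ` Q \<subseteq> H"
    using im by (rule fg_subsetE) iprover
  obtain B' where B': "B' \<subseteq> Q" "finite B'" "B = g ` B'"
    using finite_subset_image[OF B(1,2)] by blast
  have "Q \<subseteq> H" if H: "submodule H E N" "A \<union> B' \<subseteq> H" for H
  proof
    fix y assume y: "y \<in> Q"
    have QH: "submodule (Q \<inter> H) E N" by (rule N.submodule_Int[OF Q H(1)])
    have "g ` Q \<subseteq> g ` (Q \<inter> H)"
      using B' H by (intro B(3) submodule_image[OF N N' g QH]) auto
    then obtain y' where y': "y' \<in> Q" "y' \<in> H" "g y = g y'" using y by blast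
    have c: "y \<in> carrier N" "y' \<in> carrier N" using y y' N.submoduleD(2)[OF Q] by auto
    have "g (y \<ominus>\<^bsub>N\<^esub> y') = \<zero>\<^bsub>N'\<^esub>"
      using c y' linear_mapD(1)[OF g] by (simp add: linear_map_diff[OF N N' g] N'.minus_eq_zero_iff)
    then have "y \<ominus>\<^bsub>N\<^esub> y' \<in> H"
      using A(3)[OF H(1)] H(2) N.submoduleD(7)[OF Q y y'(1)] by auto
    then show "y \<in> H" using N.cong_mem[OF H(1) c] y' by simp
  qed
  moreover have "finite (A \<union> B')" "A \<union> B' \<subseteq> Q" using A B' by auto
  ultimately show ?thesis by (intro fg_subsetI[of "A \<union> B'"])
qed

lemma finitely_generated_module_image:
  assumes N: "left_module E N" and N': "left_module E N'" and g: "linear_map E N N' g"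
    and "g ` carrier N = carrier N'" and fg: "finitely_generated_module E N"
  shows "finitely_generated_module E N'"
proof -
  interpret N: left_module E N by fact
  interpret N': left_module E N' by fact
  have "fg_subset E N (carrier N)" using fg by (simp add: N.finitely_generated_module_iff_fg_subset)
  then obtain A where A: "finite A" "A \<subseteq> carrier N"
    "\<And>H. submodule H E N \<Longrightarrow> A \<subseteq> H \<Longrightarrow> carrier N \<subseteq> H"
    by (rule fg_subsetE) iprover
  have "fg_subset E N' (carrier N')"
  proof (rule fg_subsetI[of "g ` A"])
    show "finite (g ` A)" using A(1) by simp
    show "g ` A \<subseteq> carrier N'" unfolding assms(4)[symmetric] by (rule image_mono[OF A(2)])
    fix H assume H: "submodule H E N'" "g ` A \<subseteq> H"
    have "carrier N \<subseteq> {x \<in> carrier N. g x \<in> H}"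
      by (rule A(3)[OF submodule_preimage[OF N N' g H(1)]]) (use A(2) H(2) in blast)
    then show "carrier N' \<subseteq> H" unfolding assms(4)[symmetric] by blast
  qed
  then show ?thesis by (simp add: N'.finitely_generated_module_iff_fg_subset)
qed

definition restrict_scalars :: "('a \<Rightarrow> 'e) \<Rightarrow> ('e, 'n, 'd) module_scheme \<Rightarrow> ('a, 'n) module"
  where "restrict_scalars z N = \<lparr>carrier = carrier N, monoid.mult = undefined, monoid.one = undefined,
    ring.zero = \<zero>\<^bsub>N\<^esub>, ring.add = add N, smult = (\<lambda>r x. z r \<odot>\<^bsub>N\<^esub> x)\<rparr>"

lemma restrict_scalars_simps [simp]:
  "carrier (restrict_scalars z N) = carrier N" "\<zero>\<^bsub>restrict_scalars z N\<^esub> = \<zero>\<^bsub>N\<^esub>"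
  "add (restrict_scalars z N) = add N" "r \<odot>\<^bsub>restrict_scalars z N\<^esub> x = z r \<odot>\<^bsub>N\<^esub> x"
  by (simp_all add: restrict_scalars_def)

lemma left_module_restrict_scalars:
  assumes "left_module E N" "ring R" "z \<in> ring_hom R E"
  shows "left_module R (restrict_scalars z N)"
proof -
  interpret N: left_module E N by fact
  have ab: "abelian_group (restrict_scalars z N)"
  proof (rule abelian_groupI, goal_cases)
    case (6 x) then show ?case by (intro bexI[of _ "\<ominus>\<^bsub>N\<^esub> x"]) (auto simp: N.N.l_neg)
  qed (auto simp: N.N.a_ac)
  show ?thesis
    by (intro left_module.intro left_module_axioms.intro assms(2) ab)
      (use ring_hom_memE[OF assms(3)] in
        \<open>auto simp: N.smult_closed N.smult_l_distr N.smult_r_distr N.smult_assoc N.smult_one\<close>)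
qed


section \<open>Homomorphism modules and direct summands of powers\<close>

lemma linear_map_restrict_scalars:
  assumes "linear_map E X Y f" "z \<in> ring_hom R E"
  shows "linear_map R (restrict_scalars z X) (restrict_scalars z Y) f"
  using assms(1) ring_hom_memE(1)[OF assms(2)] by (simp add: linear_map_def)

lemma linear_map_inverse:
  assumes X: "left_module R X" and f: "linear_map R X Y f" "bij_betw f (carrier X) (carrier Y)"
  obtains g where "linear_map R Y X g" "\<And>x. x \<in> carrier X \<Longrightarrow> g (f x) = x"
    "\<And>y. y \<in> carrier Y \<Longrightarrow> f (g y) = y"
proof -
  interpret X: left_module R X by fact
  define g where "g = inv_into (carrier X) f"
  have inj: "inj_on f (carrier X)" and im: "f ` carrier X = carrier Y"
    using f(2) by (auto simp: bij_betw_def)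
  have gf: "g (f x) = x" if "x \<in> carrier X" for x using inj that by (simp add: g_def)
  have gc: "g y \<in> carrier X" and fg: "f (g y) = y" if "y \<in> carrier Y" for y
    using that inv_into_into[of y f "carrier X"] f_inv_into_f[of y f "carrier X"]
    by (simp_all add: g_def im)
  have "linear_map R Y X g"
  proof (rule linear_mapI)
    fix y assume "y \<in> carrier Y" then show "g y \<in> carrier X" by (rule gc)
  next
    fix x y assume xy: "x \<in> carrier Y" "y \<in> carrier Y"
    have "g (f (g x \<oplus>\<^bsub>X\<^esub> g y)) = g x \<oplus>\<^bsub>X\<^esub> g y" using xy gc by (intro gf) auto
    then show "g (x \<oplus>\<^bsub>Y\<^esub> y) = g x \<oplus>\<^bsub>X\<^esub> g y"
      using xy gc by (simp add: linear_mapD(2)[OF f(1)] fg)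
  next
    fix r x assume rx: "r \<in> carrier R" "x \<in> carrier Y"
    have "g (f (r \<odot>\<^bsub>X\<^esub> g x)) = r \<odot>\<^bsub>X\<^esub> g x" using rx gc by (intro gf) (auto simp: X.smult_closed)
    then show "g (r \<odot>\<^bsub>Y\<^esub> x) = r \<odot>\<^bsub>X\<^esub> g x"
      using rx gc by (simp add: linear_mapD(3)[OF f(1)] fg)
  qed
  then show thesis using gf fg that by blast
qed

text \<open>
  Precomposition makes \<open>Hom\<^sub>R(M,X)\<close> a left module, because the product of \<open>End_ring R M\<close> applies its left factor
  first. For \<open>X = M\<close> this is the regular left module, and for \<open>X = R\<close> the dual of \<open>M\<close>.
\<close>

definition Hom_module ::
  "('a, 'c) ring_scheme \<Rightarrow> ('a, 'b, 'd) module_scheme \<Rightarrow> ('a, 'x, 'f) module_scheme \<Rightarrow> ('b \<Rightarrow> 'b, 'b \<Rightarrow> 'x) module"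
  where "Hom_module R M X = \<lparr>carrier = linear_maps R M X,
    monoid.mult = undefined, monoid.one = undefined,
    ring.zero = (\<lambda>m\<in>carrier M. \<zero>\<^bsub>X\<^esub>),
    ring.add = (\<lambda>f g. \<lambda>m\<in>carrier M. f m \<oplus>\<^bsub>X\<^esub> g m),
    smult = (\<lambda>e f. \<lambda>m\<in>carrier M. f (e m))\<rparr>"

definition Hom_map :: "('a, 'b, 'd) module_scheme \<Rightarrow> ('x \<Rightarrow> 'y) \<Rightarrow> ('b \<Rightarrow> 'x) \<Rightarrow> ('b \<Rightarrow> 'y)"
  where "Hom_map M p g = (\<lambda>m\<in>carrier M. p (g m))"

text \<open>
  The structure map of the \<open>R\<close>-algebra \<open>End_ring R M\<close>.
\<close>

definition homothety :: "('a, 'b, 'd) module_scheme \<Rightarrow> 'a \<Rightarrow> 'b \<Rightarrow> 'b"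
  where "homothety M r = (\<lambda>m\<in>carrier M. r \<odot>\<^bsub>M\<^esub> m)"

text \<open>
  The endomorphisms of \<open>Y\<close> that factor through a power of \<open>M\<close>, as sums of composites \<open>Y \<rightarrow> M \<rightarrow> Y\<close>. Generating
  them inductively avoids both the powers of \<open>M\<close> and finite sums: constructions for \<open>add M\<close> proceed by induction
  over a presentation of the identity of \<open>Y\<close>, one copy of \<open>M\<close> at a time.
\<close>

inductive factors_through ::
  "('a, 'c) ring_scheme \<Rightarrow> ('a, 'b, 'd) module_scheme \<Rightarrow> ('a, 'y, 'f) module_scheme \<Rightarrow> ('y \<Rightarrow> 'y) \<Rightarrow> bool"
  for R M Y where
  zero: "(\<And>y. y \<in> carrier Y \<Longrightarrow> t y = \<zero>\<^bsub>Y\<^esub>) \<Longrightarrow> factors_through R M Y t"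
| step: "\<lbrakk>factors_through R M Y t; linear_map R M Y u; linear_map R Y M v;
    \<And>y. y \<in> carrier Y \<Longrightarrow> t' y = u (v y) \<oplus>\<^bsub>Y\<^esub> t y\<rbrakk> \<Longrightarrow> factors_through R M Y t'"

text \<open>
  The identity factors through a power of \<open>M\<close> exactly if \<open>Y\<close> is a direct summand of it.
\<close>

definition in_add ::
  "('a, 'c) ring_scheme \<Rightarrow> ('a, 'b, 'd) module_scheme \<Rightarrow> ('a, 'y, 'f) module_scheme \<Rightarrow> bool"
  where "in_add R M Y \<longleftrightarrow> factors_through R M Y (\<lambda>y. y)"

lemma factors_through_linear:
  assumes "left_module R Y" "factors_through R M Y t"
  shows "linear_map R Y Y t"
  using assms(2)
proof induction
  case (zero t)
  then show ?case using linear_map_cong[OF assms(1) linear_map_zero_map[OF assms(1)]] by simp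
next
  case (step t u v t')
  show ?case
    by (rule linear_map_cong[OF assms(1) linear_map_add[OF assms(1) linear_map_comp[OF step(3,2)] step(5)]])
      (use step in auto)
qed

text \<open>
  Conjugating each composite \<open>Y \<rightarrow> M \<rightarrow> Y\<close> by maps \<open>W \<rightarrow> Y \<rightarrow> W\<close> gives a composite \<open>W \<rightarrow> M \<rightarrow> W\<close>.
\<close>

lemma factors_through_conjugate:
  assumes Y: "left_module R Y" and W: "left_module R W"
    and a: "linear_map R Y W a" and b: "linear_map R W Y b"
    and t: "factors_through R M Y t"
  shows "factors_through R M W (\<lambda>w. a (t (b w)))"
  using t
proof induction
  case (zero t)
  then show ?case
    using linear_mapD(1)[OF b] linear_map_zero[OF Y W a] by (intro factors_through.zero) auto
next
  case (step t u v t')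
  show ?case
  proof (rule factors_through.step[OF step(5) linear_map_comp[OF step(2) a] linear_map_comp[OF b step(3)]])
    fix w assume w: "w \<in> carrier W"
    show "a (t' (b w)) = a (u (v (b w))) \<oplus>\<^bsub>W\<^esub> a (t (b w))"
      using step(4)[of "b w"] linear_mapD(1)[OF b w] linear_mapD(1)[OF step(3)] linear_mapD(1)[OF step(2)]
        linear_mapD(1)[OF factors_through_linear[OF Y step(1)]]
      by (simp add: linear_mapD(2)[OF a])
  qed
qed

lemma in_add_retract:
  assumes "left_module R Y" "left_module R W"
    "linear_map R Y W a" "linear_map R W Y b" "\<And>w. w \<in> carrier W \<Longrightarrow> a (b w) = w"
    "in_add R M Y"
  shows "in_add R M W"
proof -
  have "factors_through R M W (\<lambda>w. a (b w))"
    using factors_through_conjugate[OF assms(1-4)] assms(6) by (auto simp: in_add_def)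
  moreover have "factors_through R M W t' \<Longrightarrow> (\<And>w. w \<in> carrier W \<Longrightarrow> t w = t' w) \<Longrightarrow> factors_through R M W t"
    for t t'
    by (induction rule: factors_through.induct)
      (auto intro: factors_through.zero factors_through.step)
  ultimately show ?thesis using assms(5) unfolding in_add_def by metis
qed

definition prod_module ::
  "('a, 'b, 'd) module_scheme \<Rightarrow> ('a, 'y, 'f) module_scheme \<Rightarrow> ('a, 'b \<times> 'y) module"
  where "prod_module M Y = \<lparr>carrier = carrier M \<times> carrier Y,
    monoid.mult = undefined, monoid.one = undefined,
    ring.zero = (\<zero>\<^bsub>M\<^esub>, \<zero>\<^bsub>Y\<^esub>),
    ring.add = (\<lambda>u v. (fst u \<oplus>\<^bsub>M\<^esub> fst v, snd u \<oplus>\<^bsub>Y\<^esub> snd v)),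
    smult = (\<lambda>r u. (r \<odot>\<^bsub>M\<^esub> fst u, r \<odot>\<^bsub>Y\<^esub> snd u))\<rparr>"

lemma prod_module_simps [simp]:
  "carrier (prod_module M Y) = carrier M \<times> carrier Y"
  "\<zero>\<^bsub>prod_module M Y\<^esub> = (\<zero>\<^bsub>M\<^esub>, \<zero>\<^bsub>Y\<^esub>)"
  "u \<oplus>\<^bsub>prod_module M Y\<^esub> v = (fst u \<oplus>\<^bsub>M\<^esub> fst v, snd u \<oplus>\<^bsub>Y\<^esub> snd v)"
  "r \<odot>\<^bsub>prod_module M Y\<^esub> u = (r \<odot>\<^bsub>M\<^esub> fst u, r \<odot>\<^bsub>Y\<^esub> snd u)"
  by (simp_all add: prod_module_def)

lemma left_module_prod:
  assumes "left_module R M" "left_module R Y"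
  shows "left_module R (prod_module M Y)"
proof -
  interpret M: left_module R M by fact
  interpret Y: left_module R Y by fact
  have ab: "abelian_group (prod_module M Y)"
  proof (rule abelian_groupI, goal_cases)
    case (6 x) then show ?case
      by (intro bexI[of _ "(\<ominus>\<^bsub>M\<^esub> fst x, \<ominus>\<^bsub>Y\<^esub> snd x)"]) (auto simp: M.N.l_neg Y.N.l_neg)
  qed (auto simp: M.N.a_ac Y.N.a_ac)
  show ?thesis
    by (intro left_module.intro left_module_axioms.intro M.E.ring_axioms ab)
      (auto simp: M.smult_closed M.smult_l_distr M.smult_r_distr M.smult_assoc M.smult_one
        Y.smult_closed Y.smult_l_distr Y.smult_r_distr Y.smult_assoc Y.smult_one)
qed

lemma prod_module_linear_maps:
  assumes "left_module R M" "left_module R Y"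
  shows "linear_map R M (prod_module M Y) (\<lambda>m. (m, \<zero>\<^bsub>Y\<^esub>))"
    and "linear_map R Y (prod_module M Y) (\<lambda>y. (\<zero>\<^bsub>M\<^esub>, y))"
    and "linear_map R (prod_module M Y) M fst"
    and "linear_map R (prod_module M Y) Y snd"
proof -
  interpret M: left_module R M by fact
  interpret Y: left_module R Y by fact
  show "linear_map R M (prod_module M Y) (\<lambda>m. (m, \<zero>\<^bsub>Y\<^esub>))"
    "linear_map R Y (prod_module M Y) (\<lambda>y. (\<zero>\<^bsub>M\<^esub>, y))"
    "linear_map R (prod_module M Y) M fst" "linear_map R (prod_module M Y) Y snd"
    by (auto simp: linear_map_def M.smult_zero_right Y.smult_zero_right)
qed

lemma finitely_generated_prod_module:
  assumes M: "left_module R M" and Y: "left_module R Y"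
    and fg: "finitely_generated_module R M" "finitely_generated_module R Y"
  shows "finitely_generated_module R (prod_module M Y)"
proof -
  interpret M: left_module R M by fact
  interpret Y: left_module R Y by fact
  interpret P: left_module R "prod_module M Y" by (rule left_module_prod[OF M Y])
  note lin = prod_module_linear_maps[OF M Y]
  obtain A where A: "finite A" "A \<subseteq> carrier M" "\<And>H. \<lbrakk>submodule H R M; A \<subseteq> H\<rbrakk> \<Longrightarrow> carrier M \<subseteq> H"
    using fg(1)[unfolded M.finitely_generated_module_iff_fg_subset] by (rule fg_subsetE) iprover
  obtain B where B: "finite B" "B \<subseteq> carrier Y" "\<And>H. \<lbrakk>submodule H R Y; B \<subseteq> H\<rbrakk> \<Longrightarrow> carrier Y \<subseteq> H"
    using fg(2)[unfolded Y.finitely_generated_module_iff_fg_subset] by (rule fg_subsetE) iprover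
  let ?C = "(\<lambda>m. (m, \<zero>\<^bsub>Y\<^esub>)) ` A \<union> (\<lambda>y. (\<zero>\<^bsub>M\<^esub>, y)) ` B"
  show ?thesis unfolding P.finitely_generated_module_iff_fg_subset
  proof (rule fg_subsetI[of ?C])
    show "finite ?C" "?C \<subseteq> carrier (prod_module M Y)" using A(1,2) B(1,2) by auto
    fix H assume H: "submodule H R (prod_module M Y)" "?C \<subseteq> H"
    have a: "carrier M \<subseteq> {m \<in> carrier M. (m, \<zero>\<^bsub>Y\<^esub>) \<in> H}"
      by (rule A(3)[OF submodule_preimage[OF M P.left_module_axioms lin(1) H(1)]])
        (use A(2) H(2) in auto)
    have b: "carrier Y \<subseteq> {y \<in> carrier Y. (\<zero>\<^bsub>M\<^esub>, y) \<in> H}"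
      by (rule B(3)[OF submodule_preimage[OF Y P.left_module_axioms lin(2) H(1)]])
        (use B(2) H(2) in auto)
    show "carrier (prod_module M Y) \<subseteq> H"
    proof
      fix p assume "p \<in> carrier (prod_module M Y)"
      then have p: "fst p \<in> carrier M" "snd p \<in> carrier Y" by auto
      then have "(fst p, \<zero>\<^bsub>Y\<^esub>) \<in> H" "(\<zero>\<^bsub>M\<^esub>, snd p) \<in> H" using a b by auto
      from P.submoduleD(4)[OF H(1) this] show "p \<in> H" using p by simp
    qed
  qed
qed

lemma in_add_prod_module:
  assumes M: "left_module R M" and Y: "left_module R Y" and "in_add R M Y"
  shows "in_add R M (prod_module M Y)"
proof -
  interpret M: left_module R M by fact
  interpret Y: left_module R Y by fact
  note lin = prod_module_linear_maps[OF M Y]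
  have "factors_through R M (prod_module M Y) (\<lambda>p. (\<zero>\<^bsub>M\<^esub>, snd p))"
    using factors_through_conjugate[OF Y left_module_prod[OF M Y] lin(2,4)] assms(3)
    by (auto simp: in_add_def)
  from factors_through.step[OF this lin(1,3)] show ?thesis by (auto simp: in_add_def)
qed

lemma in_add_zero_module:
  "carrier Y = {\<zero>\<^bsub>Y\<^esub>} \<Longrightarrow> in_add R M Y"
  unfolding in_add_def by (rule factors_through.zero) simp

locale fg_module_over_noetherian =
  fixes R :: "('a, 'c) ring_scheme" and M :: "('a, 'b, 'd) module_scheme"
  assumes cring: "cring R" and noetherian: "noetherian_ring R"
    and left_module_M: "left_module R M" and fg_M: "finitely_generated_module R M"
begin

sublocale R: cring R by (rule cring)
sublocale M: left_module R M by (rule left_module_M)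

abbreviation "E \<equiv> End_ring R M"
abbreviation "Hom X \<equiv> Hom_module R M X"
abbreviation "HomR X \<equiv> restrict_scalars (homothety M) (Hom_module R M X)"

lemma module_M: "module R M"
  using module_iff_left_module[OF cring] left_module_M by blast

sublocale E: ring E by (rule ring_End_ring[OF module_M])

lemma E_carrier: "e \<in> carrier E \<longleftrightarrow> linear_map R M M e \<and> e \<in> extensional (carrier M)"
  by (simp add: End_ring_def linear_maps_iff)

lemma E_closed: "\<lbrakk>e \<in> carrier E; m \<in> carrier M\<rbrakk> \<Longrightarrow> e m \<in> carrier M"
  by (simp add: E_carrier linear_map_def)

lemma E_simps [simp]:
  "m \<in> carrier M \<Longrightarrow> (e \<otimes>\<^bsub>E\<^esub> e') m = e' (e m)"
  "m \<in> carrier M \<Longrightarrow> (e \<oplus>\<^bsub>E\<^esub> e') m = e m \<oplus>\<^bsub>M\<^esub> e' m"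
  "m \<in> carrier M \<Longrightarrow> \<one>\<^bsub>E\<^esub> m = m" "m \<in> carrier M \<Longrightarrow> \<zero>\<^bsub>E\<^esub> m = \<zero>\<^bsub>M\<^esub>"
  by (simp_all add: End_ring_def)

lemma Hom_carrier: "f \<in> carrier (Hom X) \<longleftrightarrow> linear_map R M X f \<and> f \<in> extensional (carrier M)"
  by (simp add: Hom_module_def linear_maps_iff)

lemma Hom_closed: "\<lbrakk>f \<in> carrier (Hom X); m \<in> carrier M\<rbrakk> \<Longrightarrow> f m \<in> carrier X"
  by (simp add: Hom_carrier linear_map_def)

lemma Hom_linear: "f \<in> carrier (Hom X) \<Longrightarrow> linear_map R M X f"
  by (simp add: Hom_carrier)

lemma Hom_simps [simp]:
  "m \<in> carrier M \<Longrightarrow> (f \<oplus>\<^bsub>Hom X\<^esub> g) m = f m \<oplus>\<^bsub>X\<^esub> g m"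
  "m \<in> carrier M \<Longrightarrow> \<zero>\<^bsub>Hom X\<^esub> m = \<zero>\<^bsub>X\<^esub>"
  "m \<in> carrier M \<Longrightarrow> (e \<odot>\<^bsub>Hom X\<^esub> f) m = f (e m)"
  by (simp_all add: Hom_module_def)

lemma Hom_ext:
  "\<lbrakk>f \<in> carrier (Hom X); g \<in> carrier (Hom Y); \<And>m. m \<in> carrier M \<Longrightarrow> f m = g m\<rbrakk> \<Longrightarrow> f = g"
  by (rule extensionalityI[of _ "carrier M"]) (auto simp: Hom_carrier)

lemma restrict_Hom: "linear_map R M X f \<Longrightarrow> restrict f (carrier M) \<in> carrier (Hom X)"
  using restrict_in_linear_maps[OF left_module_M] by (simp add: Hom_module_def)

lemma restrict_E: "linear_map R M M f \<Longrightarrow> restrict f (carrier M) \<in> carrier E"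
  using restrict_in_linear_maps[OF left_module_M] by (simp add: End_ring_def)

lemma Hom_comp_E:
  "\<lbrakk>f \<in> carrier (Hom X); e \<in> carrier E\<rbrakk> \<Longrightarrow> linear_map R M X (\<lambda>m. f (e m))"
  using linear_map_comp by (auto simp: Hom_carrier E_carrier)

lemma left_module_Hom:
  assumes X: "left_module R X"
  shows "left_module E (Hom X)"
proof -
  interpret X: left_module R X by fact
  have add: "f \<oplus>\<^bsub>Hom X\<^esub> g \<in> carrier (Hom X)" if "f \<in> carrier (Hom X)" "g \<in> carrier (Hom X)" for f g
    using restrict_Hom[OF linear_map_add[OF X Hom_linear[OF that(1)] Hom_linear[OF that(2)]]]
    by (simp add: Hom_module_def)
  have zero: "\<zero>\<^bsub>Hom X\<^esub> \<in> carrier (Hom X)"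
    using restrict_Hom[OF linear_map_zero_map[OF X]] by (simp add: Hom_module_def)
  have smult: "e \<odot>\<^bsub>Hom X\<^esub> f \<in> carrier (Hom X)" if "e \<in> carrier E" "f \<in> carrier (Hom X)" for e f
    using restrict_Hom[OF Hom_comp_E[OF that(2,1)]] by (simp add: Hom_module_def)
  have ab: "abelian_group (Hom X)"
  proof (rule abelian_groupI, goal_cases)
    case (6 f)
    have m: "(\<lambda>m\<in>carrier M. \<ominus>\<^bsub>X\<^esub> f m) \<in> carrier (Hom X)"
      using linear_mapD[OF Hom_linear[OF 6]]
      by (intro restrict_Hom linear_mapI) (auto simp: X.N.minus_add X.smult_minus_right)
    show ?case
      by (rule bexI[OF _ m], rule Hom_ext[of _ X _ X])
        (use add[OF m 6] zero Hom_closed[OF 6] in \<open>auto simp: X.N.l_neg\<close>)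
  next
    case (3 f g h)
    then show ?case
      by (intro Hom_ext[of _ X _ X]) (auto simp: add Hom_closed X.N.a_assoc)
  next
    case (4 f g)
    then show ?case
      by (intro Hom_ext[of _ X _ X]) (auto simp: add Hom_closed X.N.a_comm)
  next
    case (5 f)
    then show ?case
      by (intro Hom_ext[of _ X _ X]) (auto simp: add zero Hom_closed)
  qed (auto simp: add zero)
  show ?thesis
  proof (intro left_module.intro left_module_axioms.intro E.ring_axioms ab, goal_cases)
    case (2 a b f)
    then show ?case using linear_mapD(2)[OF Hom_linear[of f X]] E_closed
      by (intro Hom_ext[of _ X _ X]) (auto simp: add smult)
  next
    case (3 a f g)
    then show ?case using E_closed by (intro Hom_ext[of _ X _ X]) (auto simp: add smult)
  next
    case (4 a b f)
    then show ?case using E_closed by (intro Hom_ext[of _ X _ X]) (auto simp: smult)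
  next
    case (5 f)
    then show ?case by (intro Hom_ext[of _ X _ X]) (auto simp: smult)
  qed (rule smult)
qed

lemma linear_map_homothety: "r \<in> carrier R \<Longrightarrow> linear_map R M M (\<lambda>m. r \<odot>\<^bsub>M\<^esub> m)"
  by (rule linear_mapI)
    (auto simp: M.smult_closed M.smult_r_distr R.m_comm simp flip: M.smult_assoc)

lemma homothety_closed: "r \<in> carrier R \<Longrightarrow> homothety M r \<in> carrier E"
  unfolding homothety_def by (rule restrict_E[OF linear_map_homothety])

lemma homothety_apply [simp]: "m \<in> carrier M \<Longrightarrow> homothety M r m = r \<odot>\<^bsub>M\<^esub> m"
  by (simp add: homothety_def)

lemma E_ext:
  "\<lbrakk>f \<in> carrier E; g \<in> carrier E; \<And>m. m \<in> carrier M \<Longrightarrow> f m = g m\<rbrakk> \<Longrightarrow> f = g"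
  by (rule extensionalityI[of _ "carrier M"]) (auto simp: E_carrier)

lemma homothety_hom: "homothety M \<in> ring_hom R E"
proof (rule ring_hom_memI)
  fix r s assume rs: "r \<in> carrier R" "s \<in> carrier R"
  show "homothety M (r \<otimes>\<^bsub>R\<^esub> s) = homothety M r \<otimes>\<^bsub>E\<^esub> homothety M s"
    using rs by (intro E_ext)
      (auto simp: homothety_closed M.smult_closed R.m_comm[of r s] M.smult_assoc)
  show "homothety M (r \<oplus>\<^bsub>R\<^esub> s) = homothety M r \<oplus>\<^bsub>E\<^esub> homothety M s"
    using rs by (intro E_ext) (auto simp: homothety_closed M.smult_l_distr)
next
  show "homothety M \<one>\<^bsub>R\<^esub> = \<one>\<^bsub>E\<^esub>"
    by (intro E_ext) (auto simp: homothety_closed M.smult_one)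
qed (rule homothety_closed)

lemma homothety_central:
  assumes r: "r \<in> carrier R" and e: "e \<in> carrier E"
  shows "homothety M r \<otimes>\<^bsub>E\<^esub> e = e \<otimes>\<^bsub>E\<^esub> homothety M r"
proof (rule E_ext)
  have "linear_map R M M e" using e by (simp add: E_carrier)
  note lin = linear_mapD(3)[OF this r]
  show "(homothety M r \<otimes>\<^bsub>E\<^esub> e) m = (e \<otimes>\<^bsub>E\<^esub> homothety M r) m" if "m \<in> carrier M" for m
    using that e by (simp add: lin E_closed)
qed (use r e in \<open>simp_all add: E.m_closed homothety_closed\<close>)

lemma left_module_HomR: "left_module R X \<Longrightarrow> left_module R (HomR X)"
  by (rule left_module_restrict_scalars[OF _ R.ring_axioms homothety_hom], rule left_module_Hom)

lemma Hom_map_closed: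
  "\<lbrakk>linear_map R X Y p; g \<in> carrier (Hom X)\<rbrakk> \<Longrightarrow> Hom_map M p g \<in> carrier (Hom Y)"
  unfolding Hom_map_def by (rule restrict_Hom, rule linear_map_comp[OF Hom_linear])

lemma Hom_map_apply [simp]: "m \<in> carrier M \<Longrightarrow> Hom_map M p g m = p (g m)"
  by (simp add: Hom_map_def)

lemma linear_map_Hom_map:
  assumes X: "left_module R X" and Y: "left_module R Y" and p: "linear_map R X Y p"
  shows "linear_map E (Hom X) (Hom Y) (Hom_map M p)"
proof -
  interpret HX: left_module E "Hom X" by (rule left_module_Hom[OF X])
  interpret HY: left_module E "Hom Y" by (rule left_module_Hom[OF Y])
  show ?thesis
  proof (rule linear_mapI)
    fix f g assume "f \<in> carrier (Hom X)" "g \<in> carrier (Hom X)"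
    then show "Hom_map M p (f \<oplus>\<^bsub>Hom X\<^esub> g) = Hom_map M p f \<oplus>\<^bsub>Hom Y\<^esub> Hom_map M p g"
      by (intro Hom_ext[of _ Y _ Y])
        (auto simp: Hom_map_closed[OF p] linear_mapD(2)[OF p] Hom_closed)
  next
    fix e f assume "e \<in> carrier E" "f \<in> carrier (Hom X)"
    then show "Hom_map M p (e \<odot>\<^bsub>Hom X\<^esub> f) = e \<odot>\<^bsub>Hom Y\<^esub> Hom_map M p f"
      by (intro Hom_ext[of _ Y _ Y])
        (auto simp: Hom_map_closed[OF p] HX.smult_closed HY.smult_closed E_closed)
  qed (rule Hom_map_closed[OF p])
qed

text \<open>
  A homomorphism is determined by its values at generators of \<open>M\<close>. Evaluation at one generator maps \<open>Q\<close> to a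
  submodule of the noetherian module \<open>X\<close>, and its kernel is determined by the values at the other generators.
\<close>

lemma fg_subset_HomR:
  assumes X: "left_module R X" and fgX: "finitely_generated_module R X"
    and Q: "submodule Q R (HomR X)"
  shows "fg_subset R (HomR X) Q"
proof -
  interpret X: left_module R X by fact
  interpret H: left_module R "HomR X" by (rule left_module_HomR[OF X])
  have *: "fg_subset R (HomR X) Q"
    if "set bs \<subseteq> carrier M" "submodule Q R (HomR X)"
      "\<And>f. \<lbrakk>f \<in> Q; \<forall>b\<in>set bs. f b = \<zero>\<^bsub>X\<^esub>\<rbrakk> \<Longrightarrow> f = \<zero>\<^bsub>Hom X\<^esub>" for bs Q
    using that
  proof (induction bs arbitrary: Q)
    case Nil
    then show ?case using H.submoduleD(3)[OF Nil(2)] by (intro fg_subsetI[of "{}"]) (auto dest: H.submoduleD(3))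
  next
    case (Cons b bs)
    have b: "b \<in> carrier M" using Cons.prems by simp
    have ev: "linear_map R (HomR X) X (\<lambda>f. f b)"
      using b linear_mapD(3)[OF Hom_linear[of _ X]] by (auto simp: linear_map_def Hom_closed)
    show ?case
    proof (rule fg_subset_extension[OF H.left_module_axioms X ev Cons.prems(2)])
      have k: "submodule {f \<in> carrier (HomR X). f b = \<zero>\<^bsub>X\<^esub>} R (HomR X)"
        by (rule submodule_kernel[OF H.left_module_axioms X ev])
      have "{f \<in> Q. f b = \<zero>\<^bsub>X\<^esub>} = Q \<inter> {f \<in> carrier (HomR X). f b = \<zero>\<^bsub>X\<^esub>}"
        using H.submoduleD(2)[OF Cons.prems(2)] by auto
      then have "submodule {f \<in> Q. f b = \<zero>\<^bsub>X\<^esub>} R (HomR X)"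
        using H.submodule_Int[OF Cons.prems(2) k] by simp
      then show "fg_subset R (HomR X) {f \<in> Q. f b = \<zero>\<^bsub>X\<^esub>}"
        using Cons.prems by (intro Cons.IH) auto
      show "fg_subset R X ((\<lambda>f. f b) ` Q)"
        by (rule X.noetherian_module[OF cring noetherian fgX
              submodule_image[OF H.left_module_axioms X ev Cons.prems(2)]])
    qed
  qed
  obtain bs where bs: "set bs \<subseteq> carrier M" "lspan R M bs = carrier M"
    using M.finitely_generated_module_lspan[OF fg_M] .
  show ?thesis
  proof (rule *[OF bs(1) Q])
    fix f assume f: "f \<in> Q" "\<forall>b\<in>set bs. f b = \<zero>\<^bsub>X\<^esub>"
    have fc: "f \<in> carrier (Hom X)" using H.submoduleD(2)[OF Q f(1)] by simp
    have "lspan R M bs \<subseteq> {m \<in> carrier M. f m = \<zero>\<^bsub>X\<^esub>}"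
      using f bs by (intro M.lspan_subset submodule_kernel[OF left_module_M X Hom_linear[OF fc]]) auto
    then show "f = \<zero>\<^bsub>Hom X\<^esub>"
      using bs fc H.N.zero_closed by (intro Hom_ext[of _ X _ X]) auto
  qed
qed

end


section \<open>Approximations and the trace ideal\<close>

lemma fg_modules_iff:
  "cring R \<Longrightarrow> X \<in> fg_modules R \<longleftrightarrow> left_module R X \<and> finitely_generated_module R X"
  by (simp add: fg_modules_def module_iff_left_module)

lemma fg_modules_copy:
  assumes R: "cring R" and X: "left_module R X" "finitely_generated_module R X"
  obtains Y f g where "Y \<in> fg_modules R" "linear_map R X Y f" "linear_map R Y X g"
    "\<And>x. x \<in> carrier X \<Longrightarrow> g (f x) = x" "\<And>y. y \<in> carrier Y \<Longrightarrow> f (g y) = y"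
proof -
  obtain Y :: "('a, 'a module_univ) module" and f where
    Y: "left_module R Y" "finitely_generated_module R Y" "f \<in> linear_maps R X Y"
      "bij_betw f (carrier X) (carrier Y)"
    using finitely_generated_module_in_universe[OF X] .
  have f: "linear_map R X Y f" using Y(3) by (rule linear_maps_imp_linear_map)
  obtain g where "linear_map R Y X g" "\<And>x. x \<in> carrier X \<Longrightarrow> g (f x) = x"
    "\<And>y. y \<in> carrier Y \<Longrightarrow> f (g y) = y"
    by (rule linear_map_inverse[OF X(1) f Y(4)]) iprover
  then show thesis using that[of Y f g] Y f by (simp add: fg_modules_iff[OF R])
qed

text \<open>
  The trace ideal of \<open>M\<close>, generated by the values \<open>f m\<close>, kills \<open>X\<close>.
\<close>

definition trace_annihilates ::
  "('a, 'c) ring_scheme \<Rightarrow> ('a, 'b, 'd) module_scheme \<Rightarrow> ('a, 'x, 'f) module_scheme \<Rightarrow> bool"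
  where "trace_annihilates R M X \<longleftrightarrow>
    (\<forall>f\<in>carrier (dual_module R M). \<forall>m\<in>carrier M. \<forall>x\<in>carrier X. f m \<odot>\<^bsub>X\<^esub> x = \<zero>\<^bsub>X\<^esub>)"

context fg_module_over_noetherian
begin

lemma dual_linear:
  assumes "f \<in> carrier (dual_module R M)"
  shows "m \<in> carrier M \<Longrightarrow> f m \<in> carrier R"
    and "\<lbrakk>m \<in> carrier M; m' \<in> carrier M\<rbrakk> \<Longrightarrow> f (m \<oplus>\<^bsub>M\<^esub> m') = f m \<oplus>\<^bsub>R\<^esub> f m'"
    and "\<lbrakk>r \<in> carrier R; m \<in> carrier M\<rbrakk> \<Longrightarrow> f (r \<odot>\<^bsub>M\<^esub> m) = r \<otimes>\<^bsub>R\<^esub> f m"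
  using assms by (auto simp: dual_module_def linear_maps_def regular_module_def)

lemma linear_map_rank_one:
  assumes X: "left_module R X" and f: "f \<in> carrier (dual_module R M)" and x: "x \<in> carrier X"
  shows "linear_map R M X (\<lambda>m. f m \<odot>\<^bsub>X\<^esub> x)"
proof -
  interpret X: left_module R X by fact
  show ?thesis
    by (rule linear_mapI)
      (use x in \<open>simp_all add: dual_linear[OF f] X.smult_closed X.smult_l_distr X.smult_assoc\<close>)
qed

text \<open>
  Each map \<open>M \<rightarrow> X\<close> that is to be lifted contributes one summand \<open>M\<close> to the source.
\<close>

lemma approximation_list:
  assumes X: "X \<in> fg_modules R" and us: "set us \<subseteq> carrier (Hom X)"
  shows "\<exists>Y p. Y \<in> fg_modules R \<and> in_add R M Y \<and> linear_map R Y X p \<and>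
    (\<forall>u\<in>set us. \<exists>g\<in>carrier (Hom Y). Hom_map M p g = u)"
  using us
proof (induction us)
  case Nil
  have lX: "left_module R X" using X by (simp add: fg_modules_iff[OF cring])
  interpret X: left_module R X by (rule lX)
  let ?Y = "X\<lparr>carrier := {\<zero>\<^bsub>X\<^esub>}\<rparr>"
  have "fg_subset R X {\<zero>\<^bsub>X\<^esub>}" by (rule fg_subsetI[of "{}"]) (auto dest: X.submoduleD(3))
  then have "?Y \<in> fg_modules R"
    using X.left_module_submodule[OF X.submodule_zero] X.finitely_generated_submodule_iff[OF X.submodule_zero]
    by (simp add: fg_modules_iff[OF cring])
  moreover have "in_add R M ?Y" by (rule in_add_zero_module) simp
  moreover have "linear_map R ?Y X (\<lambda>x. x)" by (rule linear_map_dom_subset[OF linear_map_id]) simp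
  ultimately show ?case by fastforce
next
  case (Cons u us)
  have lX: "left_module R X" using X by (simp add: fg_modules_iff[OF cring])
  interpret X: left_module R X by (rule lX)
  from Cons obtain Y p where Y: "Y \<in> fg_modules R" "in_add R M Y" and p: "linear_map R Y X p"
    and lift: "\<And>u. u \<in> set us \<Longrightarrow> \<exists>g\<in>carrier (Hom Y). Hom_map M p g = u" by auto
  have u: "u \<in> carrier (Hom X)" using Cons.prems by simp
  have lY: "left_module R Y" and fgY: "finitely_generated_module R Y"
    using Y(1) by (simp_all add: fg_modules_iff[OF cring])
  interpret Y: left_module R Y by (rule lY)
  let ?P = "prod_module M Y"
  note lin = prod_module_linear_maps[OF left_module_M lY]
  have lP: "left_module R ?P" by (rule left_module_prod[OF left_module_M lY])
  have fgP: "finitely_generated_module R ?P"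
    by (rule finitely_generated_prod_module[OF left_module_M lY fg_M fgY])
  obtain Y' f g where Y': "Y' \<in> fg_modules R" and f: "linear_map R ?P Y' f" and g: "linear_map R Y' ?P g"
    and gf: "\<And>x. x \<in> carrier ?P \<Longrightarrow> g (f x) = x" and fg: "\<And>y. y \<in> carrier Y' \<Longrightarrow> f (g y) = y"
    by (rule fg_modules_copy[OF cring lP fgP]) iprover
  have lY': "left_module R Y'" using Y'(1) by (simp add: fg_modules_iff[OF cring])
  have add': "in_add R M Y'"
    by (rule in_add_retract[OF lP lY' f g fg in_add_prod_module[OF left_module_M lY Y(2)]])
  define q where "q y = u (fst (g y)) \<oplus>\<^bsub>X\<^esub> p (snd (g y))" for y
  have q: "linear_map R Y' X q"
    unfolding q_def
    by (rule linear_map_add[OF lX linear_map_comp[OF linear_map_comp[OF g lin(3)] Hom_linear[OF u]]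
          linear_map_comp[OF linear_map_comp[OF g lin(4)] p]])
  have p0: "p \<zero>\<^bsub>Y\<^esub> = \<zero>\<^bsub>X\<^esub>" by (rule linear_map_zero[OF lY lX p])
  have u0: "u \<zero>\<^bsub>M\<^esub> = \<zero>\<^bsub>X\<^esub>" by (rule linear_map_zero[OF left_module_M lX Hom_linear[OF u]])
  have "\<exists>h\<in>carrier (Hom Y'). Hom_map M q h = v" if v: "v \<in> set (u # us)" for v
  proof (cases "v = u")
    case True
    let ?h = "\<lambda>m\<in>carrier M. f (m, \<zero>\<^bsub>Y\<^esub>)"
    have h: "?h \<in> carrier (Hom Y')" by (rule restrict_Hom[OF linear_map_comp[OF lin(1) f]])
    have "Hom_map M q ?h = v"
      using Hom_closed[OF u] unfolding True
      by (intro Hom_ext[OF Hom_map_closed[OF q h] u]) (simp add: q_def gf p0)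
    then show ?thesis using h by blast
  next
    case False
    then obtain k where k: "k \<in> carrier (Hom Y)" "Hom_map M p k = v" using v lift by auto
    have kc: "k m \<in> carrier Y" if "m \<in> carrier M" for m by (rule Hom_closed[OF k(1) that])
    let ?h = "\<lambda>m\<in>carrier M. f (\<zero>\<^bsub>M\<^esub>, k m)"
    have h: "?h \<in> carrier (Hom Y')"
      by (rule restrict_Hom[OF linear_map_comp[OF linear_map_comp[OF Hom_linear[OF k(1)] lin(2)] f]])
    have "Hom_map M q ?h = Hom_map M p k"
      using linear_mapD(1)[OF p]
      by (intro Hom_ext[OF Hom_map_closed[OF q h] Hom_map_closed[OF p k(1)]]) (simp add: q_def gf kc u0)
    then show ?thesis using h k(2) by blast
  qed
  then show ?case using Y' add' q by blast
qed

text \<open>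
  Lifting the finitely many generators of \<open>Hom\<^sub>R(M,X)\<close> suffices, since the maps that lift form a submodule.
\<close>

lemma approximation:
  assumes X: "X \<in> fg_modules R"
  obtains Y p where "Y \<in> fg_modules R" "in_add R M Y" "linear_map R Y X p"
    "Hom_map M p ` carrier (Hom Y) = carrier (Hom X)"
proof -
  have lX: "left_module R X" and fgX: "finitely_generated_module R X"
    using X by (simp_all add: fg_modules_iff[OF cring])
  interpret HX: left_module R "HomR X" by (rule left_module_HomR[OF lX])
  have "fg_subset R (HomR X) (carrier (HomR X))"
    by (rule fg_subset_HomR[OF lX fgX HX.submodule_carrier])
  then obtain A where A: "finite A" "A \<subseteq> carrier (HomR X)"
    "\<And>H. \<lbrakk>submodule H R (HomR X); A \<subseteq> H\<rbrakk> \<Longrightarrow> carrier (HomR X) \<subseteq> H"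
    by (rule fg_subsetE) iprover
  obtain us where us: "set us = A" using finite_list[OF A(1)] by blast
  then have us': "set us \<subseteq> carrier (Hom X)" using A(2) by simp
  obtain Y p where Y: "Y \<in> fg_modules R" "in_add R M Y" "linear_map R Y X p"
    "\<forall>u\<in>set us. \<exists>g\<in>carrier (Hom Y). Hom_map M p g = u"
    using approximation_list[OF X us'] by blast
  have lY: "left_module R Y" using Y(1) by (simp add: fg_modules_iff[OF cring])
  interpret HY: left_module R "HomR Y" by (rule left_module_HomR[OF lY])
  have lin: "linear_map R (HomR Y) (HomR X) (Hom_map M p)"
    by (rule linear_map_restrict_scalars[OF linear_map_Hom_map[OF lY lX Y(3)] homothety_hom])
  have "carrier (HomR X) \<subseteq> Hom_map M p ` carrier (HomR Y)"
  proof (rule A(3))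
    show "submodule (Hom_map M p ` carrier (HomR Y)) R (HomR X)"
      by (rule submodule_image[OF HY.left_module_axioms HX.left_module_axioms lin HY.submodule_carrier])
    show "A \<subseteq> Hom_map M p ` carrier (HomR Y)" using Y(4) us by auto
  qed
  then have "Hom_map M p ` carrier (Hom Y) = carrier (Hom X)"
    using Hom_map_closed[OF Y(3)] by auto
  then show thesis using that Y by blast
qed

text \<open>
  The values of \<open>a\<^sub>M\<close> at pure tensors kill \<open>X\<close>, and the pure tensors generate the tensor product additively.
\<close>

lemma natural_map_image:
  assumes X: "left_module R X" and tr: "trace_annihilates R M X"
  shows "\<lbrakk>r \<in> natural_map R M ` carrier (dual_tensor R M); x \<in> carrier X\<rbrakk> \<Longrightarrow>
      r \<in> carrier R \<and> r \<odot>\<^bsub>X\<^esub> x = \<zero>\<^bsub>X\<^esub>"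
    and "\<zero>\<^bsub>R\<^esub> \<in> natural_map R M ` carrier (dual_tensor R M)"
proof -
  interpret X: left_module R X by fact
  let ?M = "End_right_module M" and ?D = "dual_module R M" and ?T = "dual_tensor R M"
  let ?S = "carrier ?M \<times> carrier ?D"
  let ?F = "free_Abelian_group ?S" and ?N = "tensor_kernel E ?M ?D" and ?a = "natural_map R M"
  interpret D: left_module E ?D by (rule left_module_dual[OF module_M])
  interpret F: comm_group ?F by (rule abelian_free_Abelian_group)
  have cM: "carrier ?M = carrier M" "add ?M = add M" "\<And>e m. e \<odot>\<^bsub>?M\<^esub> m = e m"
    by (auto simp: End_right_module_def)
  have rel: "tensor_relators E ?M ?D \<subseteq> carrier ?F"
    by (rule tensor_relators_subset) (auto simp: cM E_closed D.smult_closed)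
  have nrm: "?N \<lhd> ?F"
    unfolding tensor_kernel_def by (rule F.subgroup_imp_normal[OF F.generate_is_subgroup[OF rel]])
  have T: "?T = ?F Mod ?N" by (simp add: dual_tensor_def tensor_product_def)
  have gT: "group ?T" unfolding T by (rule normal.factorgroup_is_group[OF nrm])
  have nat: "is_natural_map R M ?a"
    unfolding natural_map_def by (rule theI'[OF ex1_natural_map[OF module_M]])
  interpret a: group_hom ?T "add_monoid R" ?a
    using nat gT by (simp add: is_natural_map_def group_hom_def group_hom_axioms_def R.a_group)
  interpret q: group_hom ?F ?T "\<lambda>x. ?N #>\<^bsub>?F\<^esub> x"
    using normal.r_coset_hom_Mod[OF nrm] gT by (simp add: T group_hom_def group_hom_axioms_def)
  have ac: "?a t \<in> carrier R" if "t \<in> carrier ?T" for t using a.hom_closed[OF that] by simp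
  have *: "?a (?N #>\<^bsub>?F\<^esub> y) \<odot>\<^bsub>X\<^esub> x = \<zero>\<^bsub>X\<^esub>"
    if "Poly_Mapping.keys y \<subseteq> ?S" and x: "x \<in> carrier X" for y x
    using that(1)
  proof (induction rule: free_Abelian_group_induct [consumes 1, case_names zero diff gen])
    case zero then show ?case using q.hom_one a.hom_one X.smult_zero_left[OF x] by simp
  next
    case (diff y z)
    have c: "y \<in> carrier ?F" "z \<in> carrier ?F" using diff by simp_all
    have qc: "?N #>\<^bsub>?F\<^esub> y \<in> carrier ?T" "?N #>\<^bsub>?F\<^esub> z \<in> carrier ?T"
      using q.hom_closed c by blast+
    have "?a (?N #>\<^bsub>?F\<^esub> (y \<otimes>\<^bsub>?F\<^esub> inv\<^bsub>?F\<^esub> z))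
      = ?a (?N #>\<^bsub>?F\<^esub> y) \<otimes>\<^bsub>add_monoid R\<^esub> inv\<^bsub>add_monoid R\<^esub> ?a (?N #>\<^bsub>?F\<^esub> z)"
      using c qc by (metis F.inv_closed q.hom_mult q.hom_inv a.hom_mult a.hom_inv a.G.inv_closed)
    then have "?a (?N #>\<^bsub>?F\<^esub> (y - z)) = ?a (?N #>\<^bsub>?F\<^esub> y) \<oplus>\<^bsub>R\<^esub> \<ominus>\<^bsub>R\<^esub> ?a (?N #>\<^bsub>?F\<^esub> z)"
      using c by (simp add: a_inv_def)
    then show ?case
      using diff ac[OF qc(1)] ac[OF qc(2)] x
      by (simp add: X.smult_l_distr X.smult_minus_left)
  next
    case (gen s)
    obtain m f where s: "s = (m, f)" by (cases s)
    with gen have mf: "m \<in> carrier M" "f \<in> carrier ?D" by (auto simp: cM)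
    then have "?a (pure_tensor E ?M ?D m f) = f m" using nat by (simp add: is_natural_map_def)
    then show ?case using tr mf x unfolding trace_annihilates_def s pure_tensor_def by auto
  qed
  show "r \<in> carrier R \<and> r \<odot>\<^bsub>X\<^esub> x = \<zero>\<^bsub>X\<^esub>" if r: "r \<in> ?a ` carrier ?T" and x: "x \<in> carrier X"
  proof -
    obtain t where t: "t \<in> carrier ?T" "r = ?a t" using r by blast
    then obtain y where "y \<in> carrier ?F" "t = ?N #>\<^bsub>?F\<^esub> y" by (auto simp: T carrier_FactGroup)
    then show ?thesis using *[OF _ x, of y] ac t by auto
  qed
  show "\<zero>\<^bsub>R\<^esub> \<in> ?a ` carrier ?T"
    using a.hom_one a.G.one_closed by (metis imageI monoid.simps(2))
qed

text \<open>
  If a prime \<open>P\<close> lies outside the non-generating locus, then the class of \<open>1\<close> vanishes in the localization of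
  \<open>Cok a\<^sub>M\<close> at \<open>P\<close>. So some \<open>u\<close> outside \<open>P\<close> lies in the image of \<open>a\<^sub>M\<close>, which kills \<open>X\<close>; then \<open>X\<^sub>P\<close> is zero.
\<close>

lemma trace_annihilates_C_NG:
  assumes X: "X \<in> fg_modules R" and tr: "trace_annihilates R M X"
  shows "X \<in> C_NG R M"
proof -
  have lX: "left_module R X" using X by (simp add: fg_modules_iff[OF cring])
  interpret X: left_module R X by (rule lX)
  let ?I = "natural_map R M ` carrier (dual_tensor R M)" and ?C = "Cok_natural_map R M"
  note I = natural_map_image[OF lX tr]
  have "P \<in> NG R M" if P: "P \<in> supp R X" for P
  proof (rule ccontr)
    assume nP: "P \<notin> NG R M"
    have pr: "primeideal P R" using P by (simp add: supp_def Spec_def)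
    interpret P: primeideal P R by (rule pr)
    have one: "\<one>\<^bsub>R\<^esub> \<in> carrier R - P" using P.one_imp_carrier P.I_notcarr by auto
    have triv: "carrier (localized_module R ?C P) = {\<zero>\<^bsub>localized_module R ?C P\<^esub>}"
      using nP P by (auto simp: NG_def supp_def)
    let ?c = "?I +>\<^bsub>regular_module R\<^esub> \<one>\<^bsub>R\<^esub>"
    have zc: "\<zero>\<^bsub>?C\<^esub> = ?I" by (simp add: Cok_natural_map_def quotient_module_def)
    have cc: "?c \<in> carrier ?C"
      by (auto simp: Cok_natural_map_def quotient_module_def A_RCOSETS_def' regular_module_def)
    have "fraction_rel R ?C P `` {(?c, \<one>\<^bsub>R\<^esub>)} \<in> carrier (localized_module R ?C P)"
      using cc one by (auto simp: localized_module_def quotient_def)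
    then have "fraction_rel R ?C P `` {(?c, \<one>\<^bsub>R\<^esub>)} = fraction_rel R ?C P `` {(?I, \<one>\<^bsub>R\<^esub>)}"
      using triv zc by (simp add: localized_module_def)
    moreover have "(?c, \<one>\<^bsub>R\<^esub>) \<in> fraction_rel R ?C P `` {(?c, \<one>\<^bsub>R\<^esub>)}"
      using cc one by (auto simp: fraction_rel_def)
    ultimately have "((?I, \<one>\<^bsub>R\<^esub>), (?c, \<one>\<^bsub>R\<^esub>)) \<in> fraction_rel R ?C P" by simp
    then obtain u where u: "u \<in> carrier R - P"
      "u \<odot>\<^bsub>?C\<^esub> (\<one>\<^bsub>R\<^esub> \<odot>\<^bsub>?C\<^esub> ?I) = u \<odot>\<^bsub>?C\<^esub> (\<one>\<^bsub>R\<^esub> \<odot>\<^bsub>?C\<^esub> ?c)"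
      unfolding fraction_rel_def by auto
    have smC: "r \<odot>\<^bsub>?C\<^esub> A = {i \<oplus>\<^bsub>R\<^esub> r \<otimes>\<^bsub>R\<^esub> x | i x. i \<in> ?I \<and> x \<in> A}" for r A
      by (auto simp: Cok_natural_map_def quotient_module_def a_r_coset_def' regular_module_def)
    have c: "?c = {i \<oplus>\<^bsub>R\<^esub> \<one>\<^bsub>R\<^esub> | i. i \<in> ?I}"
      by (auto simp: a_r_coset_def' regular_module_def)
    \<comment> \<open>The two equal cosets both contain \<open>0\<close>; the relation in \<open>R\<close> that expresses this for the second one
      acts on \<open>X\<close> as \<open>0 = u x\<close>.\<close>
    have "\<zero>\<^bsub>R\<^esub> \<in> \<one>\<^bsub>R\<^esub> \<odot>\<^bsub>?C\<^esub> ?I" unfolding smC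
      using I(2) by (intro CollectI exI[of _ "\<zero>\<^bsub>R\<^esub>"]) auto
    then have "\<zero>\<^bsub>R\<^esub> \<in> u \<odot>\<^bsub>?C\<^esub> (\<one>\<^bsub>R\<^esub> \<odot>\<^bsub>?C\<^esub> ?I)" unfolding smC[of u]
      using I(2) u(1) by (intro CollectI exI[of _ "\<zero>\<^bsub>R\<^esub>"]) auto
    then have "\<zero>\<^bsub>R\<^esub> \<in> u \<odot>\<^bsub>?C\<^esub> (\<one>\<^bsub>R\<^esub> \<odot>\<^bsub>?C\<^esub> ?c)" by (simp add: u(2))
    then obtain i j k where ijk: "i \<in> ?I" "j \<in> ?I" "k \<in> ?I"
      "\<zero>\<^bsub>R\<^esub> = i \<oplus>\<^bsub>R\<^esub> u \<otimes>\<^bsub>R\<^esub> (j \<oplus>\<^bsub>R\<^esub> \<one>\<^bsub>R\<^esub> \<otimes>\<^bsub>R\<^esub> (k \<oplus>\<^bsub>R\<^esub> \<one>\<^bsub>R\<^esub>))"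
      unfolding smC c by blast
    have ux: "u \<odot>\<^bsub>X\<^esub> x = \<zero>\<^bsub>X\<^esub>" if x: "x \<in> carrier X" for x
    proof -
      note i = I(1)[OF ijk(1) x] and j = I(1)[OF ijk(2) x] and k = I(1)[OF ijk(3) x]
      have "\<zero>\<^bsub>X\<^esub> = (i \<oplus>\<^bsub>R\<^esub> u \<otimes>\<^bsub>R\<^esub> (j \<oplus>\<^bsub>R\<^esub> \<one>\<^bsub>R\<^esub> \<otimes>\<^bsub>R\<^esub> (k \<oplus>\<^bsub>R\<^esub> \<one>\<^bsub>R\<^esub>))) \<odot>\<^bsub>X\<^esub> x"
        by (simp only: ijk(4)[symmetric] X.smult_zero_left[OF x])
      also have "\<dots> = u \<odot>\<^bsub>X\<^esub> x"
        using i j k u(1) x by (simp add: X.smult_l_distr X.smult_assoc X.smult_closed X.smult_one)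
      finally show ?thesis by simp
    qed
    \<comment> \<open>As \<open>u\<close> kills \<open>X\<close>, all fractions are equal.\<close>
    have tot: "fraction_rel R X P `` {p} = carrier X \<times> (carrier R - P)"
      if "p \<in> carrier X \<times> (carrier R - P)" for p
      using that u(1) ux unfolding fraction_rel_def
      by (auto simp: X.smult_closed intro!: bexI[of _ u])
    have "carrier (localized_module R X P) = {\<zero>\<^bsub>localized_module R X P\<^esub>}"
      using tot[of "(\<zero>\<^bsub>X\<^esub>, \<one>\<^bsub>R\<^esub>)"] one tot by (force simp: localized_module_def quotient_def)
    then show False using P by (simp add: supp_def)
  qed
  then show ?thesis using X by (auto simp: C_NG_def)
qed

text \<open>
  The map \<open>m \<mapsto> f(m)x\<close> is one of the maps \<open>M \<rightarrow> K\<close>.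
\<close>

lemma trace_annihilates_if_no_maps:
  assumes K: "left_module R K" and z: "\<And>g m. \<lbrakk>g \<in> carrier (Hom K); m \<in> carrier M\<rbrakk> \<Longrightarrow> g m = \<zero>\<^bsub>K\<^esub>"
  shows "trace_annihilates R M K"
  unfolding trace_annihilates_def
proof (intro ballI)
  fix f m x assume *: "f \<in> carrier (dual_module R M)" "m \<in> carrier M" "x \<in> carrier K"
  have "(\<lambda>m\<in>carrier M. f m \<odot>\<^bsub>K\<^esub> x) m = \<zero>\<^bsub>K\<^esub>"
    by (rule z[OF restrict_Hom[OF linear_map_rank_one[OF K *(1,3)]] *(2)])
  then show "f m \<odot>\<^bsub>K\<^esub> x = \<zero>\<^bsub>K\<^esub>" using *(2) by simp
qed

text \<open>
  The map \<open>m \<mapsto> f(m)x\<close> lifts along \<open>p\<close>. In other words, the trace ideal kills the cokernel of \<open>p\<close>.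
\<close>

lemma trace_mult_in_image:
  assumes X: "left_module R X" and p: "linear_map R Y X p"
    and surj: "Hom_map M p ` carrier (Hom Y) = carrier (Hom X)"
    and *: "f \<in> carrier (dual_module R M)" "m \<in> carrier M" "x \<in> carrier X"
  shows "f m \<odot>\<^bsub>X\<^esub> x \<in> p ` carrier Y"
proof -
  have "(\<lambda>m\<in>carrier M. f m \<odot>\<^bsub>X\<^esub> x) \<in> Hom_map M p ` carrier (Hom Y)"
    unfolding surj by (rule restrict_Hom[OF linear_map_rank_one[OF X *(1,3)]])
  then obtain g where g: "g \<in> carrier (Hom Y)" "(\<lambda>m\<in>carrier M. f m \<odot>\<^bsub>X\<^esub> x) = Hom_map M p g" by blast
  have "f m \<odot>\<^bsub>X\<^esub> x = (\<lambda>m\<in>carrier M. f m \<odot>\<^bsub>X\<^esub> x) m" using *(2) by simp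
  also have "\<dots> = p (g m)" unfolding g(2) using *(2) by simp
  finally have "f m \<odot>\<^bsub>X\<^esub> x = p (g m)" .
  then show ?thesis using Hom_closed[OF g(1) *(2)] by blast
qed

end


section \<open>Lifting along surjections of modules over the endomorphism ring\<close>

lemma short_exactI:
  assumes X: "left_module R X" and Y: "left_module R Y" and Z: "left_module R Z"
    and f: "linear_map R X Y f" and g: "linear_map R Y Z g"
    and "inj_on f (carrier X)" and im: "f ` carrier X = {y \<in> carrier Y. g y = \<zero>\<^bsub>Z\<^esub>}"
    and surj: "g ` carrier Y = carrier Z"
  shows "short_exact R X Y Z (restrict f (carrier X)) (restrict g (carrier Y))"
proof -
  have "restrict f (carrier X) ` carrier X = {y \<in> carrier Y. restrict g (carrier Y) y = \<zero>\<^bsub>Z\<^esub>}"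
    using im by (auto simp: image_def restrict_def)
  moreover have "restrict g (carrier Y) ` carrier Y = carrier Z" using surj by (simp add: image_def)
  ultimately show ?thesis unfolding short_exact_def
    using restrict_in_linear_maps[OF X f] restrict_in_linear_maps[OF Y g] assms(6)
    by (simp add: inj_on_def)
qed

text \<open>
  By definition a projective module lifts along surjections within the universe, and finitely generated modules
  of any type have copies there.
\<close>

lemma projective_module_lift:
  fixes P :: "('e, 'e module_univ) module"
  assumes P: "projective_module E P" and X: "left_module E X" "finitely_generated_module E X"
    and Y: "left_module E Y" "finitely_generated_module E Y"
    and g: "linear_map E X Y g" "g ` carrier X = carrier Y" and f: "linear_map E P Y f"
  obtains h where "linear_map E P X h" "\<And>p. p \<in> carrier P \<Longrightarrow> g (h p) = f p"
proof -
  have lP: "left_module E P" using P by (simp add: projective_module_def)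
  obtain X' :: "('e, 'e module_univ) module" and \<phi> where
    X': "left_module E X'" "\<phi> \<in> linear_maps E X X'" "bij_betw \<phi> (carrier X) (carrier X')"
    by (rule finitely_generated_module_in_universe[OF X]) iprover
  obtain Y' :: "('e, 'e module_univ) module" and \<psi> where
    Y': "left_module E Y'" "\<psi> \<in> linear_maps E Y Y'" "bij_betw \<psi> (carrier Y) (carrier Y')"
    by (rule finitely_generated_module_in_universe[OF Y]) iprover
  note \<phi> = linear_maps_imp_linear_map[OF X'(2)] and \<psi> = linear_maps_imp_linear_map[OF Y'(2)]
  obtain \<phi>' where \<phi>': "linear_map E X' X \<phi>'" "\<And>x. x \<in> carrier X \<Longrightarrow> \<phi>' (\<phi> x) = x"
    by (rule linear_map_inverse[OF X(1) \<phi> X'(3)]) iprover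
  obtain \<psi>' where \<psi>': "linear_map E Y' Y \<psi>'" "\<And>x. x \<in> carrier Y \<Longrightarrow> \<psi>' (\<psi> x) = x"
    by (rule linear_map_inverse[OF Y(1) \<psi> Y'(3)]) iprover
  let ?g = "restrict (\<lambda>x. \<psi> (g (\<phi>' x))) (carrier X')" and ?f = "restrict (\<lambda>p. \<psi> (f p)) (carrier P)"
  have g': "?g \<in> linear_maps E X' Y'"
    by (rule restrict_in_linear_maps[OF X'(1) linear_map_comp[OF linear_map_comp[OF \<phi>'(1) g(1)] \<psi>]])
  have f': "?f \<in> linear_maps E P Y'" by (rule restrict_in_linear_maps[OF lP linear_map_comp[OF f \<psi>]])
  have surj: "?g ` carrier X' = carrier Y'"
  proof
    show "?g ` carrier X' \<subseteq> carrier Y'"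
      using linear_mapD(1)[OF linear_maps_imp_linear_map[OF g']] by blast
    show "carrier Y' \<subseteq> ?g ` carrier X'"
    proof
      fix y assume "y \<in> carrier Y'"
      then obtain v where v: "v \<in> carrier Y" "y = \<psi> v" using Y'(3) by (auto simp: bij_betw_def)
      then obtain x where x: "x \<in> carrier X" "v = g x" using g(2) by (metis imageE)
      then have "\<phi> x \<in> carrier X'" using linear_mapD(1)[OF \<phi>] by blast
      then show "y \<in> ?g ` carrier X'" using x v \<phi>'(2) by (intro image_eqI[of _ _ "\<phi> x"]) auto
    qed
  qed
  obtain h where h: "h \<in> linear_maps E P X'" "\<forall>p\<in>carrier P. ?g (h p) = ?f p"
    using P X'(1) Y'(1) g' surj f' unfolding projective_module_def by meson
  note hl = linear_maps_imp_linear_map[OF h(1)]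
  have "g (\<phi>' (h p)) = f p" if p: "p \<in> carrier P" for p
  proof -
    have hp: "h p \<in> carrier X'" by (rule linear_mapD(1)[OF hl p])
    then have "\<psi> (g (\<phi>' (h p))) = \<psi> (f p)" using h(2)[rule_format, OF p] p by simp
    then have "\<psi>' (\<psi> (g (\<phi>' (h p)))) = \<psi>' (\<psi> (f p))" by simp
    then show ?thesis
      using \<psi>'(2)[OF linear_mapD(1)[OF f p]] \<psi>'(2)[OF linear_mapD(1)[OF g(1) linear_mapD(1)[OF \<phi>'(1) hp]]]
      by simp
  qed
  then show thesis by (rule that[OF linear_map_comp[OF hl \<phi>'(1)]])
qed

text \<open>
  A projective resolution of length \<open>0\<close> is an isomorphism from a projective module.
\<close>

lemma has_projective_resolution_0:
  fixes L :: "('e, 'u) module"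
  assumes L: "left_module E L" and res: "has_projective_resolution E 0 L"
  obtains P :: "('e, 'u) module" and d where "projective_module E P" "linear_map E P L d" "bij_betw d (carrier P) (carrier L)"
proof -
  obtain P d where P: "\<forall>i. projective_module E (P i)" "\<forall>i>0. carrier (P i) = {\<zero>\<^bsub>P i\<^esub>}"
    "d 0 \<in> linear_maps E (P 0) L" "d 0 ` carrier (P 0) = carrier L"
    "d 1 ` carrier (P 1) = {x \<in> carrier (P 0). d 0 x = \<zero>\<^bsub>L\<^esub>}"
    "\<forall>i. d (Suc i) \<in> linear_maps E (P (Suc i)) (P i)"
    using res unfolding has_projective_resolution_def by blast
  have lP: "left_module E (P i)" for i using P(1) by (simp add: projective_module_def)
  interpret P0: left_module E "P 0" by (rule lP)
  interpret L: left_module E L by (rule L)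
  note d0 = linear_maps_imp_linear_map[OF P(3)]
  have d1: "linear_map E (P 1) (P 0) (d 1)" using linear_maps_imp_linear_map[OF P(6)[rule_format, of 0]] by simp
  have "carrier (P 1) = {\<zero>\<^bsub>P 1\<^esub>}" using P(2) by simp
  then have "d 1 ` carrier (P 1) = {\<zero>\<^bsub>P 0\<^esub>}" using linear_map_zero[OF lP lP d1] by simp
  then have kerset: "{x \<in> carrier (P 0). d 0 x = \<zero>\<^bsub>L\<^esub>} = {\<zero>\<^bsub>P 0\<^esub>}"
    by (simp only: P(5)[symmetric])
  have ker: "x = \<zero>\<^bsub>P 0\<^esub>" if "x \<in> carrier (P 0)" "d 0 x = \<zero>\<^bsub>L\<^esub>" for x
  proof -
    have "x \<in> {x \<in> carrier (P 0). d 0 x = \<zero>\<^bsub>L\<^esub>}" using that by simp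
    then have "x \<in> {\<zero>\<^bsub>P 0\<^esub>}" by (simp only: kerset)
    then show ?thesis by (rule singletonD)
  qed
  have "inj_on (d 0) (carrier (P 0))"
  proof (rule inj_onI)
    fix x y assume *: "x \<in> carrier (P 0)" "y \<in> carrier (P 0)" "d 0 x = d 0 y"
    have "d 0 (x \<ominus>\<^bsub>P 0\<^esub> y) = \<zero>\<^bsub>L\<^esub>"
      unfolding linear_map_diff[OF lP L d0 *(1,2)]
        L.minus_eq_zero_iff[OF linear_mapD(1)[OF d0 *(1)] linear_mapD(1)[OF d0 *(2)]] by (rule *(3))
    then have "x \<ominus>\<^bsub>P 0\<^esub> y = \<zero>\<^bsub>P 0\<^esub>" by (rule ker[OF P0.N.minus_closed[OF *(1,2)]])
    then show "x = y" by (simp only: P0.minus_eq_zero_iff[OF *(1,2)])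
  qed
  then have "bij_betw (d 0) (carrier (P 0)) (carrier L)" using P(4) unfolding bij_betw_def by iprover
  then show thesis by (rule that[OF P(1)[rule_format] d0])
qed

text \<open>
  Truncating the resolution leaves one of the first syzygy.
\<close>

lemma has_projective_resolution_Suc:
  fixes L :: "('e, 'u) module"
  assumes L: "left_module E L" and res: "has_projective_resolution E (Suc n) L"
  obtains P :: "('e, 'u) module" and d where "projective_module E P" "linear_map E P L d" "d ` carrier P = carrier L"
    "has_projective_resolution E n (P\<lparr>carrier := {x \<in> carrier P. d x = \<zero>\<^bsub>L\<^esub>}\<rparr>)"
proof -
  obtain P d where P: "\<forall>i. projective_module E (P i)" "\<forall>i>Suc n. carrier (P i) = {\<zero>\<^bsub>P i\<^esub>}"
    "d 0 \<in> linear_maps E (P 0) L" "d 0 ` carrier (P 0) = carrier L"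
    "d 1 ` carrier (P 1) = {x \<in> carrier (P 0). d 0 x = \<zero>\<^bsub>L\<^esub>}"
    "\<forall>i. d (Suc i) \<in> linear_maps E (P (Suc i)) (P i)"
    "\<forall>i. d (Suc (Suc i)) ` carrier (P (Suc (Suc i))) = {x \<in> carrier (P (Suc i)). d (Suc i) x = \<zero>\<^bsub>P i\<^esub>}"
    using res unfolding has_projective_resolution_def by (elim exE conjE) (rule that; assumption)
  let ?K = "{x \<in> carrier (P 0). d 0 x = \<zero>\<^bsub>L\<^esub>}"
  have d1: "linear_map E (P 1) (P 0) (d 1)" "d 1 \<in> extensional (carrier (P 1))"
    using P(6)[rule_format, of 0] by (simp_all add: linear_maps_iff)
  have im: "d 1 x \<in> ?K" if "x \<in> carrier (P 1)" for x
    unfolding P(5)[symmetric] using that by (rule imageI)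
  have "d 1 \<in> linear_maps E (P 1) ((P 0)\<lparr>carrier := ?K\<rparr>)"
    unfolding linear_maps_iff using linear_map_cod_subset[OF d1(1) im] d1(2) by simp
  then have "has_projective_resolution E n ((P 0)\<lparr>carrier := ?K\<rparr>)"
    unfolding has_projective_resolution_def
    using P by (intro exI[of _ "\<lambda>i. P (Suc i)"] exI[of _ "\<lambda>i. d (Suc i)"]) (simp add: P(7)[rule_format, of 0, simplified])
  then show thesis
    by (rule that[OF P(1)[rule_format] linear_maps_imp_linear_map[OF P(3)] P(4)])
qed

context fg_module_over_noetherian
begin

lemma E_eq_Hom: "carrier E = carrier (Hom M)"
  by (simp add: End_ring_def Hom_module_def)

lemma finitely_generated_Hom:
  assumes "X \<in> fg_modules R"
  shows "finitely_generated_module E (Hom X)"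
proof -
  have lX: "left_module R X" and fgX: "finitely_generated_module R X"
    using assms by (simp_all add: fg_modules_iff[OF cring])
  interpret H: left_module E "Hom X" by (rule left_module_Hom[OF lX])
  interpret HR: left_module R "HomR X" by (rule left_module_HomR[OF lX])
  obtain A where A: "finite A" "A \<subseteq> carrier (HomR X)"
    "\<And>H. \<lbrakk>submodule H R (HomR X); A \<subseteq> H\<rbrakk> \<Longrightarrow> carrier (HomR X) \<subseteq> H"
    using fg_subset_HomR[OF lX fgX HR.submodule_carrier] by (rule fg_subsetE) iprover
  have "submodule H R (HomR X)" if "submodule H E (Hom X)" for H
    using H.submoduleD[OF that] homothety_closed by (intro HR.submoduleI) auto
  then have "fg_subset E (Hom X) (carrier (Hom X))"
    using A by (intro fg_subsetI[of A]) auto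
  then show ?thesis by (simp add: H.finitely_generated_module_iff_fg_subset)
qed

lemma Hom_map_zero_map:
  "\<lbrakk>\<And>y. y \<in> carrier Y \<Longrightarrow> t y = \<zero>\<^bsub>Z\<^esub>; h \<in> carrier (Hom Y)\<rbrakk> \<Longrightarrow> Hom_map M t h = \<zero>\<^bsub>Hom Z\<^esub>"
  using Hom_closed[of h Y] by (simp add: Hom_map_def Hom_module_def fun_eq_iff)

lemma Hom_map_id: "h \<in> carrier (Hom Y) \<Longrightarrow> Hom_map M (\<lambda>y. y) h = h"
  using Hom_carrier[of h Y] by (simp add: Hom_map_def extensional_restrict)

lemma Hom_map_factors_step:
  assumes Y: "left_module R Y" and t: "factors_through R M Y t"
    and u: "linear_map R M Y u" and v: "linear_map R Y M v"
    and t': "\<forall>y\<in>carrier Y. t' y = u (v y) \<oplus>\<^bsub>Y\<^esub> t y" and h: "h \<in> carrier (Hom Y)"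
  shows "Hom_map M v h \<in> carrier E" "Hom_map M t h \<in> carrier (Hom Y)" "Hom_map M t' h \<in> carrier (Hom Y)"
    and "Hom_map M t' h = Hom_map M v h \<odot>\<^bsub>Hom Y\<^esub> restrict u (carrier M) \<oplus>\<^bsub>Hom Y\<^esub> Hom_map M t h"
proof -
  interpret HY: left_module E "Hom Y" by (rule left_module_Hom[OF Y])
  show vE: "Hom_map M v h \<in> carrier E" using Hom_map_closed[OF v h] by (simp add: E_eq_Hom)
  show th: "Hom_map M t h \<in> carrier (Hom Y)" by (rule Hom_map_closed[OF factors_through_linear[OF Y t] h])
  show t'h: "Hom_map M t' h \<in> carrier (Hom Y)"
    by (rule Hom_map_closed[OF factors_through_linear[OF Y factors_through.step[OF t u v t'[rule_format]]] h])
  show "Hom_map M t' h = Hom_map M v h \<odot>\<^bsub>Hom Y\<^esub> restrict u (carrier M) \<oplus>\<^bsub>Hom Y\<^esub> Hom_map M t h"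
    using t' Hom_closed[OF h] linear_mapD(1)[OF v]
    by (intro Hom_ext[of _ Y _ Y]) (simp_all add: HY.smult_closed vE restrict_Hom[OF u] th t'h)
qed

text \<open>
  Projectivity of \<open>Hom\<^sub>R(M,Y)\<close> for \<open>Y\<close> in \<open>add M\<close>, relative to modules of arbitrary types. For a composite
  \<open>u v : Y \<rightarrow> M \<rightarrow> Y\<close>, a preimage \<open>z\<close> of \<open>f u\<close> under \<open>d\<close> gives the lift \<open>h \<mapsto> (v h) z\<close> of \<open>h \<mapsto> f (u v h)\<close>; the
  lifts are added up along a presentation of the identity.
\<close>

lemma in_add_lift:
  assumes Y: "left_module R Y" "in_add R M Y" and P: "left_module E P" and L: "left_module E L"
    and d: "linear_map E P L d" "d ` carrier P = carrier L" and f: "linear_map E (Hom Y) L f"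
  obtains a where "linear_map E (Hom Y) P a" "\<And>y. y \<in> carrier (Hom Y) \<Longrightarrow> d (a y) = f y"
proof -
  interpret P: left_module E P by (rule P)
  interpret L: left_module E L by (rule L)
  interpret HY: left_module E "Hom Y" by (rule left_module_Hom[OF Y(1)])
  have "\<exists>a. linear_map E (Hom Y) P a \<and> (\<forall>y\<in>carrier (Hom Y). d (a y) = f (Hom_map M t y))"
    if "factors_through R M Y t" for t using that
  proof induction
    case (zero t)
    have "Hom_map M t y = \<zero>\<^bsub>Hom Y\<^esub>" if "y \<in> carrier (Hom Y)" for y
      by (rule Hom_map_zero_map[OF zero that])
    then show ?case
      using linear_map_zero_map[OF P, of "Hom Y"] linear_map_zero[OF P L d(1)]
        linear_map_zero[OF HY.left_module_axioms L f]
      by (intro exI[of _ "\<lambda>y. \<zero>\<^bsub>P\<^esub>"]) simp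
  next
    case (step t u v t')
    then obtain a where a: "linear_map E (Hom Y) P a"
      "\<And>y. y \<in> carrier (Hom Y) \<Longrightarrow> d (a y) = f (Hom_map M t y)" by blast
    let ?u = "restrict u (carrier M)"
    have u: "?u \<in> carrier (Hom Y)" by (rule restrict_Hom[OF step(2)])
    have "f ?u \<in> d ` carrier P" unfolding d(2) by (rule linear_mapD(1)[OF f u])
    then obtain z where z: "z \<in> carrier P" "f ?u = d z" by blast
    have v: "linear_map E (Hom Y) (Hom M) (Hom_map M v)"
      by (rule linear_map_Hom_map[OF Y(1) left_module_M step(3)])
    have vE: "Hom_map M v y \<in> carrier E" if "y \<in> carrier (Hom Y)" for y
      using linear_mapD(1)[OF v that] by (simp add: E_eq_Hom)
    have vadd: "Hom_map M v (x \<oplus>\<^bsub>Hom Y\<^esub> y) = Hom_map M v x \<oplus>\<^bsub>E\<^esub> Hom_map M v y"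
      if "x \<in> carrier (Hom Y)" "y \<in> carrier (Hom Y)" for x y
      using linear_mapD(2)[OF v that] by (simp add: End_ring_def Hom_module_def)
    have vsm: "Hom_map M v (e \<odot>\<^bsub>Hom Y\<^esub> y) = e \<otimes>\<^bsub>E\<^esub> Hom_map M v y"
      if "e \<in> carrier E" "y \<in> carrier (Hom Y)" for e y
      using linear_mapD(3)[OF v that] by (simp add: End_ring_def Hom_module_def)
    have l: "linear_map E (Hom Y) P (\<lambda>y. Hom_map M v y \<odot>\<^bsub>P\<^esub> z)"
      using z(1) vE by (intro linear_mapI) (simp_all add: P.smult_closed vadd vsm P.smult_l_distr P.smult_assoc)
    have "d (Hom_map M v y \<odot>\<^bsub>P\<^esub> z \<oplus>\<^bsub>P\<^esub> a y) = f (Hom_map M t' y)" if y: "y \<in> carrier (Hom Y)" for y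
    proof -
      have t': "\<forall>y\<in>carrier Y. t' y = u (v y) \<oplus>\<^bsub>Y\<^esub> t y" using step(4) by blast
      note stp = Hom_map_factors_step[OF Y(1) step(1-3) t' y]
      have "d (Hom_map M v y \<odot>\<^bsub>P\<^esub> z \<oplus>\<^bsub>P\<^esub> a y) = Hom_map M v y \<odot>\<^bsub>L\<^esub> f ?u \<oplus>\<^bsub>L\<^esub> f (Hom_map M t y)"
        using vE[OF y] z linear_mapD(1)[OF a(1) y] a(2)[OF y]
        by (simp add: linear_mapD(2,3)[OF d(1)] P.smult_closed)
      also have "\<dots> = f (Hom_map M v y \<odot>\<^bsub>Hom Y\<^esub> ?u \<oplus>\<^bsub>Hom Y\<^esub> Hom_map M t y)"
        using vE[OF y] u stp(2) by (simp add: linear_mapD(2,3)[OF f] HY.smult_closed)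
      also have "Hom_map M v y \<odot>\<^bsub>Hom Y\<^esub> ?u \<oplus>\<^bsub>Hom Y\<^esub> Hom_map M t y = Hom_map M t' y"
        by (rule stp(4)[symmetric])
      finally show ?thesis .
    qed
    then show ?case using linear_map_add[OF P l a(1)] by (intro exI[of _ "\<lambda>y. Hom_map M v y \<odot>\<^bsub>P\<^esub> z \<oplus>\<^bsub>P\<^esub> a y"]) simp
  qed
  then obtain a where "linear_map E (Hom Y) P a"
    "\<forall>y\<in>carrier (Hom Y). d (a y) = f (Hom_map M (\<lambda>y. y) y)" using Y(2) unfolding in_add_def by blast
  then show thesis using that[of a] by (simp add: Hom_map_id)
qed

lemma in_add_map_eq:
  assumes Y: "left_module R Y" "in_add R M Y" and W: "left_module R W"
    and f: "linear_map R Y W f" and g: "linear_map R Y W g"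
    and eq: "\<And>h. h \<in> carrier (Hom Y) \<Longrightarrow> Hom_map M f h = Hom_map M g h" and y: "y \<in> carrier Y"
  shows "f y = g y"
proof -
  have "\<forall>y\<in>carrier Y. f (t y) = g (t y)" if "factors_through R M Y t" for t using that
  proof induction
    case (zero t)
    then show ?case using linear_map_zero[OF Y(1) W f] linear_map_zero[OF Y(1) W g] by simp
  next
    case (step t u v t')
    have "f (u m) = g (u m)" if m: "m \<in> carrier M" for m
    proof -
      have "Hom_map M f (restrict u (carrier M)) m = Hom_map M g (restrict u (carrier M)) m"
        by (simp only: eq[OF restrict_Hom[OF step(2)]])
      then show ?thesis using m by simp
    qed
    then show ?case
      using step(4,5) linear_mapD(1)[OF step(3)] linear_mapD(1)[OF step(2)]
        linear_mapD(1)[OF factors_through_linear[OF Y(1) step(1)]]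
      by (simp add: linear_mapD(2)[OF f] linear_mapD(2)[OF g])
  qed
  then show ?thesis using Y(2) y unfolding in_add_def by blast
qed

text \<open>
  On \<open>add M\<close> the functor \<open>Hom\<^sub>R(M,_)\<close> is full: if \<open>u v : Y \<rightarrow> M \<rightarrow> Y\<close> is a composite, then by \<open>E\<close>-linearity
  \<open>s (u v h) = (s u) v h\<close>, and \<open>s u\<close> is a map \<open>M \<rightarrow> W\<close>.
\<close>

lemma in_add_Yoneda:
  assumes Y: "left_module R Y" "in_add R M Y" and W: "left_module R W"
    and s: "linear_map E (Hom Y) (Hom W) s"
  obtains \<epsilon> where "linear_map R Y W \<epsilon>" "\<And>h. h \<in> carrier (Hom Y) \<Longrightarrow> s h = Hom_map M \<epsilon> h"
proof -
  interpret W: left_module R W by (rule W)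
  interpret HY: left_module E "Hom Y" by (rule left_module_Hom[OF Y(1)])
  interpret HW: left_module E "Hom W" by (rule left_module_Hom[OF W])
  have "\<exists>\<epsilon>. linear_map R Y W \<epsilon> \<and> (\<forall>h\<in>carrier (Hom Y). s (Hom_map M t h) = Hom_map M \<epsilon> h)"
    if "factors_through R M Y t" for t using that
  proof induction
    case (zero t)
    have "Hom_map M t y = \<zero>\<^bsub>Hom Y\<^esub>" if "y \<in> carrier (Hom Y)" for y
      by (rule Hom_map_zero_map[OF zero that])
    moreover have "Hom_map M (\<lambda>y. \<zero>\<^bsub>W\<^esub>) h = \<zero>\<^bsub>Hom W\<^esub>" if "h \<in> carrier (Hom Y)" for h
      by (simp add: Hom_map_def Hom_module_def)
    ultimately show ?case
      using linear_map_zero_map[OF W, of Y] linear_map_zero[OF HY.left_module_axioms HW.left_module_axioms s]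
      by (intro exI[of _ "\<lambda>y. \<zero>\<^bsub>W\<^esub>"]) simp
  next
    case (step t u v t')
    then obtain \<epsilon> where \<epsilon>: "linear_map R Y W \<epsilon>"
      "\<And>h. h \<in> carrier (Hom Y) \<Longrightarrow> s (Hom_map M t h) = Hom_map M \<epsilon> h" by blast
    let ?u = "restrict u (carrier M)"
    have u: "?u \<in> carrier (Hom Y)" by (rule restrict_Hom[OF step(2)])
    have su: "s ?u \<in> carrier (Hom W)" by (rule linear_mapD(1)[OF s u])
    have lin: "linear_map R Y W (\<lambda>y. s ?u (v y) \<oplus>\<^bsub>W\<^esub> \<epsilon> y)"
      by (rule linear_map_add[OF W linear_map_comp[OF step(3) Hom_linear[OF su]] \<epsilon>(1)])
    have "s (Hom_map M t' h) = Hom_map M (\<lambda>y. s ?u (v y) \<oplus>\<^bsub>W\<^esub> \<epsilon> y) h" if h: "h \<in> carrier (Hom Y)" for h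
    proof -
      have t': "\<forall>y\<in>carrier Y. t' y = u (v y) \<oplus>\<^bsub>Y\<^esub> t y" using step(4) by blast
      note stp = Hom_map_factors_step[OF Y(1) step(1-3) t' h]
      have "s (Hom_map M t' h) = Hom_map M v h \<odot>\<^bsub>Hom W\<^esub> s ?u \<oplus>\<^bsub>Hom W\<^esub> Hom_map M \<epsilon> h"
        unfolding stp(4) using stp(1,2) u by (simp add: linear_mapD(2,3)[OF s] HY.smult_closed \<epsilon>(2)[OF h])
      also have "\<dots> = Hom_map M (\<lambda>y. s ?u (v y) \<oplus>\<^bsub>W\<^esub> \<epsilon> y) h"
        by (rule Hom_ext[of _ W _ W])
          (simp_all add: HW.smult_closed stp(1) su Hom_map_closed[OF \<epsilon>(1) h] Hom_map_closed[OF lin h])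
      finally show ?thesis .
    qed
    then show ?case using lin by blast
  qed
  then obtain \<epsilon> where "linear_map R Y W \<epsilon>"
    "\<forall>h\<in>carrier (Hom Y). s (Hom_map M (\<lambda>y. y) h) = Hom_map M \<epsilon> h" using Y(2) unfolding in_add_def by blast
  then show thesis using that[of \<epsilon>] by (simp add: Hom_map_id)
qed

end


section \<open>Classes of modules of finite projective dimension\<close>

lemma submodule_finitely_generated:
  assumes "cring R" "noetherian_ring R" "X \<in> fg_modules R" "submodule H R X"
  shows "X\<lparr>carrier := H\<rparr> \<in> fg_modules R"
proof -
  have X: "left_module R X" "finitely_generated_module R X" using assms by (simp_all add: fg_modules_iff)
  interpret X: left_module R X by (rule X(1))
  show ?thesis
    using X.left_module_submodule[OF assms(4)] X.finitely_generated_submodule_iff[OF assms(4)]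
      X.noetherian_module[OF assms(1,2) X(2) assms(4)] by (simp add: fg_modules_iff[OF assms(1)])
qed

text \<open>
  The two properties of the classes in \<open>K\<^sub>0(R)/\<langle>\<C>\<^sub>M\<rangle>\<close> on which the argument rests: additivity on short exact
  sequences, and vanishing for modules supported in the non-generating locus.
\<close>

locale additive_invariant = fg_module_over_noetherian R M + G: comm_group G
  for R :: "('a, 'c) ring_scheme" and M :: "('a, 'b, 'd) module_scheme" and G :: "('g, 'h) monoid_scheme" +
  fixes cl :: "('a, 'a module_univ) module \<Rightarrow> 'g"
  assumes cl_closed: "X \<in> fg_modules R \<Longrightarrow> cl X \<in> carrier G"
    and cl_exact: "\<lbrakk>X \<in> fg_modules R; Y \<in> fg_modules R; Z \<in> fg_modules R; short_exact R X Y Z f g\<rbrakk> \<Longrightarrow>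
      cl Y = cl X \<otimes>\<^bsub>G\<^esub> cl Z"
    and cl_C_NG: "X \<in> C_NG R M \<Longrightarrow> cl X = \<one>\<^bsub>G\<^esub>"
begin

lemma cl_kernel_image:
  assumes Y: "Y \<in> fg_modules R" and X: "X \<in> fg_modules R" and p: "linear_map R Y X p"
    and surj: "p ` carrier Y = carrier X"
  shows "cl Y = cl (Y\<lparr>carrier := {y \<in> carrier Y. p y = \<zero>\<^bsub>X\<^esub>}\<rparr>) \<otimes>\<^bsub>G\<^esub> cl X"
proof -
  let ?K = "{y \<in> carrier Y. p y = \<zero>\<^bsub>X\<^esub>}"
  have lY: "left_module R Y" and lX: "left_module R X" using X Y by (simp_all add: fg_modules_iff[OF cring])
  have K: "submodule ?K R Y" by (rule submodule_kernel[OF lY lX p])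
  have "short_exact R (Y\<lparr>carrier := ?K\<rparr>) Y X (restrict (\<lambda>y. y) (carrier (Y\<lparr>carrier := ?K\<rparr>))) (restrict p (carrier Y))"
  proof (rule short_exactI[OF left_module.left_module_submodule[OF lY K] lY lX _ p _ _ surj])
    show "linear_map R (Y\<lparr>carrier := ?K\<rparr>) Y (\<lambda>y. y)"
      by (rule linear_map_dom_subset[OF linear_map_id]) auto
  qed auto
  then show ?thesis
    by (rule cl_exact[OF submodule_finitely_generated[OF cring noetherian Y K] Y X])
qed

text \<open>
  The trace ideal kills the cokernel \<open>Q\<close> of \<open>p\<close>, whose class therefore vanishes; so \<open>X\<close> has the class of the image.
\<close>

lemma cl_approximation:
  assumes Y: "Y \<in> fg_modules R" and X: "X \<in> fg_modules R" and p: "linear_map R Y X p"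
    and surj: "Hom_map M p ` carrier (Hom Y) = carrier (Hom X)"
  shows "cl Y = cl (Y\<lparr>carrier := {y \<in> carrier Y. p y = \<zero>\<^bsub>X\<^esub>}\<rparr>) \<otimes>\<^bsub>G\<^esub> cl X"
proof -
  let ?I = "p ` carrier Y"
  have lY: "left_module R Y" and lX: "left_module R X" and fgX: "finitely_generated_module R X"
    using X Y by (simp_all add: fg_modules_iff[OF cring])
  interpret X: left_module R X by (rule lX)
  have I: "submodule ?I R X"
    by (rule submodule_image[OF lY lX p left_module.submodule_carrier[OF lY]])
  let ?X = "X\<lparr>carrier := ?I\<rparr>"
  have X': "?X \<in> fg_modules R" by (rule submodule_finitely_generated[OF cring noetherian X I])
  obtain Q :: "('a, 'a module_univ) module" and q where Q: "left_module R Q" and q: "linear_map R X Q q"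
    and qs: "q ` carrier X = carrier Q" and qk: "\<And>x. x \<in> carrier X \<Longrightarrow> q x = \<zero>\<^bsub>Q\<^esub> \<longleftrightarrow> x \<in> ?I"
    by (rule X.ex_quotient[OF I]) iprover
  have fQ: "Q \<in> fg_modules R"
    using Q finitely_generated_module_image[OF lX Q q qs fgX] by (simp add: fg_modules_iff[OF cring])
  have "f m \<odot>\<^bsub>Q\<^esub> y = \<zero>\<^bsub>Q\<^esub>" if *: "f \<in> carrier (dual_module R M)" "m \<in> carrier M" "y \<in> carrier Q" for f m y
  proof -
    have "y \<in> q ` carrier X" unfolding qs by (rule *(3))
    then obtain x where x: "x \<in> carrier X" "y = q x" by blast
    have fm: "f m \<in> carrier R" by (rule dual_linear(1)[OF *(1,2)])
    have "q (f m \<odot>\<^bsub>X\<^esub> x) = \<zero>\<^bsub>Q\<^esub>"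
      using qk[OF X.smult_closed[OF fm x(1)]] trace_mult_in_image[OF lX p surj *(1,2) x(1)] by blast
    then show ?thesis using linear_mapD(3)[OF q fm x(1)] x(2) by simp
  qed
  then have "cl Q = \<one>\<^bsub>G\<^esub>"
    by (intro cl_C_NG trace_annihilates_C_NG[OF fQ]) (simp add: trace_annihilates_def)
  moreover have "{x \<in> carrier X. q x = \<zero>\<^bsub>Q\<^esub>} = ?I"
    using qk X.submoduleD(2)[OF I] by auto
  ultimately have "cl X = cl ?X" using cl_kernel_image[OF X fQ q qs] cl_closed[OF X'] by simp
  moreover have "cl Y = cl (Y\<lparr>carrier := {y \<in> carrier Y. p y = \<zero>\<^bsub>?X\<^esub>}\<rparr>) \<otimes>\<^bsub>G\<^esub> cl ?X"
    by (rule cl_kernel_image[OF Y X' linear_map_cod_subset[OF p]]) auto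
  ultimately show ?thesis by simp
qed

lemma cl_no_maps:
  assumes K: "K \<in> fg_modules R" and "\<And>g m. \<lbrakk>g \<in> carrier (Hom K); m \<in> carrier M\<rbrakk> \<Longrightarrow> g m = \<zero>\<^bsub>K\<^esub>"
  shows "cl K = \<one>\<^bsub>G\<^esub>"
  using K assms(2) by (intro cl_C_NG trace_annihilates_C_NG trace_annihilates_if_no_maps)
    (simp_all add: fg_modules_iff[OF cring])

text \<open>
  The idempotent \<open>s p\<close> of \<open>Hom\<^sub>R(M,Y)\<close> is induced by an idempotent \<open>\<epsilon>\<close> of \<open>Y\<close>. Its image \<open>W\<close> belongs to \<open>add M\<close>, and
  \<open>p\<close> restricts to a map \<open>W \<rightarrow> X\<close> that is bijective on \<open>Hom\<^sub>R(M,_)\<close>, so that \<open>W\<close> and \<open>X\<close> have the same class.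
\<close>

lemma cl_in_subgroup_if_split:
  assumes H: "subgroup H G" "\<And>W. \<lbrakk>W \<in> fg_modules R; in_add R M W\<rbrakk> \<Longrightarrow> cl W \<in> H"
    and X: "X \<in> fg_modules R" and Y: "Y \<in> fg_modules R" "in_add R M Y" and p: "linear_map R Y X p"
    and s: "linear_map E (Hom X) (Hom Y) s" "\<And>x. x \<in> carrier (Hom X) \<Longrightarrow> Hom_map M p (s x) = x"
  shows "cl X \<in> H"
proof -
  have lY: "left_module R Y" and lX: "left_module R X"
    using X Y by (simp_all add: fg_modules_iff[OF cring])
  interpret Y: left_module R Y by (rule lY)
  have \<pi>: "linear_map E (Hom Y) (Hom X) (Hom_map M p)" by (rule linear_map_Hom_map[OF lY lX p])
  obtain \<epsilon> where \<epsilon>: "linear_map R Y Y \<epsilon>" "\<And>h. h \<in> carrier (Hom Y) \<Longrightarrow> s (Hom_map M p h) = Hom_map M \<epsilon> h"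
    by (rule in_add_Yoneda[OF lY Y(2) lY linear_map_comp[OF \<pi> s(1)]]) iprover
  have idem: "\<epsilon> (\<epsilon> y) = \<epsilon> y" if y: "y \<in> carrier Y" for y
  proof (rule in_add_map_eq[OF lY Y(2) lY linear_map_comp[OF \<epsilon>(1) \<epsilon>(1)] \<epsilon>(1) _ y])
    fix h assume h: "h \<in> carrier (Hom Y)"
    have ph: "Hom_map M p h \<in> carrier (Hom X)" by (rule Hom_map_closed[OF p h])
    have "Hom_map M (\<lambda>y. \<epsilon> (\<epsilon> y)) h = Hom_map M \<epsilon> (Hom_map M \<epsilon> h)"
      by (simp add: Hom_map_def fun_eq_iff)
    also have "\<dots> = s (Hom_map M p (Hom_map M \<epsilon> h))"
      by (rule \<epsilon>(2)[OF Hom_map_closed[OF \<epsilon>(1) h], symmetric])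
    also have "\<dots> = s (Hom_map M p (s (Hom_map M p h)))" by (simp only: \<epsilon>(2)[OF h])
    also have "\<dots> = Hom_map M \<epsilon> h" unfolding s(2)[OF ph] by (rule \<epsilon>(2)[OF h])
    finally show "Hom_map M (\<lambda>y. \<epsilon> (\<epsilon> y)) h = Hom_map M \<epsilon> h" .
  qed
  let ?I = "\<epsilon> ` carrier Y" let ?W = "Y\<lparr>carrier := ?I\<rparr>"
  have I: "submodule ?I R Y" by (rule submodule_image[OF lY lY \<epsilon>(1) Y.submodule_carrier])
  have Isub: "?I \<subseteq> carrier Y" by (rule Y.submoduleD(1)[OF I])
  have W: "?W \<in> fg_modules R" by (rule submodule_finitely_generated[OF cring noetherian Y(1) I])
  have lW: "left_module R ?W" by (rule Y.left_module_submodule[OF I])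
  have addW: "in_add R M ?W"
  proof (rule in_add_retract[OF lY lW _ _ _ Y(2)])
    show "linear_map R Y ?W \<epsilon>" by (rule linear_map_cod_subset[OF \<epsilon>(1)]) auto
    show "linear_map R ?W Y (\<lambda>y. y)" by (rule linear_map_dom_subset[OF linear_map_id Isub])
  qed (auto simp: idem)
  have pW: "linear_map R ?W X p" by (rule linear_map_dom_subset[OF p Isub])
  have HomW: "h \<in> carrier (Hom Y)" if "h \<in> carrier (Hom ?W)" for h
    using that linear_map_cod_superset[where R = R and X = M and Y = Y and K = "?I" and f = h] Isub by (simp add: Hom_carrier)
  have eW: "Hom_map M \<epsilon> h = h" if h: "h \<in> carrier (Hom ?W)" for h
  proof (rule Hom_ext[OF Hom_map_closed[OF \<epsilon>(1) HomW[OF h]] HomW[OF h]])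
    fix m assume m: "m \<in> carrier M"
    have "h m \<in> ?I" using Hom_closed[OF h m] by simp
    then show "Hom_map M \<epsilon> h m = h m" using m idem by auto
  qed
  have "Hom_map M p ` carrier (Hom ?W) = carrier (Hom X)"
  proof
    show "Hom_map M p ` carrier (Hom ?W) \<subseteq> carrier (Hom X)" using Hom_map_closed[OF pW] by blast
    show "carrier (Hom X) \<subseteq> Hom_map M p ` carrier (Hom ?W)"
    proof
      fix x assume x: "x \<in> carrier (Hom X)"
      have sx: "s x \<in> carrier (Hom Y)" by (rule linear_mapD(1)[OF s(1) x])
      have e: "Hom_map M \<epsilon> (s x) = s x" using \<epsilon>(2)[OF sx] s(2)[OF x] by simp
      have "s x m \<in> ?I" if m: "m \<in> carrier M" for m
      proof -
        have "s x m = Hom_map M \<epsilon> (s x) m" by (simp only: e)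
        then show ?thesis using m Hom_closed[OF sx m] by simp
      qed
      then have "s x \<in> carrier (Hom ?W)"
        using sx linear_map_cod_subset[OF Hom_linear[OF sx]] by (simp add: Hom_carrier)
      then show "x \<in> Hom_map M p ` carrier (Hom ?W)"
        using s(2)[OF x] by (intro image_eqI[of _ _ "s x"]) simp_all
    qed
  qed
  note * = cl_approximation[OF W X pW this]
  let ?K = "{y \<in> carrier ?W. p y = \<zero>\<^bsub>X\<^esub>}"
  have K: "submodule ?K R ?W" by (rule submodule_kernel[OF lW lX pW])
  have fK: "?W\<lparr>carrier := ?K\<rparr> \<in> fg_modules R" by (rule submodule_finitely_generated[OF cring noetherian W K])
  have "cl (?W\<lparr>carrier := ?K\<rparr>) = \<one>\<^bsub>G\<^esub>"
  proof (rule cl_no_maps[OF fK])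
    fix g m assume g: "g \<in> carrier (Hom (?W\<lparr>carrier := ?K\<rparr>))" and m: "m \<in> carrier M"
    have gW: "g \<in> carrier (Hom ?W)"
      using g linear_map_cod_superset[where R = R and X = M and Y = "?W" and K = "?K" and f = g] by (simp add: Hom_carrier)
    have gY: "g \<in> carrier (Hom Y)" by (rule HomW[OF gW])
    have pg: "p (g m) = \<zero>\<^bsub>X\<^esub>" if "m \<in> carrier M" for m using Hom_closed[OF g that] by simp
    interpret HX: left_module E "Hom X" by (rule left_module_Hom[OF lX])
    have "Hom_map M p g = \<zero>\<^bsub>Hom X\<^esub>"
      by (rule Hom_ext[OF Hom_map_closed[OF p gY] HX.N.zero_closed]) (simp add: pg)
    then have "Hom_map M \<epsilon> g = \<zero>\<^bsub>Hom Y\<^esub>"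
      using \<epsilon>(2)[OF gY] linear_map_zero[OF HX.left_module_axioms left_module_Hom[OF lY] s(1)] by simp
    then have "g m = \<zero>\<^bsub>Hom Y\<^esub> m" using eW[OF gW] by simp
    then show "g m = \<zero>\<^bsub>?W\<lparr>carrier := ?K\<rparr>\<^esub>" using m by simp
  qed
  then have "cl X = cl ?W" using * cl_closed[OF X] by simp
  then show ?thesis using H(2)[OF W addW] by simp
qed

text \<open>
  The iterated approximations of \<open>X\<close> are compared with a given projective resolution one syzygy at a time. The
  identity of \<open>Hom\<^sub>R(M,X)\<close> is written as \<open>b a + h i\<close>, where \<open>b a\<close> factors through a module with a resolution of
  length \<open>n\<close> and \<open>h i\<close> through \<open>Hom\<^sub>R(M,Z)\<close> with \<open>Z\<close> in \<open>add M\<close>. The second summand absorbs the choices of lifts: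
  it plays the part of a homotopy and replaces the direct sums of Schanuel's lemma.
  
  If \<open>n = 0\<close>, both summands lift along \<open>\<pi> = Hom\<^sub>R(M,p)\<close>, where \<open>p : Y \<rightarrow> X\<close> is an approximation, hence \<open>\<pi>\<close> splits.
  Otherwise let \<open>X'\<close> be the kernel of \<open>p\<close> and lift \<open>a\<close>, \<open>b\<close>, \<open>h\<close> to \<open>a'\<close>, \<open>b'\<close>, \<open>h'\<close> on the level of \<open>Hom\<^sub>R(M,Y)\<close> and
  of a projective module over \<open>L\<close> with kernel the first syzygy. Then \<open>k = id - b' a' - h' i \<pi>\<close> has image in
  \<open>Hom\<^sub>R(M,X')\<close>, on which \<open>\<pi>\<close> vanishes, so that there \<open>id = b' a' + k\<close>: a decomposition of the same kind for \<open>X'\<close>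
  and \<open>n - 1\<close>.
\<close>

lemma cl_in_subgroup_if_resolution:
  fixes L :: "('b \<Rightarrow> 'b, ('b \<Rightarrow> 'b) module_univ) module"
  assumes H: "subgroup H G" "\<And>W. \<lbrakk>W \<in> fg_modules R; in_add R M W\<rbrakk> \<Longrightarrow> cl W \<in> H"
    and X: "X \<in> fg_modules R" and L: "left_module E L" "has_projective_resolution E n L"
    and a: "linear_map E (Hom X) L a" and b: "linear_map E L (Hom X) b"
    and Z: "Z \<in> fg_modules R" "in_add R M Z"
    and i: "linear_map E (Hom X) (Hom Z) i" and h: "linear_map E (Hom Z) (Hom X) h"
    and id: "\<And>x. x \<in> carrier (Hom X) \<Longrightarrow> b (a x) \<oplus>\<^bsub>Hom X\<^esub> h (i x) = x"
  shows "cl X \<in> H"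
  using X L a b Z i h id
proof (induction n arbitrary: X L a b Z i h)
  case (0 X L a b Z i h)
  note X = 0(1) and L = 0(2,3) and a = 0(4) and b = 0(5) and Z = 0(6,7) and i = 0(8) and h = 0(9) and id = 0(10)
  have lX: "left_module R X" and lZ: "left_module R Z" using X Z by (simp_all add: fg_modules_iff[OF cring])
  obtain Y p where Y: "Y \<in> fg_modules R" "in_add R M Y" and p: "linear_map R Y X p"
    and surj: "Hom_map M p ` carrier (Hom Y) = carrier (Hom X)" by (rule approximation[OF X]) iprover
  have lY: "left_module R Y" using Y by (simp add: fg_modules_iff[OF cring])
  have hX: "left_module E (Hom X)" and hY: "left_module E (Hom Y)" and hZ: "left_module E (Hom Z)"
    by (rule left_module_Hom[OF lX] left_module_Hom[OF lY] left_module_Hom[OF lZ])+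
  have \<pi>: "linear_map E (Hom Y) (Hom X) (Hom_map M p)" by (rule linear_map_Hom_map[OF lY lX p])
  obtain P :: "('b \<Rightarrow> 'b, ('b \<Rightarrow> 'b) module_univ) module" and d
    where P: "projective_module E P" "linear_map E P L d" "bij_betw d (carrier P) (carrier L)"
    by (rule has_projective_resolution_0[OF L]) iprover
  have lP: "left_module E P" using P(1) by (simp add: projective_module_def)
  obtain d' where d': "linear_map E L P d'" "\<And>y. y \<in> carrier L \<Longrightarrow> d (d' y) = y"
    by (rule linear_map_inverse[OF lP P(2,3)]) iprover
  obtain b' where b': "linear_map E P (Hom Y) b'" "\<And>x. x \<in> carrier P \<Longrightarrow> Hom_map M p (b' x) = b (d x)"
    by (rule projective_module_lift[OF P(1) hY finitely_generated_Hom[OF Y(1)] hX finitely_generated_Hom[OF X]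
          \<pi> surj linear_map_comp[OF P(2) b]]) iprover
  obtain h' where h': "linear_map E (Hom Z) (Hom Y) h'" "\<And>x. x \<in> carrier (Hom Z) \<Longrightarrow> Hom_map M p (h' x) = h x"
    by (rule in_add_lift[OF lZ Z(2) hY hX \<pi> surj h]) iprover
  let ?s = "\<lambda>x. b' (d' (a x)) \<oplus>\<^bsub>Hom Y\<^esub> h' (i x)"
  have s: "linear_map E (Hom X) (Hom Y) ?s"
    by (rule linear_map_add[OF hY linear_map_comp[OF linear_map_comp[OF a d'(1)] b'(1)] linear_map_comp[OF i h'(1)]])
  have "Hom_map M p (?s x) = x" if x: "x \<in> carrier (Hom X)" for x
  proof -
    have ax: "a x \<in> carrier L" and ix: "i x \<in> carrier (Hom Z)"
      by (rule linear_mapD(1)[OF a x] linear_mapD(1)[OF i x])+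
    have dax: "d' (a x) \<in> carrier P" by (rule linear_mapD(1)[OF d'(1) ax])
    have "Hom_map M p (?s x) = Hom_map M p (b' (d' (a x))) \<oplus>\<^bsub>Hom X\<^esub> Hom_map M p (h' (i x))"
      by (rule linear_mapD(2)[OF \<pi> linear_mapD(1)[OF b'(1) dax] linear_mapD(1)[OF h'(1) ix]])
    also have "\<dots> = x" by (simp only: b'(2)[OF dax] d'(2)[OF ax] h'(2)[OF ix] id[OF x])
    finally show ?thesis .
  qed
  from cl_in_subgroup_if_split[OF H X Y p s this] show ?case .
next
  case (Suc n X L a b Z i h)
  note IH = Suc(1)
  note X = Suc(2) and L = Suc(3,4) and a = Suc(5) and b = Suc(6) and Z = Suc(7,8) and i = Suc(9) and h = Suc(10) and id = Suc(11)
  have lX: "left_module R X" and lZ: "left_module R Z" using X Z by (simp_all add: fg_modules_iff[OF cring])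
  obtain Y p where Y: "Y \<in> fg_modules R" "in_add R M Y" and p: "linear_map R Y X p"
    and surj: "Hom_map M p ` carrier (Hom Y) = carrier (Hom X)" by (rule approximation[OF X]) iprover
  have lY: "left_module R Y" using Y by (simp add: fg_modules_iff[OF cring])
  interpret Y: left_module R Y by (rule lY)
  interpret hX: left_module E "Hom X" by (rule left_module_Hom[OF lX])
  interpret hY: left_module E "Hom Y" by (rule left_module_Hom[OF lY])
  interpret hZ: left_module E "Hom Z" by (rule left_module_Hom[OF lZ])
  note hX = hX.left_module_axioms and hY = hY.left_module_axioms and hZ = hZ.left_module_axioms
  let ?\<pi> = "Hom_map M p"
  have \<pi>: "linear_map E (Hom Y) (Hom X) ?\<pi>" by (rule linear_map_Hom_map[OF lY lX p])
  obtain P :: "('b \<Rightarrow> 'b, ('b \<Rightarrow> 'b) module_univ) module" and d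
    where P: "projective_module E P" and d: "linear_map E P L d" "d ` carrier P = carrier L"
    and res: "has_projective_resolution E n (P\<lparr>carrier := {x \<in> carrier P. d x = \<zero>\<^bsub>L\<^esub>}\<rparr>)"
    by (rule has_projective_resolution_Suc[OF L]) iprover
  have lP: "left_module E P" using P(1) by (simp add: projective_module_def)
  obtain b' where b': "linear_map E P (Hom Y) b'" "\<And>x. x \<in> carrier P \<Longrightarrow> ?\<pi> (b' x) = b (d x)"
    by (rule projective_module_lift[OF P hY finitely_generated_Hom[OF Y(1)] hX finitely_generated_Hom[OF X]
          \<pi> surj linear_map_comp[OF d(1) b]]) iprover
  obtain a' where a': "linear_map E (Hom Y) P a'" "\<And>y. y \<in> carrier (Hom Y) \<Longrightarrow> d (a' y) = a (?\<pi> y)"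
    by (rule in_add_lift[OF lY Y(2) lP L(1) d linear_map_comp[OF \<pi> a]]) iprover
  obtain h' where h': "linear_map E (Hom Z) (Hom Y) h'" "\<And>x. x \<in> carrier (Hom Z) \<Longrightarrow> ?\<pi> (h' x) = h x"
    by (rule in_add_lift[OF lZ Z(2) hY hX \<pi> surj h]) iprover
  define k where "k y = y \<ominus>\<^bsub>Hom Y\<^esub> (b' (a' y) \<oplus>\<^bsub>Hom Y\<^esub> h' (i (?\<pi> y)))" for y
  have sm: "linear_map E (Hom Y) (Hom Y) (\<lambda>y. b' (a' y) \<oplus>\<^bsub>Hom Y\<^esub> h' (i (?\<pi> y)))"
    by (rule linear_map_add[OF hY linear_map_comp[OF a'(1) b'(1)] linear_map_comp[OF linear_map_comp[OF \<pi> i] h'(1)]])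
  have k: "linear_map E (Hom Y) (Hom Y) k"
    unfolding k_def by (rule linear_map_diff_map[OF hY linear_map_id sm])
  have \<pi>k: "?\<pi> (k y) = \<zero>\<^bsub>Hom X\<^esub>" if y: "y \<in> carrier (Hom Y)" for y
  proof -
    have \<pi>y: "?\<pi> y \<in> carrier (Hom X)" and ay: "a' y \<in> carrier P"
      by (rule linear_mapD(1)[OF \<pi> y] linear_mapD(1)[OF a'(1) y])+
    have iy: "i (?\<pi> y) \<in> carrier (Hom Z)" by (rule linear_mapD(1)[OF i \<pi>y])
    have "?\<pi> (b' (a' y) \<oplus>\<^bsub>Hom Y\<^esub> h' (i (?\<pi> y))) = ?\<pi> (b' (a' y)) \<oplus>\<^bsub>Hom X\<^esub> ?\<pi> (h' (i (?\<pi> y)))"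
      by (rule linear_mapD(2)[OF \<pi> linear_mapD(1)[OF b'(1) ay] linear_mapD(1)[OF h'(1) iy]])
    also have "\<dots> = ?\<pi> y" by (simp only: b'(2)[OF ay] a'(2)[OF y] h'(2)[OF iy] id[OF \<pi>y])
    finally show ?thesis
      unfolding k_def linear_map_diff[OF hY hX \<pi> y linear_mapD(1)[OF sm y]] using \<pi>y
      by (simp add: hX.minus_eq_zero_iff)
  qed
  let ?K = "{y \<in> carrier Y. p y = \<zero>\<^bsub>X\<^esub>}"
  let ?X = "Y\<lparr>carrier := ?K\<rparr>"
  have K: "submodule ?K R Y" by (rule submodule_kernel[OF lY lX p])
  have X1: "?X \<in> fg_modules R" by (rule submodule_finitely_generated[OF cring noetherian Y(1) K])
  have HomK: "y \<in> carrier (Hom ?X) \<longleftrightarrow> y \<in> carrier (Hom Y) \<and> ?\<pi> y = \<zero>\<^bsub>Hom X\<^esub>" for y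
  proof
    assume y: "y \<in> carrier (Hom ?X)"
    have yY: "y \<in> carrier (Hom Y)"
      using y linear_map_cod_superset[where R = R and X = M and Y = Y and K = "?K" and f = y] by (simp add: Hom_carrier)
    have "?\<pi> y = \<zero>\<^bsub>Hom X\<^esub>"
      using Hom_closed[OF y] by (intro Hom_ext[OF Hom_map_closed[OF p yY] hX.N.zero_closed]) simp
    then show "y \<in> carrier (Hom Y) \<and> ?\<pi> y = \<zero>\<^bsub>Hom X\<^esub>" using yY by simp
  next
    assume y: "y \<in> carrier (Hom Y) \<and> ?\<pi> y = \<zero>\<^bsub>Hom X\<^esub>"
    have "y m \<in> ?K" if m: "m \<in> carrier M" for m
    proof -
      have "p (y m) = ?\<pi> y m" using m by simp
      also have "\<dots> = \<zero>\<^bsub>X\<^esub>" using y m by simp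
      finally show ?thesis using Hom_closed[OF conjunct1[OF y] m] by simp
    qed
    then show "y \<in> carrier (Hom ?X)"
      using y linear_map_cod_subset[OF Hom_linear[OF conjunct1[OF y]]] by (simp add: Hom_carrier)
  qed
  define N where "N = {y \<in> carrier (Hom Y). ?\<pi> y = \<zero>\<^bsub>Hom X\<^esub>}"
  have HX1: "Hom ?X = (Hom Y)\<lparr>carrier := N\<rparr>"
  proof -
    have "carrier (Hom ?X) = N" using HomK unfolding N_def by blast
    then show ?thesis by (simp add: Hom_module_def)
  qed
  have Nsub: "N \<subseteq> carrier (Hom Y)" unfolding N_def by blast
  let ?L = "{x \<in> carrier P. d x = \<zero>\<^bsub>L\<^esub>}"
  have Ls: "submodule ?L E P" by (rule submodule_kernel[OF lP L(1) d(1)])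
  have "cl ?X \<in> H"
  proof (rule IH[OF X1 left_module.left_module_submodule[OF lP Ls] res])
    show "linear_map E (Hom ?X) (P\<lparr>carrier := ?L\<rparr>) a'" unfolding HX1
      using linear_map_zero[OF hX L(1) a] linear_mapD(1)[OF a'(1)] a'(2)
      by (intro linear_map_subset[OF a'(1) Nsub]) (simp add: N_def)
    show "linear_map E (P\<lparr>carrier := ?L\<rparr>) (Hom ?X) b'" unfolding HX1
      using linear_map_zero[OF L(1) hX b] linear_mapD(1)[OF b'(1)] b'(2)
      by (intro linear_map_subset[OF b'(1)]) (auto simp: N_def)
    show "Y \<in> fg_modules R" "in_add R M Y" by (rule Y)+
    show "linear_map E (Hom ?X) (Hom Y) (\<lambda>y. y)" unfolding HX1
      by (rule linear_map_dom_subset[OF linear_map_id Nsub])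
    show "linear_map E (Hom Y) (Hom ?X) k" unfolding HX1
      by (rule linear_map_cod_subset[OF k]) (simp add: N_def \<pi>k linear_mapD(1)[OF k])
    fix y assume "y \<in> carrier (Hom ?X)"
    then have y: "y \<in> carrier (Hom Y)" "?\<pi> y = \<zero>\<^bsub>Hom X\<^esub>" by (simp_all add: HomK)
    have bay: "b' (a' y) \<in> carrier (Hom Y)"
      by (rule linear_mapD(1)[OF b'(1) linear_mapD(1)[OF a'(1) y(1)]])
    have "h' (i (?\<pi> y)) = \<zero>\<^bsub>Hom Y\<^esub>"
      by (simp only: y(2) linear_map_zero[OF hX hZ i] linear_map_zero[OF hZ hY h'(1)])
    then have "k y = y \<ominus>\<^bsub>Hom Y\<^esub> b' (a' y)" using bay by (simp add: k_def)
    then show "b' (a' y) \<oplus>\<^bsub>Hom ?X\<^esub> k y = y"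
      unfolding HX1 using hY.add_minus_cancel[OF y(1) bay] by simp
  qed
  moreover have "cl Y = cl ?X \<otimes>\<^bsub>G\<^esub> cl X" by (rule cl_approximation[OF Y(1) X p surj])
  then have "cl X = inv\<^bsub>G\<^esub> cl ?X \<otimes>\<^bsub>G\<^esub> cl Y"
    using cl_closed[OF X1] cl_closed[OF X] by (simp add: G.m_assoc[symmetric])
  ultimately show ?case
    using H(1) H(2)[OF Y] by (simp add: subgroup.m_closed subgroup.m_inv_closed)
qed

lemma cl_in_subgroup:
  assumes H: "subgroup H G" "\<And>W. \<lbrakk>W \<in> fg_modules R; in_add R M W\<rbrakk> \<Longrightarrow> cl W \<in> H"
    and gd: "gl_dim E < \<infinity>" and X: "X \<in> fg_modules R"
  shows "cl X \<in> H"
proof -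
  have lX: "left_module R X" using X by (simp add: fg_modules_iff[OF cring])
  have hX: "left_module E (Hom X)" by (rule left_module_Hom[OF lX])
  obtain L :: "('b \<Rightarrow> 'b, ('b \<Rightarrow> 'b) module_univ) module" and \<phi> where
    L: "left_module E L" "\<phi> \<in> linear_maps E (Hom X) L" "bij_betw \<phi> (carrier (Hom X)) (carrier L)"
    by (rule finitely_generated_module_in_universe[OF hX finitely_generated_Hom[OF X]]) iprover
  note \<phi> = linear_maps_imp_linear_map[OF L(2)]
  obtain \<psi> where \<psi>: "linear_map E L (Hom X) \<psi>" "\<And>x. x \<in> carrier (Hom X) \<Longrightarrow> \<psi> (\<phi> x) = x"
    by (rule linear_map_inverse[OF hX \<phi> L(3)]) iprover
  have "proj_dim E L \<le> gl_dim E" unfolding gl_dim_def using L(1) by (intro Sup_upper) blast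
  then have "proj_dim E L < \<infinity>" using gd by (rule order.strict_trans1)
  have "{enat n |n. has_projective_resolution E n L} \<noteq> {}"
  proof
    assume empty: "{enat n |n. has_projective_resolution E n L} = {}"
    have "proj_dim E L = \<infinity>" unfolding proj_dim_def empty by (simp add: Inf_enat_def)
    with \<open>proj_dim E L < \<infinity>\<close> show False by simp
  qed
  then obtain n where n: "has_projective_resolution E n L" by blast
  obtain Y p where Y: "Y \<in> fg_modules R" "in_add R M Y" "linear_map R Y X p"
    by (rule approximation[OF X]) iprover
  have lY: "left_module R Y" using Y by (simp add: fg_modules_iff[OF cring])
  interpret hX: left_module E "Hom X" by (rule hX)
  have id: "\<psi> (\<phi> x) \<oplus>\<^bsub>Hom X\<^esub> \<zero>\<^bsub>Hom X\<^esub> = x" if "x \<in> carrier (Hom X)" for x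
    using that by (simp add: \<psi>(2) hX.N.r_zero)
  show ?thesis
    by (rule cl_in_subgroup_if_resolution[OF H X L(1) n \<phi> \<psi>(1) Y(1,2)
        linear_map_zero_map[OF left_module_Hom[OF lY]] linear_map_zero_map[OF hX.left_module_axioms] id])
qed

end


section \<open>Maximal submodules over a semilocal ring\<close>

text \<open>
  Dickson's lemma, by induction on the number of coordinates. A family \<open>F\<close> that works for the old coordinates also
  works for all vectors whose new coordinate is at least the bound \<open>m\<close> of the new coordinates on \<open>F\<close>; the
  other vectors are treated separately for each of the finitely many values of the new coordinate.
\<close>

lemma Dickson:
  fixes t :: "'w \<Rightarrow> 'l \<Rightarrow> nat"
  assumes "finite L"
  obtains F where "finite F" "F \<subseteq> T" "\<And>w. w \<in> T \<Longrightarrow> \<exists>v\<in>F. \<forall>l\<in>L. t v l \<le> t w l"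
proof -
  have "\<exists>F. finite F \<and> F \<subseteq> T \<and> (\<forall>w\<in>T. \<exists>v\<in>F. \<forall>l\<in>L. t v l \<le> t w l)" for T :: "'w set"
    using assms
  proof (induction L arbitrary: T)
    case empty
    show ?case
    proof (cases "T = {}")
      case False
      then obtain w where "w \<in> T" by blast
      then show ?thesis by (intro exI[of _ "{w}"]) auto
    qed auto
  next
    case (insert l L)
    obtain F where F: "finite F" "F \<subseteq> T" "\<forall>w\<in>T. \<exists>v\<in>F. \<forall>l\<in>L. t v l \<le> t w l"
      using insert.IH[of T] by blast
    have "\<forall>j. \<exists>G. finite G \<and> G \<subseteq> {w \<in> T. t w l = j} \<and>
        (\<forall>w\<in>{w \<in> T. t w l = j}. \<exists>v\<in>G. \<forall>l\<in>L. t v l \<le> t w l)"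
      using insert.IH by blast
    from choice[OF this] obtain G where G0: "\<forall>j. finite (G j) \<and> G j \<subseteq> {w \<in> T. t w l = j} \<and>
        (\<forall>w\<in>{w \<in> T. t w l = j}. \<exists>v\<in>G j. \<forall>l\<in>L. t v l \<le> t w l)" ..
    have G: "finite (G j)" "G j \<subseteq> {w \<in> T. t w l = j}"
      "\<lbrakk>w \<in> T; t w l = j\<rbrakk> \<Longrightarrow> \<exists>v\<in>G j. \<forall>l\<in>L. t v l \<le> t w l" for j w
      using G0[rule_format, of j] by simp_all
    define m where "m = (\<Sum>v\<in>F. t v l)"
    have m: "t v l \<le> m" if "v \<in> F" for v unfolding m_def using F(1) that by (intro member_le_sum) auto
    have "\<exists>v\<in>F \<union> (\<Union>j<m. G j). \<forall>l'\<in>insert l L. t v l' \<le> t w l'" if w: "w \<in> T" for w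
    proof (cases "t w l < m")
      case True
      obtain v where "v \<in> G (t w l)" "\<forall>l\<in>L. t v l \<le> t w l" using G(3)[OF w refl] by blast
      moreover have "t v l = t w l" if "v \<in> G (t w l)" for v using G(2) that by blast
      ultimately show ?thesis using True by (intro bexI[of _ v]) auto
    next
      case False
      obtain v where "v \<in> F" "\<forall>l\<in>L. t v l \<le> t w l" using F(3) w by blast
      then show ?thesis using False m[of v] by (intro bexI[of _ v]) auto
    qed
    moreover have "finite (F \<union> (\<Union>j<m. G j))" using F(1) G(1) by simp
    moreover have "F \<union> (\<Union>j<m. G j) \<subseteq> T" using F(2) G(2) by blast
    ultimately show ?case by (intro exI[of _ "F \<union> (\<Union>j<m. G j)"]) simp
  qed
  from this[of T] show thesis using that by blast
qed

definition maximal_submodule :: "('e, 'c) ring_scheme \<Rightarrow> ('e, 'n, 'd) module_scheme \<Rightarrow> 'n set \<Rightarrow> bool"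
  where "maximal_submodule E N B \<longleftrightarrow> submodule B E N \<and> B \<noteq> carrier N \<and>
    (\<forall>C. submodule C E N \<longrightarrow> B \<subseteq> C \<longrightarrow> C = B \<or> C = carrier N)"

lemma maximal_submoduleD:
  assumes "maximal_submodule E N B"
  shows "submodule B E N" "B \<noteq> carrier N" "\<lbrakk>submodule C E N; B \<subseteq> C\<rbrakk> \<Longrightarrow> C = B \<or> C = carrier N"
  using assms unfolding maximal_submodule_def by iprover+

text \<open>
  The number of generators that occur as leading terms of elements of \<open>D\<close>. For submodules containing \<open>I N\<close>, where \<open>I\<close> is
  a maximal ideal, it replaces the dimension of \<open>D/I N\<close> over the field \<open>R/I\<close>: by \<open>leading_count_eq\<close> it is
  strictly monotone on them.
\<close>

primrec leading_count :: "('e, 'c) ring_scheme \<Rightarrow> ('e, 'n, 'd) module_scheme \<Rightarrow> 'n set \<Rightarrow> 'n list \<Rightarrow> nat" where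
  "leading_count R N D [] = 0"
| "leading_count R N D (x # xs) = leading_count R N D xs + of_bool (\<exists>v\<in>lspan R N xs. x \<oplus>\<^bsub>N\<^esub> v \<in> D)"

lemma leading_count_mono:
  assumes "D \<subseteq> D'"
  shows "leading_count R N D xs \<le> leading_count R N D' xs"
proof (induction xs)
  case (Cons x xs)
  then show ?case using assms by (auto intro: add_mono)
qed simp

context left_module
begin

lemma maximal_sum:
  assumes B: "maximal_submodule E N B" and D: "submodule D E N" "\<not> D \<subseteq> B" and x: "x \<in> carrier N"
  obtains b d where "b \<in> B" "d \<in> D" "x = b \<oplus>\<^bsub>N\<^esub> d"
proof -
  note BD = maximal_submoduleD[OF B]
  let ?S = "{x \<oplus>\<^bsub>N\<^esub> y | x y. x \<in> B \<and> y \<in> D}"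
  have S: "submodule ?S E N" by (rule submodule_sum[OF BD(1) D(1)])
  have BS: "B \<subseteq> ?S"
  proof
    fix b assume b: "b \<in> B"
    then have "b = b \<oplus>\<^bsub>N\<^esub> \<zero>\<^bsub>N\<^esub>" using submoduleD(2)[OF BD(1) b] by simp
    then show "b \<in> ?S" using b submoduleD(3)[OF D(1)] by blast
  qed
  obtain d where d: "d \<in> D" "d \<notin> B" using D(2) by blast
  have "d = \<zero>\<^bsub>N\<^esub> \<oplus>\<^bsub>N\<^esub> d" using submoduleD(2)[OF D(1) d(1)] by simp
  then have "d \<in> ?S" using d(1) submoduleD(3)[OF BD(1)] by blast
  then have "?S \<noteq> B" using d(2) by metis
  then have "?S = carrier N" using BD(3)[OF S BS] by iprover
  then have "x \<in> ?S" using x by simp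
  then show thesis using that by blast
qed

lemma maximal_generator:
  assumes B: "maximal_submodule E N B" and y: "y \<in> carrier N" "y \<notin> B" and x: "x \<in> carrier N"
  obtains a where "a \<in> carrier E" "x \<ominus>\<^bsub>N\<^esub> a \<odot>\<^bsub>N\<^esub> y \<in> B"
proof -
  note B1 = maximal_submoduleD(1)[OF B]
  have ys: "set [y] \<subseteq> carrier N" using y by simp
  have "submodule (lspan E N [y]) E N" "\<not> lspan E N [y] \<subseteq> B"
    using submodule_lspan[OF ys] set_subset_lspan[OF ys] y by auto
  from maximal_sum[OF B this x] obtain b d where bd: "b \<in> B" "d \<in> lspan E N [y]" "x = b \<oplus>\<^bsub>N\<^esub> d" by blast
  then obtain a where a: "a \<in> carrier E" "d = a \<odot>\<^bsub>N\<^esub> y" using y by (auto simp: smult_closed)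
  have "b \<in> carrier N" "d \<in> carrier N" using bd(1) submoduleD(2)[OF B1] a y by (auto simp: smult_closed)
  then have "x \<ominus>\<^bsub>N\<^esub> d = b" unfolding bd(3) by (subst N.a_comm) (simp_all add: add_diff_left)
  then show thesis using that[of a] a bd(1) by simp
qed

text \<open>
  Irredundance means that \<open>B\<close> and the intersection of the other members span \<open>N\<close>, so the congruences can be corrected
  one by one without disturbing those already achieved.
\<close>

lemma chinese_remainder:
  assumes fin: "finite \<B>" and mx: "\<And>B. B \<in> \<B> \<Longrightarrow> maximal_submodule E N B"
    and irr: "\<And>B. B \<in> \<B> \<Longrightarrow> \<not> carrier N \<inter> \<Inter>(\<B> - {B}) \<subseteq> B"
    and q: "\<And>B. B \<in> \<B> \<Longrightarrow> q B \<in> carrier N"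
  obtains p where "p \<in> carrier N" "\<And>B. B \<in> \<B> \<Longrightarrow> p \<ominus>\<^bsub>N\<^esub> q B \<in> B"
proof -
  have "\<exists>p\<in>carrier N. \<forall>B\<in>\<C>. p \<ominus>\<^bsub>N\<^esub> q B \<in> B" if "finite \<C>" "\<C> \<subseteq> \<B>" for \<C> using that
  proof (induction \<C>)
    case empty then show ?case by (intro bexI[of _ "\<zero>\<^bsub>N\<^esub>"]) auto
  next
    case (insert B \<C>)
    then obtain p where p: "p \<in> carrier N" "\<And>C. C \<in> \<C> \<Longrightarrow> p \<ominus>\<^bsub>N\<^esub> q C \<in> C" by auto
    have B: "B \<in> \<B>" using insert by simp
    let ?D = "carrier N \<inter> \<Inter>(\<B> - {B})"
    have D: "submodule ?D E N" using maximal_submoduleD(1)[OF mx] by (intro submodule_Inter) auto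
    obtain b d where bd: "b \<in> B" "d \<in> ?D" "q B \<ominus>\<^bsub>N\<^esub> p = b \<oplus>\<^bsub>N\<^esub> d"
      by (rule maximal_sum[OF mx[OF B] D irr[OF B] N.minus_closed[OF q[OF B] p(1)]]) iprover
    have bc: "b \<in> carrier N" "d \<in> carrier N" using bd(2) submoduleD(2)[OF maximal_submoduleD(1)[OF mx[OF B]] bd(1)] by auto
    have "p \<oplus>\<^bsub>N\<^esub> d \<ominus>\<^bsub>N\<^esub> q B = \<ominus>\<^bsub>N\<^esub> b"
    proof -
      have "q B = p \<oplus>\<^bsub>N\<^esub> (b \<oplus>\<^bsub>N\<^esub> d)" using add_minus_cancel[OF q[OF B] p(1)] bd(3) by simp
      also have "\<dots> = (p \<oplus>\<^bsub>N\<^esub> d) \<oplus>\<^bsub>N\<^esub> b" using p bc by (simp add: N.a_ac)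
      finally have e: "q B = (p \<oplus>\<^bsub>N\<^esub> d) \<oplus>\<^bsub>N\<^esub> b" .
      have "p \<oplus>\<^bsub>N\<^esub> d \<in> carrier N" using p bc by simp
      then show ?thesis unfolding e using bc
        by (simp add: a_minus_def N.minus_add) (simp add: N.r_neg flip: N.a_assoc)
    qed
    then have 1: "p \<oplus>\<^bsub>N\<^esub> d \<ominus>\<^bsub>N\<^esub> q B \<in> B"
      using submoduleD(6)[OF maximal_submoduleD(1)[OF mx[OF B]] bd(1)] by simp
    have 2: "p \<oplus>\<^bsub>N\<^esub> d \<ominus>\<^bsub>N\<^esub> q C \<in> C" if C: "C \<in> \<C>" for C
    proof -
      have CB: "C \<in> \<B>" "C \<noteq> B" using C insert by auto
      note Cs = maximal_submoduleD(1)[OF mx[OF CB(1)]]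
      have dC: "d \<in> C" using bd(2) CB by blast
      have pd: "p \<oplus>\<^bsub>N\<^esub> d \<ominus>\<^bsub>N\<^esub> p \<in> C" using dC add_diff_left p bc by simp
      show ?thesis
        by (rule cong_trans[OF Cs _ p(1) q[OF CB(1)] pd p(2)[OF C]]) (use p bc in simp)
    qed
    show ?case using 1 2 p bc by (intro bexI[of _ "p \<oplus>\<^bsub>N\<^esub> d"]) auto
  qed
  from this[OF fin order_refl] show thesis using that by blast
qed

lemma ideal_annihilator:
  assumes comm: "cring E" and D: "submodule D E N" and x: "x \<in> carrier N"
  shows "ideal {r \<in> carrier E. r \<odot>\<^bsub>N\<^esub> x \<in> D} E"
proof -
  have "{r \<in> carrier E. \<exists>v\<in>{\<zero>\<^bsub>N\<^esub>}. r \<odot>\<^bsub>N\<^esub> x \<oplus>\<^bsub>N\<^esub> v \<in> D} = {r \<in> carrier E. r \<odot>\<^bsub>N\<^esub> x \<in> D}"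
    using x by (auto simp: smult_closed)
  then show ?thesis using submodule_coefficients[OF submodule_zero D x comm] by simp
qed

text \<open>
  The simple module \<open>N/D\<close> is generated by any nonzero element \<open>x\<close>, and \<open>I\<close> is the annihilator of \<open>x\<close> in it.
\<close>

lemma maximal_submodule_maximalideal:
  assumes comm: "cring E" and D: "maximal_submodule E N D"
  obtains I where "maximalideal I E" "\<And>r n. \<lbrakk>r \<in> I; n \<in> carrier N\<rbrakk> \<Longrightarrow> r \<odot>\<^bsub>N\<^esub> n \<in> D"
proof -
  interpret cring E by fact
  note D1 = maximal_submoduleD[OF D]
  obtain x where x: "x \<in> carrier N" "x \<notin> D" using D1(1,2) submoduleD(1)[OF D1(1)] by blast
  let ?I = "{r \<in> carrier E. r \<odot>\<^bsub>N\<^esub> x \<in> D}"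
  have id: "ideal ?I E" by (rule ideal_annihilator[OF comm D1(1) x(1)])
  have n1: "\<one> \<notin> ?I" using x by (simp add: smult_one)
  have "maximalideal ?I E"
  proof (rule maximalidealI[OF id])
    show "carrier E \<noteq> ?I" using n1 E.one_closed by blast
    fix J assume J: "ideal J E" "?I \<subseteq> J" "J \<subseteq> carrier E"
    interpret J: ideal J E by (rule J(1))
    show "J = ?I \<or> J = carrier E"
    proof (cases "J \<subseteq> ?I")
      case True then show ?thesis using J(2) by blast
    next
      case False
      then obtain r where r: "r \<in> J" "r \<notin> ?I" by blast
      have rE: "r \<in> carrier E" using r J(3) by blast
      have rx: "r \<odot>\<^bsub>N\<^esub> x \<in> carrier N" "r \<odot>\<^bsub>N\<^esub> x \<notin> D" using r rE x by (auto simp: smult_closed)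
      obtain s where s: "s \<in> carrier E" "x \<ominus>\<^bsub>N\<^esub> s \<odot>\<^bsub>N\<^esub> (r \<odot>\<^bsub>N\<^esub> x) \<in> D"
        by (rule maximal_generator[OF D rx x(1)]) iprover
      have "(\<one> \<ominus> s \<otimes> r) \<odot>\<^bsub>N\<^esub> x = x \<ominus>\<^bsub>N\<^esub> s \<odot>\<^bsub>N\<^esub> (r \<odot>\<^bsub>N\<^esub> x)"
        using s rE x by (simp add: smult_diff_left smult_assoc smult_one)
      then have "\<one> \<ominus> s \<otimes> r \<in> J" using s rE J(2) by auto
      moreover have "s \<otimes> r \<in> J" using r(1) s(1) by (rule J.I_l_closed)
      ultimately have "(\<one> \<ominus> s \<otimes> r) \<oplus> s \<otimes> r \<in> J" by (rule J.a_closed)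
      then have "\<one> \<in> J" using s rE by (simp add: a_minus_def E.a_assoc E.l_neg)
      then show ?thesis using J.one_imp_carrier by simp
    qed
  qed
  moreover have "r \<odot>\<^bsub>N\<^esub> n \<in> D" if r: "r \<in> ?I" and n: "n \<in> carrier N" for r n
  proof -
    obtain s where s: "s \<in> carrier E" "n \<ominus>\<^bsub>N\<^esub> s \<odot>\<^bsub>N\<^esub> x \<in> D"
      by (rule maximal_generator[OF D x n]) iprover
    have rE: "r \<in> carrier E" using r by simp
    have "r \<odot>\<^bsub>N\<^esub> n \<ominus>\<^bsub>N\<^esub> r \<odot>\<^bsub>N\<^esub> (s \<odot>\<^bsub>N\<^esub> x) \<in> D"
      using s x n rE by (intro cong_smult[OF D1(1)]) (auto simp: smult_closed)
    moreover have "r \<odot>\<^bsub>N\<^esub> (s \<odot>\<^bsub>N\<^esub> x) = s \<odot>\<^bsub>N\<^esub> (r \<odot>\<^bsub>N\<^esub> x)"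
      using rE s x by (simp add: m_comm[of r s] flip: smult_assoc)
    moreover have "s \<odot>\<^bsub>N\<^esub> (r \<odot>\<^bsub>N\<^esub> x) \<in> D" using r s submoduleD(5)[OF D1(1)] by simp
    ultimately show ?thesis
      using cong_mem[OF D1(1), of "r \<odot>\<^bsub>N\<^esub> n" "s \<odot>\<^bsub>N\<^esub> (r \<odot>\<^bsub>N\<^esub> x)"] rE s x n by (simp add: smult_closed)
  qed
  ultimately show thesis using that[of ?I] by blast
qed

lemma maximalideal_inverse:
  assumes comm: "cring E" and I: "maximalideal I E" and r: "r \<in> carrier E" "r \<notin> I"
  obtains s i where "s \<in> carrier E" "i \<in> I" "i \<oplus> s \<otimes> r = \<one>"
proof -
  interpret cring E by fact
  interpret I: maximalideal I E by fact
  let ?J = "I <+>\<^bsub>E\<^esub> PIdl r"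
  have J: "ideal ?J E" by (rule add_ideals[OF I.is_ideal cgenideal_ideal[OF r(1)]])
  have IJ: "I \<subseteq> ?J"
  proof
    fix i assume i: "i \<in> I"
    have "i = i \<oplus> \<zero> \<otimes> r" using i r by (simp add: I.a_Hcarr)
    then show "i \<in> ?J" using i unfolding set_add_def' cgenideal_def by blast
  qed
  have "r = \<zero> \<oplus> \<one> \<otimes> r" using r by simp
  then have "r \<in> ?J" using I.zero_closed unfolding set_add_def' cgenideal_def by blast
  then have "?J = carrier E" using I.I_maximal[OF J IJ] ideal.Icarr[OF J] r by blast
  then have "\<one> \<in> ?J" by simp
  then obtain i s where "i \<in> I" "s \<in> carrier E" "\<one> = i \<oplus> s \<otimes> r"
    unfolding set_add_def' cgenideal_def by auto
  then show thesis by (intro that[of s i]) simp_all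
qed

text \<open>
  Let \<open>y = r x + v\<close> in \<open>D'\<close> have leading term \<open>r x\<close>. If \<open>r \<in> I\<close>, then \<open>r x \<in> D\<close> can be subtracted. Otherwise \<open>r\<close> is
  invertible modulo \<open>I\<close>, so that \<open>x\<close> is a leading term in \<open>D'\<close>, hence by equality of the counts in \<open>D\<close>, and a
  multiple of the corresponding element of \<open>D\<close> can be subtracted.
\<close>

lemma leading_count_eq:
  assumes comm: "cring E" and I: "maximalideal I E"
    and D: "submodule D E N" and D': "submodule D' E N" and DD': "D \<subseteq> D'"
    and ID: "\<And>r n. \<lbrakk>r \<in> I; n \<in> carrier N\<rbrakk> \<Longrightarrow> r \<odot>\<^bsub>N\<^esub> n \<in> D"
  shows "\<lbrakk>set xs \<subseteq> carrier N; leading_count E N D' xs \<le> leading_count E N D xs\<rbrakk> \<Longrightarrow>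
    D' \<inter> lspan E N xs \<subseteq> D"
proof (induction xs)
  case Nil then show ?case using submoduleD(3)[OF D] by auto
next
  case (Cons x xs)
  interpret cring E by fact
  interpret I: maximalideal I E by fact
  let ?V = "lspan E N xs"
  have x: "x \<in> carrier N" and V: "submodule ?V E N" using Cons.prems submodule_lspan by auto
  have le: "leading_count E N D xs \<le> leading_count E N D' xs" by (rule leading_count_mono[OF DD'])
  let ?f = "\<lambda>D. \<exists>v\<in>?V. x \<oplus>\<^bsub>N\<^esub> v \<in> D"
  have ff: "?f D \<Longrightarrow> ?f D'" using DD' by blast
  have le': "leading_count E N D' xs \<le> leading_count E N D xs" and flag: "?f D' \<Longrightarrow> ?f D"
    using Cons.prems(2) le ff by (auto simp: of_bool_def split: if_splits)
  have IH: "D' \<inter> ?V \<subseteq> D" using Cons.prems le' by (intro Cons.IH) auto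
  show ?case
  proof
    fix y assume y: "y \<in> D' \<inter> lspan E N (x # xs)"
    then obtain r v where rv: "r \<in> carrier E" "v \<in> ?V" "y = r \<odot>\<^bsub>N\<^esub> x \<oplus>\<^bsub>N\<^esub> v" by auto
    have vc: "v \<in> carrier N" by (rule submoduleD(2)[OF V rv(2)])
    have yc: "y \<in> carrier N" using y submoduleD(2)[OF D'] by auto
    show "y \<in> D"
    proof (cases "r \<in> I")
      case True
      then have rx: "r \<odot>\<^bsub>N\<^esub> x \<in> D" using x by (rule ID)
      have "y \<ominus>\<^bsub>N\<^esub> r \<odot>\<^bsub>N\<^esub> x \<in> D'" using y rx DD' submoduleD(7)[OF D'] by blast
      then have "v \<in> D'" using rv x vc by (simp add: add_diff_left smult_closed)
      then have "v \<in> D" using IH rv(2) by blast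
      then show ?thesis unfolding rv(3) by (rule submoduleD(4)[OF D rx])
    next
      case False
      obtain s i where s: "s \<in> carrier E" "i \<in> I" "i \<oplus> s \<otimes> r = \<one>"
        by (rule maximalideal_inverse[OF comm I rv(1) False]) iprover
      have ic: "i \<in> carrier E" using s(2) by (rule I.a_Hcarr)
      have "i \<odot>\<^bsub>N\<^esub> x \<oplus>\<^bsub>N\<^esub> s \<odot>\<^bsub>N\<^esub> y = (i \<oplus> s \<otimes> r) \<odot>\<^bsub>N\<^esub> x \<oplus>\<^bsub>N\<^esub> s \<odot>\<^bsub>N\<^esub> v"
        unfolding rv(3) using s(1) ic x vc rv(1)
        by (simp add: smult_l_distr smult_r_distr smult_assoc smult_closed N.a_assoc)
      then have "i \<odot>\<^bsub>N\<^esub> x \<oplus>\<^bsub>N\<^esub> s \<odot>\<^bsub>N\<^esub> y = x \<oplus>\<^bsub>N\<^esub> s \<odot>\<^bsub>N\<^esub> v"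
        using s(3) x by (simp add: smult_one)
      moreover have "i \<odot>\<^bsub>N\<^esub> x \<oplus>\<^bsub>N\<^esub> s \<odot>\<^bsub>N\<^esub> y \<in> D'"
        using ID[OF s(2) x] DD' y s(1) submoduleD(4,5)[OF D'] by blast
      moreover have "s \<odot>\<^bsub>N\<^esub> v \<in> ?V" by (rule submoduleD(5)[OF V s(1) rv(2)])
      ultimately have "?f D'" by metis
      then obtain w where w: "w \<in> ?V" "x \<oplus>\<^bsub>N\<^esub> w \<in> D" using flag by blast
      have wc: "w \<in> carrier N" by (rule submoduleD(2)[OF V w(1)])
      have rw: "r \<odot>\<^bsub>N\<^esub> (x \<oplus>\<^bsub>N\<^esub> w) \<in> D" by (rule submoduleD(5)[OF D rv(1) w(2)])
      have e: "y \<ominus>\<^bsub>N\<^esub> r \<odot>\<^bsub>N\<^esub> (x \<oplus>\<^bsub>N\<^esub> w) = v \<ominus>\<^bsub>N\<^esub> r \<odot>\<^bsub>N\<^esub> w"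
      proof -
        have c: "r \<odot>\<^bsub>N\<^esub> x \<in> carrier N" "r \<odot>\<^bsub>N\<^esub> w \<in> carrier N" using rv(1) x wc by (auto simp: smult_closed)
        show ?thesis unfolding rv(3) smult_r_distr[OF rv(1) x wc] using c vc
          by (simp add: a_minus_def N.minus_add N.a_ac) (simp add: N.r_neg1 N.r_neg2 add_neg_cancel N.r_neg)
      qed
      have "v \<ominus>\<^bsub>N\<^esub> r \<odot>\<^bsub>N\<^esub> w \<in> D' \<inter> ?V"
        using submoduleD(7)[OF V rv(2) submoduleD(5)[OF V rv(1) w(1)]]
          submoduleD(7)[OF D', of y "r \<odot>\<^bsub>N\<^esub> (x \<oplus>\<^bsub>N\<^esub> w)"] y rw DD' e by auto
      then have "y \<ominus>\<^bsub>N\<^esub> r \<odot>\<^bsub>N\<^esub> (x \<oplus>\<^bsub>N\<^esub> w) \<in> D" using IH e by auto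
      then show ?thesis using cong_mem[OF D yc submoduleD(2)[OF D rw]] rw by blast
    qed
  qed
qed

end

text \<open>
  An irredundant family of maximal submodules whose intersection is the radical of \<open>N\<close>: it decomposes the largest
  semisimple quotient of \<open>N\<close> as the direct sum of the simple modules \<open>N/B\<close>.
\<close>

definition top_family :: "('e, 'c) ring_scheme \<Rightarrow> ('e, 'n, 'd) module_scheme \<Rightarrow> 'n set set \<Rightarrow> bool"
  where "top_family E N \<B> \<longleftrightarrow> finite \<B> \<and> (\<forall>B\<in>\<B>. maximal_submodule E N B) \<and>
    (\<forall>B. maximal_submodule E N B \<longrightarrow> carrier N \<inter> \<Inter>\<B> \<subseteq> B) \<and>
    (\<forall>B\<in>\<B>. \<not> carrier N \<inter> \<Inter>(\<B> - {B}) \<subseteq> B)"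

lemma top_familyD:
  assumes "top_family E N \<B>"
  shows "finite \<B>" "B \<in> \<B> \<Longrightarrow> maximal_submodule E N B"
    "maximal_submodule E N B \<Longrightarrow> carrier N \<inter> \<Inter>\<B> \<subseteq> B"
    "B \<in> \<B> \<Longrightarrow> \<not> carrier N \<inter> \<Inter>(\<B> - {B}) \<subseteq> B"
  using assms unfolding top_family_def by simp_all

context fg_module_over_noetherian
begin

lemma submodule_E_imp_R:
  assumes X: "left_module R X" and "submodule H E (Hom X)"
  shows "submodule H R (HomR X)"
proof -
  interpret H: left_module E "Hom X" by (rule left_module_Hom[OF X])
  interpret HR: left_module R "HomR X" by (rule left_module_HomR[OF X])
  show ?thesis using H.submoduleD[OF assms(2)] homothety_closed by (intro HR.submoduleI) auto
qed

lemma ex_maximal_submodule: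
  assumes X: "left_module R X" "finitely_generated_module R X"
    and C: "submodule C E (Hom X)" "C \<noteq> carrier (Hom X)"
  obtains B where "maximal_submodule E (Hom X) B" "C \<subseteq> B"
proof -
  interpret H: left_module E "Hom X" by (rule left_module_Hom[OF X(1)])
  interpret HR: left_module R "HomR X" by (rule left_module_HomR[OF X(1)])
  let ?S = "{H. submodule H E (Hom X) \<and> C \<subseteq> H \<and> H \<noteq> carrier (Hom X)}"
  have ne: "?S \<noteq> {}" using C by blast
  obtain B where B: "B \<in> ?S" "\<And>K. \<lbrakk>K \<in> ?S; B \<subseteq> K\<rbrakk> \<Longrightarrow> K = B"
    by (rule HR.noetherian_maximal[OF fg_subset_HomR[OF X] ne]) (use submodule_E_imp_R[OF X(1)] in auto)
  have "D = B \<or> D = carrier (Hom X)" if D: "submodule D E (Hom X)" "B \<subseteq> D" for D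
    using B(1) B(2)[of D] D by auto
  then have "maximal_submodule E (Hom X) B" using B(1) unfolding maximal_submodule_def by blast
  then show thesis using that B(1) by blast
qed

text \<open>
  Take a maximal \<open>R\<close>-submodule \<open>D\<close> containing \<open>B\<close> and the maximal ideal \<open>I\<close> that kills the quotient by \<open>D\<close>. The largest
  \<open>E\<close>-submodule of \<open>D\<close> is \<open>B\<close> by maximality, and it contains \<open>I N\<close> because \<open>R\<close> acts centrally.
\<close>

lemma maximal_submodule_over_maximalideal:
  assumes X: "left_module R X" "finitely_generated_module R X" and B: "maximal_submodule E (Hom X) B"
  obtains I where "maximalideal I R"
    "\<And>r n. \<lbrakk>r \<in> I; n \<in> carrier (Hom X)\<rbrakk> \<Longrightarrow> homothety M r \<odot>\<^bsub>Hom X\<^esub> n \<in> B"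
proof -
  interpret H: left_module E "Hom X" by (rule left_module_Hom[OF X(1)])
  interpret HR: left_module R "HomR X" by (rule left_module_HomR[OF X(1)])
  note B1 = maximal_submoduleD[OF B]
  let ?S = "{H. submodule H R (HomR X) \<and> B \<subseteq> H \<and> H \<noteq> carrier (HomR X)}"
  have ne: "?S \<noteq> {}" using B1(1,2) submodule_E_imp_R[OF X(1)] by auto
  obtain D where D: "D \<in> ?S" "\<And>K. \<lbrakk>K \<in> ?S; D \<subseteq> K\<rbrakk> \<Longrightarrow> K = D"
    by (rule HR.noetherian_maximal[OF fg_subset_HomR[OF X] ne]) auto
  have D1: "submodule D R (HomR X)" using D(1) by blast
  have "K = D \<or> K = carrier (HomR X)" if K: "submodule K R (HomR X)" "D \<subseteq> K" for K
    using D(1) D(2)[of K] K by auto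
  then have "maximal_submodule R (HomR X) D" using D(1) unfolding maximal_submodule_def by blast
  then obtain I where I: "maximalideal I R"
    "\<And>r n. \<lbrakk>r \<in> I; n \<in> carrier (HomR X)\<rbrakk> \<Longrightarrow> r \<odot>\<^bsub>HomR X\<^esub> n \<in> D"
    by (rule HR.maximal_submodule_maximalideal[OF cring]) iprover
  let ?D = "{n \<in> carrier (Hom X). \<forall>e\<in>carrier E. e \<odot>\<^bsub>Hom X\<^esub> n \<in> D}"
  have D0: "submodule ?D E (Hom X)"
    using HR.submoduleD(3,4)[OF D1]
    by (intro H.submoduleI) (auto simp: H.smult_zero_right H.smult_r_distr H.smult_closed simp flip: H.smult_assoc)
  have BD: "B \<subseteq> ?D" using D(1) H.submoduleD(2,5)[OF B1(1)] by blast
  have "?D \<subseteq> D" using H.smult_one E.one_closed by fastforce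
  then have "?D \<noteq> carrier (Hom X)" using D(1) HR.submoduleD(1)[OF D1] by auto
  then have DB: "?D = B" using B1(3)[OF D0 BD] by iprover
  have "homothety M r \<odot>\<^bsub>Hom X\<^esub> n \<in> B" if r: "r \<in> I" and n: "n \<in> carrier (Hom X)" for r n
  proof -
    interpret I: maximalideal I R by (rule I(1))
    have rR: "r \<in> carrier R" using r by (rule I.a_Hcarr)
    have "e \<odot>\<^bsub>Hom X\<^esub> (homothety M r \<odot>\<^bsub>Hom X\<^esub> n) \<in> D" if e: "e \<in> carrier E" for e
    proof -
      have "e \<odot>\<^bsub>Hom X\<^esub> (homothety M r \<odot>\<^bsub>Hom X\<^esub> n) = homothety M r \<odot>\<^bsub>Hom X\<^esub> (e \<odot>\<^bsub>Hom X\<^esub> n)"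
        using e n homothety_closed[OF rR] homothety_central[OF rR e]
        by (simp flip: H.smult_assoc)
      then show ?thesis using I(2)[OF r, of "e \<odot>\<^bsub>Hom X\<^esub> n"] e n by (simp add: H.smult_closed)
    qed
    then have "homothety M r \<odot>\<^bsub>Hom X\<^esub> n \<in> ?D" using n homothety_closed[OF rR] by (simp add: H.smult_closed)
    then show ?thesis by (simp only: DB)
  qed
  then show thesis using that[of I] I(1) by iprover
qed

text \<open>
  For a fixed maximal ideal \<open>I\<close> of \<open>R\<close>, an intersection of finitely many maximal submodules containing \<open>I N\<close> with the
  least \<open>leading_count\<close> is contained in all of them. There are finitely many \<open>I\<close>, and every maximal submodule
  contains \<open>I N\<close> for one of them; a family of least cardinality with the resulting property is irredundant.
\<close>

lemma ex_top_family:
  assumes semi: "semilocal R" and X: "left_module R X" "finitely_generated_module R X"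
  shows "\<exists>\<B>. top_family E (Hom X) \<B>"
proof -
  interpret H: left_module E "Hom X" by (rule left_module_Hom[OF X(1)])
  interpret HR: left_module R "HomR X" by (rule left_module_HomR[OF X(1)])
  let ?N = "carrier (Hom X)"
  define over where "over I B \<longleftrightarrow> maximal_submodule E (Hom X) B \<and>
    (\<forall>r\<in>I. \<forall>n\<in>?N. homothety M r \<odot>\<^bsub>Hom X\<^esub> n \<in> B)" for I B
  have "fg_subset R (HomR X) (carrier (HomR X))" by (rule fg_subset_HomR[OF X HR.submodule_carrier])
  then have "finitely_generated_module R (HomR X)" by (simp add: HR.finitely_generated_module_iff_fg_subset)
  then obtain xs where xs: "set xs \<subseteq> carrier (HomR X)" "lspan R (HomR X) xs = carrier (HomR X)"
    by (rule HR.finitely_generated_module_lspan) iprover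
  have sub: "submodule (?N \<inter> \<Inter>\<B>) E (Hom X)" if "\<forall>B\<in>\<B>. maximal_submodule E (Hom X) B" for \<B>
    using that maximal_submoduleD(1) by (intro H.submodule_Inter) blast
  have fam: "\<exists>\<B>. finite \<B> \<and> (\<forall>B\<in>\<B>. over I B) \<and> (\<forall>B. over I B \<longrightarrow> ?N \<inter> \<Inter>\<B> \<subseteq> B)"
    if I: "maximalideal I R" for I
  proof -
    let ?F = "\<lambda>\<B>. finite \<B> \<and> (\<forall>B\<in>\<B>. over I B)"
    let ?c = "\<lambda>\<B>. leading_count R (HomR X) (?N \<inter> \<Inter>\<B>) xs"
    have "?F {}" by simp
    from ex_has_least_nat[of ?F, OF this, of ?c] obtain \<B> where \<B>: "?F \<B>" "\<And>\<C>. ?F \<C> \<Longrightarrow> ?c \<B> \<le> ?c \<C>" by blast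
    have "?N \<inter> \<Inter>\<B> \<subseteq> B" if B: "over I B" for B
    proof -
      have F: "?F (insert B \<B>)" using \<B>(1) B by blast
      have s1: "submodule (?N \<inter> \<Inter>\<B>) R (HomR X)" and s2: "submodule (?N \<inter> \<Inter>(insert B \<B>)) R (HomR X)"
        using \<B>(1) F unfolding over_def by (intro submodule_E_imp_R[OF X(1)] sub; blast)+
      have "(?N \<inter> \<Inter>\<B>) \<inter> lspan R (HomR X) xs \<subseteq> ?N \<inter> \<Inter>(insert B \<B>)"
      proof (rule HR.leading_count_eq[OF cring I s2 s1 _ _ xs(1) \<B>(2)[OF F]])
        fix r n assume "r \<in> I" "n \<in> carrier (HomR X)"
        moreover from this have "r \<odot>\<^bsub>HomR X\<^esub> n \<in> carrier (HomR X)"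
          using ideal.Icarr[OF maximalideal.axioms(1)[OF I]] HR.smult_closed by blast
        ultimately show "r \<odot>\<^bsub>HomR X\<^esub> n \<in> ?N \<inter> \<Inter>(insert B \<B>)"
          using F unfolding over_def by auto
      qed auto
      then show ?thesis unfolding xs(2) by auto
    qed
    then show ?thesis using \<B>(1) by blast
  qed
  let ?G = "\<lambda>\<B>. finite \<B> \<and> (\<forall>B\<in>\<B>. maximal_submodule E (Hom X) B) \<and>
    (\<forall>B. maximal_submodule E (Hom X) B \<longrightarrow> ?N \<inter> \<Inter>\<B> \<subseteq> B)"
  have "\<exists>\<B>. ?G \<B>"
  proof -
    have "\<forall>I\<in>{I. maximalideal I R}. \<exists>\<B>. finite \<B> \<and> (\<forall>B\<in>\<B>. over I B) \<and> (\<forall>B. over I B \<longrightarrow> ?N \<inter> \<Inter>\<B> \<subseteq> B)"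
      using fam by simp
    from bchoice[OF this] obtain b where "\<forall>I\<in>{I. maximalideal I R}.
        finite (b I) \<and> (\<forall>B\<in>b I. over I B) \<and> (\<forall>B. over I B \<longrightarrow> ?N \<inter> \<Inter>(b I) \<subseteq> B)" ..
    then have b: "finite (b I) \<and> (\<forall>B\<in>b I. over I B) \<and> (\<forall>B. over I B \<longrightarrow> ?N \<inter> \<Inter>(b I) \<subseteq> B)"
      if "maximalideal I R" for I using that by simp
    let ?U = "\<Union>I\<in>{I. maximalideal I R}. b I"
    have "?N \<inter> \<Inter>?U \<subseteq> B" if B: "maximal_submodule E (Hom X) B" for B
    proof -
      obtain I where I: "maximalideal I R"
        "\<And>r n. \<lbrakk>r \<in> I; n \<in> ?N\<rbrakk> \<Longrightarrow> homothety M r \<odot>\<^bsub>Hom X\<^esub> n \<in> B"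
        by (rule maximal_submodule_over_maximalideal[OF X B]) iprover
      then have "over I B" using B by (simp add: over_def)
      then have "?N \<inter> \<Inter>(b I) \<subseteq> B" using b[OF I(1)] by simp
      moreover have "\<Inter>?U \<subseteq> \<Inter>(b I)" using I(1) by blast
      ultimately show ?thesis by blast
    qed
    moreover have "finite ?U" using semi b unfolding semilocal_def by blast
    moreover have "\<forall>B\<in>?U. maximal_submodule E (Hom X) B" using b unfolding over_def by blast
    ultimately show ?thesis by (intro exI[of _ ?U]) simp
  qed
  then obtain \<B>0 where "?G \<B>0" by (elim exE)
  from ex_has_least_nat[of ?G, OF this, of card] obtain \<B> where
    \<B>: "?G \<B>" "\<And>\<C>. ?G \<C> \<Longrightarrow> card \<B> \<le> card \<C>" by blast
  have "\<not> ?N \<inter> \<Inter>(\<B> - {B}) \<subseteq> B" if B: "B \<in> \<B>" for B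
  proof
    assume *: "?N \<inter> \<Inter>(\<B> - {B}) \<subseteq> B"
    have "x \<in> C" if "x \<in> ?N \<inter> \<Inter>(\<B> - {B})" "C \<in> \<B>" for x C
      using subsetD[OF * that(1)] that by (cases "C = B") auto
    then have le: "?N \<inter> \<Inter>(\<B> - {B}) \<subseteq> ?N \<inter> \<Inter>\<B>" by blast
    have "?G (\<B> - {B})"
    proof (intro conjI allI impI ballI)
      show "finite (\<B> - {B})" using \<B>(1) by simp
      show "maximal_submodule E (Hom X) C" if "C \<in> \<B> - {B}" for C using \<B>(1) that by simp
      show "?N \<inter> \<Inter>(\<B> - {B}) \<subseteq> C" if "maximal_submodule E (Hom X) C" for C
        using \<B>(1) that by (intro order_trans[OF le]) simp
    qed
    then have "card \<B> \<le> card (\<B> - {B})" by (rule \<B>(2))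
    then show False using B \<B>(1) by (metis card_Diff1_less not_le)
  qed
  then show ?thesis using \<B>(1) unfolding top_family_def by (intro exI[of _ \<B>]) simp
qed

end


section \<open>Splitting off direct summands\<close>

context fg_module_over_noetherian
begin

lemma Hom_M_eq_E:
  "e \<odot>\<^bsub>Hom M\<^esub> f = e \<otimes>\<^bsub>E\<^esub> f" "e \<oplus>\<^bsub>Hom M\<^esub> f = e \<oplus>\<^bsub>E\<^esub> f" "carrier (Hom M) = carrier E"
  by (simp_all add: End_ring_def Hom_module_def)

lemma linear_map_smult_const:
  assumes X: "left_module R X" and x: "x \<in> carrier (Hom X)"
  shows "linear_map E (Hom M) (Hom X) (\<lambda>e. e \<odot>\<^bsub>Hom X\<^esub> x)"
proof -
  interpret H: left_module E "Hom X" by (rule left_module_Hom[OF X])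
  show ?thesis using x
    by (intro linear_mapI) (simp_all only: Hom_M_eq_E H.smult_closed H.smult_l_distr H.smult_assoc)
qed

text \<open>
  The annihilator of a nonzero element of the simple module \<open>Hom\<^sub>R(M,X)/B\<close> is a maximal left ideal.
\<close>

lemma maximal_annihilator:
  assumes X: "left_module R X" and B: "maximal_submodule E (Hom X) B"
    and x: "x \<in> carrier (Hom X)" "x \<notin> B"
  shows "maximal_submodule E (Hom M) {e \<in> carrier E. e \<odot>\<^bsub>Hom X\<^esub> x \<in> B}"
proof -
  interpret H: left_module E "Hom X" by (rule left_module_Hom[OF X])
  interpret HM: left_module E "Hom M" by (rule left_module_Hom[OF left_module_M])
  note B1 = maximal_submoduleD[OF B]
  let ?A = "{e \<in> carrier E. e \<odot>\<^bsub>Hom X\<^esub> x \<in> B}"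
  have A: "submodule ?A E (Hom M)"
    using submodule_preimage[OF HM.left_module_axioms H.left_module_axioms linear_map_smult_const[OF X x(1)] B1(1)]
    by (simp add: Hom_M_eq_E)
  have 1: "\<one>\<^bsub>E\<^esub> \<notin> ?A" using x by (simp add: H.smult_one)
  have "C = ?A \<or> C = carrier (Hom M)" if C: "submodule C E (Hom M)" "?A \<subseteq> C" for C
  proof (cases "C \<subseteq> ?A")
    case True then show ?thesis using C(2) by blast
  next
    case False
    then obtain c where c: "c \<in> C" "c \<notin> ?A" by blast
    have cE: "c \<in> carrier E" using HM.submoduleD(2)[OF C(1) c(1)] by (simp add: Hom_M_eq_E)
    have cx: "c \<odot>\<^bsub>Hom X\<^esub> x \<in> carrier (Hom X)" "c \<odot>\<^bsub>Hom X\<^esub> x \<notin> B"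
      using c(2) cE x(1) by (simp_all add: H.smult_closed)
    obtain a where a: "a \<in> carrier E" "x \<ominus>\<^bsub>Hom X\<^esub> a \<odot>\<^bsub>Hom X\<^esub> (c \<odot>\<^bsub>Hom X\<^esub> x) \<in> B"
      by (rule H.maximal_generator[OF B cx x(1)]) iprover
    have ac: "a \<otimes>\<^bsub>E\<^esub> c \<in> C" using HM.submoduleD(5)[OF C(1) a(1) c(1)] by (simp add: Hom_M_eq_E)
    have "(\<one>\<^bsub>E\<^esub> \<ominus>\<^bsub>E\<^esub> a \<otimes>\<^bsub>E\<^esub> c) \<odot>\<^bsub>Hom X\<^esub> x \<in> B"
      using a cE x(1) by (simp add: H.smult_diff_left H.smult_one H.smult_assoc)
    then have "\<one>\<^bsub>E\<^esub> \<ominus>\<^bsub>E\<^esub> a \<otimes>\<^bsub>E\<^esub> c \<in> C" using C(2) a(1) cE by auto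
    from HM.submoduleD(4)[OF C(1) this ac] have "\<one>\<^bsub>E\<^esub> \<in> C"
      using a(1) cE by (simp add: Hom_M_eq_E a_minus_def E.a_assoc E.l_neg)
    then have "e \<in> C" if "e \<in> carrier E" for e
      using HM.submoduleD(5)[OF C(1) that] that by (simp add: Hom_M_eq_E) (metis E.r_one)
    then show ?thesis using HM.submoduleD(1)[OF C(1)] by (auto simp: Hom_M_eq_E)
  qed
  moreover have "?A \<noteq> carrier (Hom M)" using 1 E.one_closed by (auto simp: Hom_M_eq_E)
  ultimately show ?thesis using A unfolding maximal_submodule_def by iprover
qed

text \<open>
  Every simple module is isomorphic to \<open>E/I\<close> for one of the finitely many \<open>I\<close> in \<open>\<L>\<close>; an isomorphism with \<open>E/I\<close> is
  recorded by an element \<open>x\<close> whose annihilator modulo \<open>B\<close> is \<open>I\<close>. The reason is that the annihilator \<open>A\<close> of some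
  element contains the intersection of \<open>\<L>\<close>. In a least subfamily with this property pick \<open>I\<close>, let \<open>D\<close> be the
  intersection of the other members, and write \<open>1 = l + e\<close> with \<open>l\<close> in \<open>I\<close> and \<open>e\<close> in \<open>D\<close>. Multiplying the element
  by \<open>e\<close> changes its annihilator from \<open>A\<close> to \<open>I\<close>.
\<close>

lemma maximal_submodule_type:
  assumes X: "left_module R X" and L: "top_family E (Hom M) \<L>"
    and B: "maximal_submodule E (Hom X) B"
  obtains I x where "I \<in> \<L>" "x \<in> carrier (Hom X)" "x \<notin> B" "{e \<in> carrier E. e \<odot>\<^bsub>Hom X\<^esub> x \<in> B} = I"
proof -
  interpret H: left_module E "Hom X" by (rule left_module_Hom[OF X])
  interpret HM: left_module E "Hom M" by (rule left_module_Hom[OF left_module_M])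
  note B1 = maximal_submoduleD[OF B] and L1 = top_familyD[OF L]
  obtain x where x: "x \<in> carrier (Hom X)" "x \<notin> B" using B1(1,2) H.submoduleD(1)[OF B1(1)] by blast
  let ?A = "{e \<in> carrier E. e \<odot>\<^bsub>Hom X\<^esub> x \<in> B}"
  have A: "maximal_submodule E (Hom M) ?A" by (rule maximal_annihilator[OF X B x])
  note A1 = maximal_submoduleD[OF A]
  let ?P = "\<lambda>\<C>. \<C> \<subseteq> \<L> \<and> carrier E \<inter> \<Inter>\<C> \<subseteq> ?A"
  have "?P \<L>" using L1(3)[OF A] by (simp add: Hom_M_eq_E)
  from ex_has_least_nat[of ?P, OF this, of card] obtain \<C> where
    \<C>: "?P \<C>" "\<And>\<D>. ?P \<D> \<Longrightarrow> card \<C> \<le> card \<D>" by blast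
  have "\<C> \<noteq> {}"
  proof
    assume "\<C> = {}"
    then have "carrier E \<subseteq> ?A" using \<C>(1) by simp
    then show False using x(2) H.smult_one[OF x(1)] E.one_closed by auto
  qed
  then obtain I where I: "I \<in> \<C>" by blast
  have IL: "I \<in> \<L>" using I \<C>(1) by blast
  note I1 = maximal_submoduleD[OF L1(2)[OF IL]]
  let ?D = "carrier E \<inter> \<Inter>(\<C> - {I})"
  have D: "submodule ?D E (Hom M)"
    using HM.submodule_Inter[of "\<C> - {I}"] maximal_submoduleD(1)[OF L1(2)] \<C>(1) by (auto simp: Hom_M_eq_E)
  have nDA: "\<not> ?D \<subseteq> ?A"
  proof
    assume "?D \<subseteq> ?A"
    then have "?P (\<C> - {I})" using \<C>(1) by blast
    from \<C>(2)[OF this] show False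
      using card_Diff1_less[OF finite_subset[OF conjunct1[OF \<C>(1)] L1(1)] I] by simp
  qed
  have DIA: "d \<in> ?A" if "d \<in> ?D" "d \<in> I" for d using that \<C>(1) by blast
  have nDI: "\<not> ?D \<subseteq> I" using nDA DIA by blast
  have "\<one>\<^bsub>E\<^esub> \<in> carrier (Hom M)" by (simp add: Hom_M_eq_E)
  then obtain l e where le: "l \<in> I" "e \<in> ?D" "\<one>\<^bsub>E\<^esub> = l \<oplus>\<^bsub>E\<^esub> e"
    by (rule HM.maximal_sum[OF L1(2)[OF IL] D nDI]) (simp only: Hom_M_eq_E)
  have eE: "e \<in> carrier E" using le(2) by blast
  have lE: "l \<in> carrier E" using HM.submoduleD(2)[OF I1(1) le(1)] by (simp add: Hom_M_eq_E)
  have split: "a = a \<otimes>\<^bsub>E\<^esub> l \<oplus>\<^bsub>E\<^esub> a \<otimes>\<^bsub>E\<^esub> e" if a: "a \<in> carrier E" for a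
  proof -
    have "a = a \<otimes>\<^bsub>E\<^esub> (l \<oplus>\<^bsub>E\<^esub> e)" unfolding le(3)[symmetric] using a by simp
    then show ?thesis using a lE eE by (simp add: E.r_distr)
  qed
  have lI: "a \<otimes>\<^bsub>E\<^esub> l \<in> I" if "a \<in> carrier E" for a
    using HM.submoduleD(5)[OF I1(1) that le(1)] by (simp add: Hom_M_eq_E)
  have eD: "a \<otimes>\<^bsub>E\<^esub> e \<in> ?D" if "a \<in> carrier E" for a
    using HM.submoduleD(5)[OF D that le(2)] by (simp only: Hom_M_eq_E)
  \<comment> \<open>Otherwise \<open>d = d e + d l\<close> would lie in \<open>A\<close> for all \<open>d\<close> in \<open>D\<close>.\<close>
  have enA: "e \<notin> ?A"
  proof
    assume eA: "e \<in> ?A"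
    have "d \<in> ?A" if d: "d \<in> ?D" for d
    proof -
      have dE: "d \<in> carrier E" using d by blast
      have dl: "d \<otimes>\<^bsub>E\<^esub> l \<in> carrier E" "d \<otimes>\<^bsub>E\<^esub> e \<in> carrier E" using dE lE eE by simp_all
      have deA: "d \<otimes>\<^bsub>E\<^esub> e \<in> ?A"
        using HM.submoduleD(5)[OF A1(1) dE eA] by (simp only: Hom_M_eq_E)
      have "d = d \<otimes>\<^bsub>E\<^esub> e \<oplus>\<^bsub>Hom M\<^esub> d \<otimes>\<^bsub>E\<^esub> l"
        using split[OF dE] dl by (simp add: Hom_M_eq_E E.a_comm)
      then have "d \<ominus>\<^bsub>Hom M\<^esub> d \<otimes>\<^bsub>E\<^esub> e = d \<otimes>\<^bsub>E\<^esub> l"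
        using HM.add_diff_left[of "d \<otimes>\<^bsub>E\<^esub> e" "d \<otimes>\<^bsub>E\<^esub> l"] dl by (simp only: Hom_M_eq_E(3))
      then have "d \<otimes>\<^bsub>E\<^esub> l \<in> ?D" using HM.submoduleD(7)[OF D d eD[OF dE]] by (simp only:)
      then have "d \<otimes>\<^bsub>E\<^esub> l \<in> ?A" by (rule DIA[OF _ lI[OF dE]])
      from HM.submoduleD(4)[OF A1(1) this deA] show ?thesis
        by (simp only: Hom_M_eq_E split[OF dE, symmetric])
    qed
    then show False using nDA by blast
  qed
  let ?y = "e \<odot>\<^bsub>Hom X\<^esub> x"
  have y: "?y \<in> carrier (Hom X)" "?y \<notin> B" using enA eE x(1) by (simp_all add: H.smult_closed)
  let ?A' = "{a \<in> carrier E. a \<odot>\<^bsub>Hom X\<^esub> ?y \<in> B}"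
  have A': "maximal_submodule E (Hom M) ?A'" by (rule maximal_annihilator[OF X B y])
  have "I \<subseteq> ?A'"
  proof
    fix a assume a: "a \<in> I"
    have aE: "a \<in> carrier E" using HM.submoduleD(2)[OF I1(1) a] by (simp add: Hom_M_eq_E)
    have c: "a \<otimes>\<^bsub>E\<^esub> l \<in> carrier (Hom M)" "a \<otimes>\<^bsub>E\<^esub> e \<in> carrier (Hom M)" using aE lE eE by (simp_all add: Hom_M_eq_E)
    have aI: "a \<ominus>\<^bsub>Hom M\<^esub> a \<otimes>\<^bsub>E\<^esub> l \<in> I" by (rule HM.submoduleD(7)[OF I1(1) a lI[OF aE]])
    have "a \<ominus>\<^bsub>Hom M\<^esub> a \<otimes>\<^bsub>E\<^esub> l = a \<otimes>\<^bsub>E\<^esub> e"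
    proof -
      have "a = a \<otimes>\<^bsub>E\<^esub> l \<oplus>\<^bsub>Hom M\<^esub> a \<otimes>\<^bsub>E\<^esub> e" using split[OF aE] by (simp only: Hom_M_eq_E(2))
      then show ?thesis using HM.add_diff_left[OF c] by (simp only:)
    qed
    then have "a \<otimes>\<^bsub>E\<^esub> e \<in> I" using aI by (simp only:)
    then have "a \<otimes>\<^bsub>E\<^esub> e \<in> ?A" by (rule DIA[OF eD[OF aE]])
    then show "a \<in> ?A'" using aE eE x(1) by (simp add: H.smult_assoc)
  qed
  then have "?A' = I" using I1(3)[OF maximal_submoduleD(1)[OF A']] maximal_submoduleD(2)[OF A'] by blast
  then show thesis using that[OF IL y] by blast
qed

text \<open>
  The equality of annihilators identifies the simple module \<open>Hom\<^sub>R(M,X)/B\<close> with \<open>Hom\<^sub>R(M,Y)/\<iota> B\<close>, so that the semisimple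
  quotient of \<open>Hom\<^sub>R(M,Y)\<close> given by \<open>\<C>\<close> maps onto that of \<open>Hom\<^sub>R(M,X)\<close>. A map \<open>F : Y \<rightarrow> X\<close> lifting this one is
  constructed along a presentation of the identity of \<open>Y\<close>: the witness \<open>a\<close> says that \<open>h\<close> and \<open>F h\<close> correspond
  to the same multiple of the chosen generators. The image of \<open>F\<close> on \<open>Hom\<^sub>R(M,_)\<close> meets every class modulo the
  radical, so no maximal submodule contains it.
\<close>

lemma surjection_if_types_match:
  assumes X: "left_module R X" "finitely_generated_module R X"
    and Y: "left_module R Y" "in_add R M Y"
    and \<B>: "top_family E (Hom X) \<B>" and \<C>: "top_family E (Hom Y) \<C>"
    and \<iota>: "inj_on \<iota> \<B>" "\<And>B. B \<in> \<B> \<Longrightarrow> \<iota> B \<in> \<C>"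
    and x: "\<And>B. B \<in> \<B> \<Longrightarrow> x B \<in> carrier (Hom X)" "\<And>B. B \<in> \<B> \<Longrightarrow> x B \<notin> B"
    and y: "\<And>B. B \<in> \<B> \<Longrightarrow> y B \<in> carrier (Hom Y)" "\<And>B. B \<in> \<B> \<Longrightarrow> y B \<notin> \<iota> B"
    and xy: "\<And>B e. \<lbrakk>B \<in> \<B>; e \<in> carrier E\<rbrakk> \<Longrightarrow> e \<odot>\<^bsub>Hom X\<^esub> x B \<in> B \<longleftrightarrow> e \<odot>\<^bsub>Hom Y\<^esub> y B \<in> \<iota> B"
  obtains F where "linear_map R Y X F" "Hom_map M F ` carrier (Hom Y) = carrier (Hom X)"
proof -
  interpret HX: left_module E "Hom X" by (rule left_module_Hom[OF X(1)])
  interpret HY: left_module E "Hom Y" by (rule left_module_Hom[OF Y(1)])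
  note B1 = top_familyD[OF \<B>] and C1 = top_familyD[OF \<C>]
  have sB: "submodule B E (Hom X)" if "B \<in> \<B>" for B by (rule maximal_submoduleD(1)[OF B1(2)[OF that]])
  have sC: "submodule (\<iota> B) E (Hom Y)" if "B \<in> \<B>" for B
    by (rule maximal_submoduleD(1)[OF C1(2)[OF \<iota>(2)[OF that]]])
  have "\<exists>F. linear_map R Y X F \<and> (\<forall>h\<in>carrier (Hom Y). \<forall>B\<in>\<B>. \<exists>a\<in>carrier E.
      Hom_map M t h \<ominus>\<^bsub>Hom Y\<^esub> a \<odot>\<^bsub>Hom Y\<^esub> y B \<in> \<iota> B \<and> Hom_map M F h \<ominus>\<^bsub>Hom X\<^esub> a \<odot>\<^bsub>Hom X\<^esub> x B \<in> B)"
    if "factors_through R M Y t" for t using that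
  proof induction
    case (zero t)
    have t0: "Hom_map M t h = \<zero>\<^bsub>Hom Y\<^esub>" if "h \<in> carrier (Hom Y)" for h
      by (rule Hom_map_zero_map[OF zero that])
    have f0: "Hom_map M (\<lambda>w. \<zero>\<^bsub>X\<^esub>) h = \<zero>\<^bsub>Hom X\<^esub>" if "h \<in> carrier (Hom Y)" for h
      by (simp add: Hom_map_def Hom_module_def)
    show ?case
    proof (intro exI[of _ "\<lambda>w. \<zero>\<^bsub>X\<^esub>"] conjI ballI)
      fix h B assume h: "h \<in> carrier (Hom Y)" and B: "B \<in> \<B>"
      show "\<exists>a\<in>carrier E. Hom_map M t h \<ominus>\<^bsub>Hom Y\<^esub> a \<odot>\<^bsub>Hom Y\<^esub> y B \<in> \<iota> B \<and>
          Hom_map M (\<lambda>w. \<zero>\<^bsub>X\<^esub>) h \<ominus>\<^bsub>Hom X\<^esub> a \<odot>\<^bsub>Hom X\<^esub> x B \<in> B"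
        unfolding t0[OF h] f0[OF h] using x(1)[OF B] y(1)[OF B] HX.cong_refl[OF sB[OF B] HX.N.zero_closed]
            HY.cong_refl[OF sC[OF B] HY.N.zero_closed]
        by (intro bexI[of _ "\<zero>\<^bsub>E\<^esub>"]) (simp_all add: HX.smult_zero_left HY.smult_zero_left)
    qed (rule linear_map_zero_map[OF X(1)])
  next
    case (step t u v t')
    then obtain F where F: "linear_map R Y X F" "\<forall>h\<in>carrier (Hom Y). \<forall>B\<in>\<B>. \<exists>a\<in>carrier E.
      Hom_map M t h \<ominus>\<^bsub>Hom Y\<^esub> a \<odot>\<^bsub>Hom Y\<^esub> y B \<in> \<iota> B \<and> Hom_map M F h \<ominus>\<^bsub>Hom X\<^esub> a \<odot>\<^bsub>Hom X\<^esub> x B \<in> B" by blast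
    let ?u = "restrict u (carrier M)"
    have u: "?u \<in> carrier (Hom Y)" by (rule restrict_Hom[OF step(2)])
    have "\<exists>c\<in>carrier E. ?u \<ominus>\<^bsub>Hom Y\<^esub> c \<odot>\<^bsub>Hom Y\<^esub> y B \<in> \<iota> B" if B: "B \<in> \<B>" for B
      by (rule HY.maximal_generator[OF C1(2)[OF \<iota>(2)[OF B]] y(1)[OF B] y(2)[OF B] u]) blast
    then have "\<forall>B\<in>\<B>. \<exists>c. c \<in> carrier E \<and> ?u \<ominus>\<^bsub>Hom Y\<^esub> c \<odot>\<^bsub>Hom Y\<^esub> y B \<in> \<iota> B" by blast
    from bchoice[OF this] obtain c where
      c: "\<forall>B\<in>\<B>. c B \<in> carrier E \<and> ?u \<ominus>\<^bsub>Hom Y\<^esub> c B \<odot>\<^bsub>Hom Y\<^esub> y B \<in> \<iota> B" ..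
    obtain z where z: "z \<in> carrier (Hom X)" "\<And>B. B \<in> \<B> \<Longrightarrow> z \<ominus>\<^bsub>Hom X\<^esub> c B \<odot>\<^bsub>Hom X\<^esub> x B \<in> B"
      by (rule HX.chinese_remainder[OF B1(1,2,4), of "\<lambda>B. c B \<odot>\<^bsub>Hom X\<^esub> x B"])
        (use c x in \<open>auto simp: HX.smult_closed\<close>)
    let ?F = "\<lambda>w. z (v w) \<oplus>\<^bsub>X\<^esub> F w"
    have F': "linear_map R Y X ?F"
      by (rule linear_map_add[OF X(1) linear_map_comp[OF step(3) Hom_linear[OF z(1)]] F(1)])
    have "\<exists>a\<in>carrier E. Hom_map M t' h \<ominus>\<^bsub>Hom Y\<^esub> a \<odot>\<^bsub>Hom Y\<^esub> y B \<in> \<iota> B \<and>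
        Hom_map M ?F h \<ominus>\<^bsub>Hom X\<^esub> a \<odot>\<^bsub>Hom X\<^esub> x B \<in> B" if h: "h \<in> carrier (Hom Y)" and B: "B \<in> \<B>" for h B
    proof -
      obtain a where a: "a \<in> carrier E" "Hom_map M t h \<ominus>\<^bsub>Hom Y\<^esub> a \<odot>\<^bsub>Hom Y\<^esub> y B \<in> \<iota> B"
        "Hom_map M F h \<ominus>\<^bsub>Hom X\<^esub> a \<odot>\<^bsub>Hom X\<^esub> x B \<in> B" using F(2) h B by blast
      have cB: "c B \<in> carrier E" "?u \<ominus>\<^bsub>Hom Y\<^esub> c B \<odot>\<^bsub>Hom Y\<^esub> y B \<in> \<iota> B" using c B by simp_all
      let ?e = "Hom_map M v h"
      have t': "\<forall>y\<in>carrier Y. t' y = u (v y) \<oplus>\<^bsub>Y\<^esub> t y" using step(4) by blast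
      note stp = Hom_map_factors_step[OF Y(1) step(1-3) t' h]
      note e = stp(1) and th = stp(2) and t'e = stp(4)
      have Fh: "Hom_map M F h \<in> carrier (Hom X)" by (rule Hom_map_closed[OF F(1) h])
      have F'e: "Hom_map M ?F h = ?e \<odot>\<^bsub>Hom X\<^esub> z \<oplus>\<^bsub>Hom X\<^esub> Hom_map M F h"
        by (rule Hom_ext[of _ X _ X]) (simp_all add: HX.smult_closed e z(1) Fh Hom_map_closed[OF F' h])
      have dY: "(?e \<otimes>\<^bsub>E\<^esub> c B \<oplus>\<^bsub>E\<^esub> a) \<odot>\<^bsub>Hom Y\<^esub> y B = ?e \<odot>\<^bsub>Hom Y\<^esub> (c B \<odot>\<^bsub>Hom Y\<^esub> y B) \<oplus>\<^bsub>Hom Y\<^esub> a \<odot>\<^bsub>Hom Y\<^esub> y B"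
        using e cB(1) a(1) y(1)[OF B] by (simp only: HY.smult_l_distr HY.smult_assoc E.m_closed)
      have dX: "(?e \<otimes>\<^bsub>E\<^esub> c B \<oplus>\<^bsub>E\<^esub> a) \<odot>\<^bsub>Hom X\<^esub> x B = ?e \<odot>\<^bsub>Hom X\<^esub> (c B \<odot>\<^bsub>Hom X\<^esub> x B) \<oplus>\<^bsub>Hom X\<^esub> a \<odot>\<^bsub>Hom X\<^esub> x B"
        using e cB(1) a(1) x(1)[OF B] by (simp only: HX.smult_l_distr HX.smult_assoc E.m_closed)
      have cy: "c B \<odot>\<^bsub>Hom Y\<^esub> y B \<in> carrier (Hom Y)" "a \<odot>\<^bsub>Hom Y\<^esub> y B \<in> carrier (Hom Y)"
        "c B \<odot>\<^bsub>Hom X\<^esub> x B \<in> carrier (Hom X)" "a \<odot>\<^bsub>Hom X\<^esub> x B \<in> carrier (Hom X)"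
        using cB(1) a(1) x(1)[OF B] y(1)[OF B] by (simp_all only: HX.smult_closed HY.smult_closed)
      have "Hom_map M t' h \<ominus>\<^bsub>Hom Y\<^esub> (?e \<otimes>\<^bsub>E\<^esub> c B \<oplus>\<^bsub>E\<^esub> a) \<odot>\<^bsub>Hom Y\<^esub> y B \<in> \<iota> B"
        unfolding t'e dY
        by (rule HY.cong_add[OF sC[OF B] HY.smult_closed[OF e u] HY.smult_closed[OF e cy(1)] th cy(2)
              HY.cong_smult[OF sC[OF B] u cy(1) e cB(2)] a(2)])
      moreover have "Hom_map M ?F h \<ominus>\<^bsub>Hom X\<^esub> (?e \<otimes>\<^bsub>E\<^esub> c B \<oplus>\<^bsub>E\<^esub> a) \<odot>\<^bsub>Hom X\<^esub> x B \<in> B"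
        unfolding F'e dX
        by (rule HX.cong_add[OF sB[OF B] HX.smult_closed[OF e z(1)] HX.smult_closed[OF e cy(3)] Fh cy(4)
              HX.cong_smult[OF sB[OF B] z(1) cy(3) e z(2)[OF B]] a(3)])
      ultimately show ?thesis using e cB(1) a(1) by (intro bexI[of _ "?e \<otimes>\<^bsub>E\<^esub> c B \<oplus>\<^bsub>E\<^esub> a"]) simp_all
    qed
    then show ?case using F' by blast
  qed
  from this[OF Y(2)[unfolded in_add_def]] obtain F where F: "linear_map R Y X F"
    "\<forall>h\<in>carrier (Hom Y). \<forall>B\<in>\<B>. \<exists>a\<in>carrier E.
      Hom_map M (\<lambda>y. y) h \<ominus>\<^bsub>Hom Y\<^esub> a \<odot>\<^bsub>Hom Y\<^esub> y B \<in> \<iota> B \<and> Hom_map M F h \<ominus>\<^bsub>Hom X\<^esub> a \<odot>\<^bsub>Hom X\<^esub> x B \<in> B"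
    by (elim exE conjE)
  have Fh: "\<exists>a\<in>carrier E. h \<ominus>\<^bsub>Hom Y\<^esub> a \<odot>\<^bsub>Hom Y\<^esub> y B \<in> \<iota> B \<and> Hom_map M F h \<ominus>\<^bsub>Hom X\<^esub> a \<odot>\<^bsub>Hom X\<^esub> x B \<in> B"
    if h: "h \<in> carrier (Hom Y)" and B: "B \<in> \<B>" for h B
    using F(2)[rule_format, OF h B] by (simp only: Hom_map_id[OF h])
  let ?I = "Hom_map M F ` carrier (Hom Y)"
  have I: "submodule ?I E (Hom X)"
    by (rule submodule_image[OF HY.left_module_axioms HX.left_module_axioms
          linear_map_Hom_map[OF Y(1) X(1) F(1)] HY.submodule_carrier])
  have hit: "\<exists>p\<in>carrier (Hom Y). \<forall>B\<in>\<B>. q \<ominus>\<^bsub>Hom X\<^esub> Hom_map M F p \<in> B" if q: "q \<in> carrier (Hom X)" for q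
  proof -
    have "\<exists>a\<in>carrier E. q \<ominus>\<^bsub>Hom X\<^esub> a \<odot>\<^bsub>Hom X\<^esub> x B \<in> B" if B: "B \<in> \<B>" for B
      by (rule HX.maximal_generator[OF B1(2)[OF B] x(1)[OF B] x(2)[OF B] q]) blast
    then have "\<forall>B\<in>\<B>. \<exists>a. a \<in> carrier E \<and> q \<ominus>\<^bsub>Hom X\<^esub> a \<odot>\<^bsub>Hom X\<^esub> x B \<in> B" by blast
    from bchoice[OF this] obtain a where a: "\<forall>B\<in>\<B>. a B \<in> carrier E \<and> q \<ominus>\<^bsub>Hom X\<^esub> a B \<odot>\<^bsub>Hom X\<^esub> x B \<in> B" ..
    \<comment> \<open>The members of \<open>\<C>\<close> outside the image of \<open>\<iota>\<close> are given the arbitrary residue \<open>0\<close>.\<close>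
    let ?r = "\<lambda>C. if C \<in> \<iota> ` \<B> then a (inv_into \<B> \<iota> C) \<odot>\<^bsub>Hom Y\<^esub> y (inv_into \<B> \<iota> C) else \<zero>\<^bsub>Hom Y\<^esub>"
    have r: "?r C \<in> carrier (Hom Y)" for C
      using a y(1) inv_into_into[of C \<iota> \<B>] by (simp add: HY.smult_closed)
    obtain p where p: "p \<in> carrier (Hom Y)" "\<And>C. C \<in> \<C> \<Longrightarrow> p \<ominus>\<^bsub>Hom Y\<^esub> ?r C \<in> C"
      by (rule HY.chinese_remainder[OF C1(1,2,4) r]) iprover+
    have "q \<ominus>\<^bsub>Hom X\<^esub> Hom_map M F p \<in> B" if B: "B \<in> \<B>" for B
    proof -
      have aB: "a B \<in> carrier E" "q \<ominus>\<^bsub>Hom X\<^esub> a B \<odot>\<^bsub>Hom X\<^esub> x B \<in> B" using a B by simp_all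
      have pB: "p \<ominus>\<^bsub>Hom Y\<^esub> a B \<odot>\<^bsub>Hom Y\<^esub> y B \<in> \<iota> B" using p(2)[OF \<iota>(2)[OF B]] \<iota>(1) B by simp
      obtain b where b: "b \<in> carrier E" "p \<ominus>\<^bsub>Hom Y\<^esub> b \<odot>\<^bsub>Hom Y\<^esub> y B \<in> \<iota> B"
        "Hom_map M F p \<ominus>\<^bsub>Hom X\<^esub> b \<odot>\<^bsub>Hom X\<^esub> x B \<in> B" using Fh[OF p(1) B] by blast
      have cy: "a B \<odot>\<^bsub>Hom Y\<^esub> y B \<in> carrier (Hom Y)" "b \<odot>\<^bsub>Hom Y\<^esub> y B \<in> carrier (Hom Y)"
        "a B \<odot>\<^bsub>Hom X\<^esub> x B \<in> carrier (Hom X)" "b \<odot>\<^bsub>Hom X\<^esub> x B \<in> carrier (Hom X)"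
        using aB(1) b(1) x(1)[OF B] y(1)[OF B] by (simp_all only: HX.smult_closed HY.smult_closed)
      have Fp: "Hom_map M F p \<in> carrier (Hom X)" by (rule Hom_map_closed[OF F(1) p(1)])
      have "a B \<odot>\<^bsub>Hom Y\<^esub> y B \<ominus>\<^bsub>Hom Y\<^esub> b \<odot>\<^bsub>Hom Y\<^esub> y B \<in> \<iota> B"
        by (rule HY.cong_trans[OF sC[OF B] cy(1) p(1) cy(2) HY.cong_sym[OF sC[OF B] p(1) cy(1) pB] b(2)])
      then have "(a B \<ominus>\<^bsub>E\<^esub> b) \<odot>\<^bsub>Hom Y\<^esub> y B \<in> \<iota> B"
        using aB(1) b(1) y(1)[OF B] by (simp add: HY.smult_diff_left)
      then have "(a B \<ominus>\<^bsub>E\<^esub> b) \<odot>\<^bsub>Hom X\<^esub> x B \<in> B" using xy[OF B] aB(1) b(1) by simp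
      then have "a B \<odot>\<^bsub>Hom X\<^esub> x B \<ominus>\<^bsub>Hom X\<^esub> b \<odot>\<^bsub>Hom X\<^esub> x B \<in> B"
        using aB(1) b(1) x(1)[OF B] by (simp add: HX.smult_diff_left)
      from HX.cong_trans[OF sB[OF B] q cy(3,4) aB(2) this]
      have "q \<ominus>\<^bsub>Hom X\<^esub> b \<odot>\<^bsub>Hom X\<^esub> x B \<in> B" .
      from HX.cong_trans[OF sB[OF B] q cy(4) Fp this HX.cong_sym[OF sB[OF B] Fp cy(4) b(3)]] show ?thesis .
    qed
    then show ?thesis using p(1) by blast
  qed
  have "?I = carrier (Hom X)"
  proof (rule ccontr)
    assume "?I \<noteq> carrier (Hom X)"
    then obtain D where D: "maximal_submodule E (Hom X) D" "?I \<subseteq> D"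
      by (rule ex_maximal_submodule[OF X I]) iprover
    note D1 = maximal_submoduleD[OF D(1)]
    have "q \<in> D" if q: "q \<in> carrier (Hom X)" for q
    proof -
      obtain p where p: "p \<in> carrier (Hom Y)" "\<forall>B\<in>\<B>. q \<ominus>\<^bsub>Hom X\<^esub> Hom_map M F p \<in> B" using hit[OF q] by blast
      have Fp: "Hom_map M F p \<in> carrier (Hom X)" by (rule Hom_map_closed[OF F(1) p(1)])
      have "q \<ominus>\<^bsub>Hom X\<^esub> Hom_map M F p \<in> carrier (Hom X) \<inter> \<Inter>\<B>" using p(2) q Fp by simp
      then have "q \<ominus>\<^bsub>Hom X\<^esub> Hom_map M F p \<in> D" using B1(3)[OF D(1)] by blast
      moreover have "Hom_map M F p \<in> D" using D(2) p(1) by blast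
      ultimately show ?thesis using HX.cong_mem[OF D1(1) q Fp] by blast
    qed
    then have "carrier (Hom X) \<subseteq> D" by blast
    then show False using D1(2) HX.submoduleD(1)[OF D1(1)] by blast
  qed
  then show thesis using that[OF F(1)] by iprover
qed

text \<open>
  In a presentation of the identity of \<open>V\<close> as a sum of composites \<open>V \<rightarrow> M \<rightarrow> V\<close>, the maps \<open>M \<rightarrow> V\<close> lift along \<open>F\<close>.
\<close>

lemma section_if_Hom_surjective:
  assumes Y: "left_module R Y" and V: "left_module R V" "in_add R M V" and F: "linear_map R Y V F"
    and surj: "Hom_map M F ` carrier (Hom Y) = carrier (Hom V)"
  obtains g where "linear_map R V Y g" "\<And>v. v \<in> carrier V \<Longrightarrow> F (g v) = v"
proof -
  have "\<exists>g. linear_map R V Y g \<and> (\<forall>v\<in>carrier V. F (g v) = t v)" if "factors_through R M V t" for t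
    using that
  proof induction
    case (zero t)
    then show ?case
      using linear_map_zero_map[OF Y] linear_map_zero[OF Y V(1) F] by (intro exI[of _ "\<lambda>v. \<zero>\<^bsub>Y\<^esub>"]) simp
  next
    case (step t u w t')
    then obtain g where g: "linear_map R V Y g" "\<And>v. v \<in> carrier V \<Longrightarrow> F (g v) = t v" by blast
    have "restrict u (carrier M) \<in> Hom_map M F ` carrier (Hom Y)"
      unfolding surj by (rule restrict_Hom[OF step(2)])
    then obtain k where k: "k \<in> carrier (Hom Y)" "restrict u (carrier M) = Hom_map M F k" by blast
    have Fk: "F (k m) = u m" if m: "m \<in> carrier M" for m
    proof -
      have "u m = restrict u (carrier M) m" using m by simp
      also have "\<dots> = F (k m)" unfolding k(2) using m by simp
      finally show ?thesis by simp
    qed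
    have "linear_map R V Y (\<lambda>v. k (w v) \<oplus>\<^bsub>Y\<^esub> g v)"
      by (rule linear_map_add[OF Y linear_map_comp[OF step(3) Hom_linear[OF k(1)]] g(1)])
    moreover have "F (k (w v) \<oplus>\<^bsub>Y\<^esub> g v) = t' v" if v: "v \<in> carrier V" for v
      using linear_mapD(1)[OF step(3) v] Hom_closed[OF k(1)] linear_mapD(1)[OF g(1) v] step(4)[OF v]
      by (simp add: linear_mapD(2)[OF F] Fk g(2)[OF v])
    ultimately show ?case by blast
  qed
  from this[OF V(2)[unfolded in_add_def]] show thesis using that by blast
qed

text \<open>
  To \<open>W\<close> belongs the vector \<open>t W\<close> of multiplicities of the simple modules in the largest semisimple quotient of
  \<open>Hom\<^sub>R(M,W)\<close>. Dickson's lemma provides finitely many \<open>V\<close> such that every vector is bounded below by some \<open>t V\<close>, and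
  then the simple summands for \<open>V\<close> embed into those for \<open>W\<close> preserving types.
\<close>

lemma finite_splitting_family:
  assumes semi: "semilocal R"
  defines "T \<equiv> {W \<in> fg_modules R. in_add R M W \<and> carrier W \<noteq> {\<zero>\<^bsub>W\<^esub>}}"
  obtains F where "finite F" "F \<subseteq> T"
    "\<And>W. W \<in> T \<Longrightarrow> \<exists>V\<in>F. \<exists>f. linear_map R W V f \<and> Hom_map M f ` carrier (Hom W) = carrier (Hom V)"
proof -
  obtain \<L> where L: "top_family E (Hom M) \<L>" using ex_top_family[OF semi left_module_M fg_M] by blast
  have T: "left_module R W" "finitely_generated_module R W" "in_add R M W" if "W \<in> T" for W
    using that by (simp_all add: T_def fg_modules_iff[OF cring])
  have "\<forall>W\<in>T. \<exists>\<B>. top_family E (Hom W) \<B>" using ex_top_family[OF semi] T(1,2) by blast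
  from bchoice[OF this] obtain b where b: "\<forall>W\<in>T. top_family E (Hom W) (b W)" ..
  define P where "P W B I \<longleftrightarrow> I \<in> \<L> \<and> (\<exists>x. x \<in> carrier (Hom W) \<and> x \<notin> B \<and>
      {e \<in> carrier E. e \<odot>\<^bsub>Hom W\<^esub> x \<in> B} = I)" for W :: "('a, 'a module_univ) module" and B I
  define \<tau> where "\<tau> W B = (SOME I. P W B I)" for W B
  have \<tau>: "P W B (\<tau> W B)" if W: "W \<in> T" and B: "B \<in> b W" for W B
  proof -
    have "maximal_submodule E (Hom W) B" using top_familyD(2) b W B by blast
    then have "\<exists>I. P W B I"
      by (rule maximal_submodule_type[OF T(1)[OF W] L]) (unfold P_def, blast)
    then show ?thesis unfolding \<tau>_def by (rule someI_ex)
  qed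
  define t where "t W I = card {B \<in> b W. \<tau> W B = I}" for W I
  obtain F where F: "finite F" "F \<subseteq> T" "\<And>W. W \<in> T \<Longrightarrow> \<exists>V\<in>F. \<forall>I\<in>\<L>. t V I \<le> t W I"
    by (rule Dickson[OF top_familyD(1)[OF L]]) iprover
  have key: "\<exists>f. linear_map R W V f \<and> Hom_map M f ` carrier (Hom W) = carrier (Hom V)"
    if V: "V \<in> T" and W: "W \<in> T" and le: "\<forall>I\<in>\<L>. t V I \<le> t W I" for V W
  proof -
    have bV: "top_family E (Hom V) (b V)" and bW: "top_family E (Hom W) (b W)" using b V W by simp_all
    have "\<forall>I\<in>\<L>. \<exists>f. f ` {B \<in> b V. \<tau> V B = I} \<subseteq> {B \<in> b W. \<tau> W B = I} \<and> inj_on f {B \<in> b V. \<tau> V B = I}"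
    proof
      fix I assume "I \<in> \<L>"
      then show "\<exists>f. f ` {B \<in> b V. \<tau> V B = I} \<subseteq> {B \<in> b W. \<tau> W B = I} \<and> inj_on f {B \<in> b V. \<tau> V B = I}"
        using le top_familyD(1)[OF bV] top_familyD(1)[OF bW] by (intro card_le_inj) (auto simp: t_def)
    qed
    from bchoice[OF this] obtain f where
      f: "\<forall>I\<in>\<L>. f I ` {B \<in> b V. \<tau> V B = I} \<subseteq> {B \<in> b W. \<tau> W B = I} \<and> inj_on (f I) {B \<in> b V. \<tau> V B = I}" ..
    define \<iota> where "\<iota> B = f (\<tau> V B) B" for B
    have \<tau>L: "\<tau> V B \<in> \<L>" if "B \<in> b V" for B using \<tau>[OF V that] by (simp add: P_def)
    have \<iota>: "\<iota> B \<in> b W" "\<tau> W (\<iota> B) = \<tau> V B" if B: "B \<in> b V" for B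
      using f[rule_format, OF \<tau>L[OF B]] B unfolding \<iota>_def by blast+
    have inj: "inj_on \<iota> (b V)"
    proof (rule inj_onI)
      fix B C assume BC: "B \<in> b V" "C \<in> b V" "\<iota> B = \<iota> C"
      then have "\<tau> V B = \<tau> V C" using \<iota>(2) by metis
      then show "B = C" using BC f[rule_format, OF \<tau>L[OF BC(1)]] unfolding \<iota>_def inj_on_def by auto
    qed
    have "\<exists>x y. x \<in> carrier (Hom V) \<and> x \<notin> B \<and> y \<in> carrier (Hom W) \<and> y \<notin> \<iota> B \<and>
        (\<forall>e\<in>carrier E. e \<odot>\<^bsub>Hom V\<^esub> x \<in> B \<longleftrightarrow> e \<odot>\<^bsub>Hom W\<^esub> y \<in> \<iota> B)" if B: "B \<in> b V" for B
    proof -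
      obtain x where x: "x \<in> carrier (Hom V)" "x \<notin> B" "{e \<in> carrier E. e \<odot>\<^bsub>Hom V\<^esub> x \<in> B} = \<tau> V B"
        using \<tau>[OF V B] unfolding P_def by blast
      obtain y where y: "y \<in> carrier (Hom W)" "y \<notin> \<iota> B" "{e \<in> carrier E. e \<odot>\<^bsub>Hom W\<^esub> y \<in> \<iota> B} = \<tau> V B"
        using \<tau>[OF W \<iota>(1)[OF B]] unfolding P_def \<iota>(2)[OF B] by blast
      have "e \<odot>\<^bsub>Hom V\<^esub> x \<in> B \<longleftrightarrow> e \<odot>\<^bsub>Hom W\<^esub> y \<in> \<iota> B" if "e \<in> carrier E" for e
        using that x(3) y(3) by blast
      then show ?thesis using x(1,2) y(1,2) by blast
    qed
    then have "\<forall>B\<in>b V. \<exists>x y. x \<in> carrier (Hom V) \<and> x \<notin> B \<and> y \<in> carrier (Hom W) \<and> y \<notin> \<iota> B \<and>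
        (\<forall>e\<in>carrier E. e \<odot>\<^bsub>Hom V\<^esub> x \<in> B \<longleftrightarrow> e \<odot>\<^bsub>Hom W\<^esub> y \<in> \<iota> B)" by blast
    from bchoice[OF this] obtain x where "\<forall>B\<in>b V. \<exists>y. x B \<in> carrier (Hom V) \<and> x B \<notin> B \<and>
        y \<in> carrier (Hom W) \<and> y \<notin> \<iota> B \<and> (\<forall>e\<in>carrier E. e \<odot>\<^bsub>Hom V\<^esub> x B \<in> B \<longleftrightarrow> e \<odot>\<^bsub>Hom W\<^esub> y \<in> \<iota> B)" ..
    from bchoice[OF this] obtain y where xy: "\<forall>B\<in>b V. x B \<in> carrier (Hom V) \<and> x B \<notin> B \<and>
        y B \<in> carrier (Hom W) \<and> y B \<notin> \<iota> B \<and> (\<forall>e\<in>carrier E. e \<odot>\<^bsub>Hom V\<^esub> x B \<in> B \<longleftrightarrow> e \<odot>\<^bsub>Hom W\<^esub> y B \<in> \<iota> B)" ..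
    show ?thesis
      by (rule surjection_if_types_match[OF T(1,2)[OF V] T(1,3)[OF W] bV bW inj \<iota>(1), of x y])
        (use xy in blast)+
  qed
  show thesis
  proof (rule that[OF F(1,2)])
    fix W assume W: "W \<in> T"
    obtain V where V: "V \<in> F" "\<forall>I\<in>\<L>. t V I \<le> t W I" using F(3)[OF W] ..
    show "\<exists>V\<in>F. \<exists>f. linear_map R W V f \<and> Hom_map M f ` carrier (Hom W) = carrier (Hom V)"
      using key[OF subsetD[OF F(2) V(1)] W V(2)] by (rule bexI) (rule V(1))
  qed
qed

end

context additive_invariant
begin

text \<open>
  Consider decompositions in which a submodule \<open>C\<close> of \<open>W\<close> has been split off and a remainder \<open>K\<close> in \<open>add M\<close> is left whose
  class decides whether that of \<open>W\<close> belongs to \<open>H\<close>. As \<open>W\<close> is noetherian, \<open>C\<close> may be taken maximal. If \<open>K\<close> were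
  nonzero, some \<open>V\<close> of the family would split off from \<open>K\<close> and enlarge \<open>C\<close>.
\<close>

lemma cl_add_M_finitely_generated:
  assumes semi: "semilocal R"
  obtains F where "finite F" "F \<subseteq> fg_modules R"
    "\<And>H W. \<lbrakk>subgroup H G; cl ` F \<subseteq> H; W \<in> fg_modules R; in_add R M W\<rbrakk> \<Longrightarrow> cl W \<in> H"
proof -
  obtain F where F: "finite F" "F \<subseteq> {W \<in> fg_modules R. in_add R M W \<and> carrier W \<noteq> {\<zero>\<^bsub>W\<^esub>}}"
    "\<And>W. W \<in> {W \<in> fg_modules R. in_add R M W \<and> carrier W \<noteq> {\<zero>\<^bsub>W\<^esub>}} \<Longrightarrow>
      \<exists>V\<in>F. \<exists>f. linear_map R W V f \<and> Hom_map M f ` carrier (Hom W) = carrier (Hom V)"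
    by (rule finite_splitting_family[OF semi]) iprover
  have "cl W \<in> H" if H: "subgroup H G" "cl ` F \<subseteq> H" and W: "W \<in> fg_modules R" "in_add R M W" for H W
  proof -
    have lW: "left_module R W" "finitely_generated_module R W" using W(1) by (simp_all add: fg_modules_iff[OF cring])
    interpret W: left_module R W by (rule lW(1))
    let ?P = "\<lambda>C K. submodule C R W \<and> submodule K R W \<and> C \<inter> K = {\<zero>\<^bsub>W\<^esub>} \<and>
      in_add R M (W\<lparr>carrier := K\<rparr>) \<and> (cl (W\<lparr>carrier := K\<rparr>) \<in> H \<longrightarrow> cl W \<in> H)"
    let ?S = "{C. \<exists>K. ?P C K}"
    have "?P {\<zero>\<^bsub>W\<^esub>} (carrier W)"
      using W.submodule_zero W.submodule_carrier W(2) by simp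
    then have ne: "?S \<noteq> {}" by blast
    obtain C where C: "C \<in> ?S" "\<And>D. \<lbrakk>D \<in> ?S; C \<subseteq> D\<rbrakk> \<Longrightarrow> D = C"
      by (rule W.noetherian_maximal[OF W.noetherian_module[OF cring noetherian lW(2)] ne]) auto
    then obtain K where CK: "?P C K" by blast
    let ?K = "W\<lparr>carrier := K\<rparr>"
    have Cs: "submodule C R W" and Ks: "submodule K R W" and int: "C \<inter> K = {\<zero>\<^bsub>W\<^esub>}"
      and Ka: "in_add R M ?K" and Kcl: "cl ?K \<in> H \<Longrightarrow> cl W \<in> H" using CK by iprover+
    have fK: "?K \<in> fg_modules R" by (rule submodule_finitely_generated[OF cring noetherian W(1) Ks])
    have lK: "left_module R ?K" by (rule W.left_module_submodule[OF Ks])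
    interpret K: left_module R ?K by (rule lK)
    have "K = {\<zero>\<^bsub>W\<^esub>}"
    proof (rule ccontr)
      assume "K \<noteq> {\<zero>\<^bsub>W\<^esub>}"
      then have "?K \<in> {W \<in> fg_modules R. in_add R M W \<and> carrier W \<noteq> {\<zero>\<^bsub>W\<^esub>}}" using fK Ka by simp
      from F(3)[OF this] obtain V f where V: "V \<in> F" and f: "linear_map R ?K V f"
        and surj: "Hom_map M f ` carrier (Hom ?K) = carrier (Hom V)" by blast
      have Vfg: "V \<in> fg_modules R" and Va: "in_add R M V" and Vn: "carrier V \<noteq> {\<zero>\<^bsub>V\<^esub>}"
        using V F(2) by blast+
      have lV: "left_module R V" using Vfg by (simp add: fg_modules_iff[OF cring])
      interpret V: left_module R V by (rule lV)
      obtain g where g: "linear_map R V ?K g" "\<And>v. v \<in> carrier V \<Longrightarrow> f (g v) = v"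
        by (rule section_if_Hom_surjective[OF lK lV Va f surj]) iprover
      have gK: "g v \<in> K" if "v \<in> carrier V" for v using linear_mapD(1)[OF g(1) that] by simp
      have KW: "k \<in> carrier W" if "k \<in> K" for k by (rule W.submoduleD(2)[OF Ks that])
      have fsurj: "f ` carrier ?K = carrier V"
      proof
        show "f ` carrier ?K \<subseteq> carrier V" using linear_mapD(1)[OF f] by blast
        show "carrier V \<subseteq> f ` carrier ?K"
        proof
          fix v assume "v \<in> carrier V"
          then show "v \<in> f ` carrier ?K" using g(2) gK by (intro image_eqI[of _ _ "g v"]) simp_all
        qed
      qed
      let ?L = "{k \<in> carrier ?K. f k = \<zero>\<^bsub>V\<^esub>}"
      have Ls: "submodule ?L R ?K" by (rule submodule_kernel[OF lK lV f])
      then have LsW: "submodule ?L R W" by (simp add: W.submodule_submodule_iff[OF Ks])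
      have lL: "left_module R (W\<lparr>carrier := ?L\<rparr>)" by (rule W.left_module_submodule[OF LsW])
      have La: "in_add R M (W\<lparr>carrier := ?L\<rparr>)"
      proof (rule in_add_retract[OF lK lL _ _ _ Ka])
        have d: "linear_map R ?K ?K (\<lambda>k. k \<ominus>\<^bsub>?K\<^esub> g (f k))"
          by (rule linear_map_diff_map[OF lK linear_map_id linear_map_comp[OF f g(1)]])
        have "f (k \<ominus>\<^bsub>?K\<^esub> g (f k)) = \<zero>\<^bsub>V\<^esub>" if k: "k \<in> carrier ?K" for k
          using linear_mapD(1)[OF f k] linear_mapD(1)[OF g(1) linear_mapD(1)[OF f k]]
          by (simp only: linear_map_diff[OF lK lV f k] g(2) V.minus_eq_zero_iff)
        then have "linear_map R ?K (?K\<lparr>carrier := ?L\<rparr>) (\<lambda>k. k \<ominus>\<^bsub>?K\<^esub> g (f k))"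
          using linear_mapD(1)[OF d] by (intro linear_map_cod_subset[OF d]) blast
        then show "linear_map R ?K (W\<lparr>carrier := ?L\<rparr>) (\<lambda>k. k \<ominus>\<^bsub>?K\<^esub> g (f k))" by simp
        show "linear_map R (W\<lparr>carrier := ?L\<rparr>) ?K (\<lambda>k. k)" by (simp add: linear_map_def)
        fix k assume "k \<in> carrier (W\<lparr>carrier := ?L\<rparr>)"
        then have k: "k \<in> carrier ?K" "f k = \<zero>\<^bsub>V\<^esub>" by simp_all
        have "g \<zero>\<^bsub>V\<^esub> = \<zero>\<^bsub>?K\<^esub>" by (rule linear_map_zero[OF lV lK g(1)])
        then show "k \<ominus>\<^bsub>?K\<^esub> g (f k) = k" using K.minus_add_cancel[OF k(1) K.N.zero_closed] K.N.minus_closed[OF k(1) K.N.zero_closed]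
          by (simp only: k(2) K.N.r_zero)
      qed
      have "cl ?K = cl (?K\<lparr>carrier := ?L\<rparr>) \<otimes>\<^bsub>G\<^esub> cl V" by (rule cl_kernel_image[OF fK Vfg f fsurj])
      then have "cl ?K = cl (W\<lparr>carrier := ?L\<rparr>) \<otimes>\<^bsub>G\<^esub> cl V" by simp
      then have Lcl: "cl (W\<lparr>carrier := ?L\<rparr>) \<in> H \<longrightarrow> cl W \<in> H"
        using H V Kcl by (auto intro!: Kcl subgroup.m_closed)
      let ?D = "{x \<oplus>\<^bsub>W\<^esub> y | x y. x \<in> C \<and> y \<in> g ` carrier V}"
      have gs: "submodule (g ` carrier V) R W"
        using submodule_image[OF lV lK g(1) V.submodule_carrier] by (simp add: W.submodule_submodule_iff[OF Ks])
      have Ds: "submodule ?D R W" by (rule W.submodule_sum[OF Cs gs])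
      have "?D \<inter> ?L \<subseteq> {\<zero>\<^bsub>W\<^esub>}"
      proof
        fix d assume d: "d \<in> ?D \<inter> ?L"
        then obtain c v where cv: "c \<in> C" "v \<in> carrier V" "d = c \<oplus>\<^bsub>W\<^esub> g v" and dK: "d \<in> K" "f d = \<zero>\<^bsub>V\<^esub>" by auto
        have cW: "c \<in> carrier W" by (rule W.submoduleD(2)[OF Cs cv(1)])
        have "d \<ominus>\<^bsub>W\<^esub> g v = c" unfolding cv(3) using cW KW[OF gK[OF cv(2)]]
          by (subst W.N.a_comm) (simp_all add: W.add_diff_left)
        moreover have "d \<ominus>\<^bsub>W\<^esub> g v \<in> K" by (rule W.submoduleD(7)[OF Ks dK(1) gK[OF cv(2)]])
        ultimately have "c = \<zero>\<^bsub>W\<^esub>" using int cv(1) by blast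
        then have dg: "d = g v" using cv(3) KW[OF gK[OF cv(2)]] by simp
        then have "v = \<zero>\<^bsub>V\<^esub>" using g(2)[OF cv(2)] dK(2) by simp
        then show "d \<in> {\<zero>\<^bsub>W\<^esub>}" using dg linear_map_zero[OF lV lK g(1)] by simp
      qed
      then have "?D \<inter> ?L = {\<zero>\<^bsub>W\<^esub>}" using W.submoduleD(3)[OF Ds] W.submoduleD(3)[OF LsW] by blast
      then have "?D \<in> ?S" using Ds LsW La Lcl by blast
      moreover have "C \<subseteq> ?D"
      proof
        fix c assume c: "c \<in> C"
        have "c = c \<oplus>\<^bsub>W\<^esub> \<zero>\<^bsub>W\<^esub>" using W.submoduleD(2)[OF Cs c] by simp
        then show "c \<in> ?D" using c W.submoduleD(3)[OF gs] by blast
      qed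
      ultimately have DC: "?D = C" by (rule C(2))
      obtain v where v: "v \<in> carrier V" "v \<noteq> \<zero>\<^bsub>V\<^esub>" using Vn V.N.zero_closed by blast
      have "g v = \<zero>\<^bsub>W\<^esub> \<oplus>\<^bsub>W\<^esub> g v" using KW[OF gK[OF v(1)]] by simp
      then have "g v \<in> ?D" using v(1) W.submoduleD(3)[OF Cs] by blast
      then have "g v \<in> C" by (simp only: DC)
      then have "g v = \<zero>\<^bsub>?K\<^esub>" using int gK[OF v(1)] by auto
      then have "f (g v) = \<zero>\<^bsub>V\<^esub>" using linear_map_zero[OF lK lV f] by simp
      then show False using g(2)[OF v(1)] v(2) by simp
    qed
    then have "cl ?K = \<one>\<^bsub>G\<^esub>"
      by (intro cl_no_maps[OF fK]) (use Hom_closed in fastforce)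
    then show ?thesis using Kcl H(1) by (simp add: subgroup.one_closed)
  qed
  then show thesis using that[of F] F(1,2) by blast
qed

lemma cl_finitely_generated:
  assumes "semilocal R" "gl_dim E < \<infinity>"
  obtains F where "finite F" "F \<subseteq> fg_modules R"
    "\<And>X. X \<in> fg_modules R \<Longrightarrow> cl X \<in> generate G (cl ` F)"
proof -
  obtain F where F: "finite F" "F \<subseteq> fg_modules R"
    "\<And>H W. \<lbrakk>subgroup H G; cl ` F \<subseteq> H; W \<in> fg_modules R; in_add R M W\<rbrakk> \<Longrightarrow> cl W \<in> H"
    by (rule cl_add_M_finitely_generated[OF assms(1)]) iprover
  have sg: "subgroup (generate G (cl ` F)) G"
    by (rule G.generate_is_subgroup, rule image_subsetI, rule cl_closed, rule subsetD[OF F(2)])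
  have sub: "cl ` F \<subseteq> generate G (cl ` F)" by (rule subsetI) (rule generate.incl)
  show thesis
    by (rule that[OF F(1,2)], rule cl_in_subgroup[OF sg F(3)[OF sg sub] assms(2)])
qed

end


section \<open>The quotient of the Grothendieck group\<close>

abbreviation (input) "free_modules R \<equiv> free_Abelian_group (fg_modules R)"

abbreviation (input) "K0_quotient R M \<equiv> K0 R Mod K0_span R (C_NG R M)"

definition K0_quotient_class ::
  "('a, 'c) ring_scheme \<Rightarrow> ('a, 'b, 'd) module_scheme \<Rightarrow> (('a, 'a module_univ) module \<Rightarrow>\<^sub>0 int)
    \<Rightarrow> (('a, 'a module_univ) module \<Rightarrow>\<^sub>0 int) set set"
  where "K0_quotient_class R M x =
    K0_span R (C_NG R M) #>\<^bsub>K0 R\<^esub> (K0_kernel R #>\<^bsub>free_modules R\<^esub> x)"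

lemma K0_relators_subset: "K0_relators R \<subseteq> carrier (free_modules R)"
proof
  fix x assume "x \<in> K0_relators R"
  then obtain X Y Z where "x = frag_of Y - frag_of X - frag_of Z"
    "X \<in> fg_modules R" "Y \<in> fg_modules R" "Z \<in> fg_modules R"
    unfolding K0_relators_def by blast
  moreover from this have "frag_of Y - frag_of X \<in> carrier (free_modules R)"
    by (intro free_Abelian_group_diff_closed) auto
  ultimately show "x \<in> carrier (free_modules R)"
    by (simp only:) (intro free_Abelian_group_diff_closed, auto)
qed

context
  fixes R :: "('a, 'c) ring_scheme" and M :: "('a, 'b, 'd) module_scheme"
  assumes cring: "cring R"
begin

lemma K0_kernel_normal: "K0_kernel R \<lhd> free_modules R"
proof -
  interpret F: comm_group "free_modules R" by (rule abelian_free_Abelian_group)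
  show ?thesis unfolding K0_kernel_def
    by (rule F.subgroup_imp_normal[OF F.generate_is_subgroup[OF K0_relators_subset]])
qed

lemma K0_coset_hom: "(\<lambda>x. K0_kernel R #>\<^bsub>free_modules R\<^esub> x) \<in> hom (free_modules R) (K0 R)"
  unfolding K0_def by (rule normal.r_coset_hom_Mod[OF K0_kernel_normal])

lemma K0_class_closed: "X \<in> fg_modules R \<Longrightarrow> K0_class R X \<in> carrier (K0 R)"
  using hom_in_carrier[OF K0_coset_hom, of "frag_of X"] by (simp add: K0_class_def)

lemma K0_span_normal: "K0_span R (C_NG R M) \<lhd> K0 R"
proof -
  interpret K: comm_group "K0 R" by (rule comm_group_K0[OF cring])
  have "K0_class R ` C_NG R M \<subseteq> carrier (K0 R)" using K0_class_closed by (auto simp: C_NG_def)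
  then show ?thesis unfolding K0_span_def by (intro K.subgroup_imp_normal K.generate_is_subgroup)
qed

lemma comm_group_K0_quotient: "comm_group (K0_quotient R M)"
proof -
  interpret K: comm_group "K0 R" by (rule comm_group_K0[OF cring])
  show ?thesis using K0_span_normal by (intro K.abelian_FactGroup) (rule normal_imp_subgroup)
qed

lemma group_hom_K0_quotient_class: "group_hom (free_modules R) (K0_quotient R M) (K0_quotient_class R M)"
proof -
  interpret F: comm_group "free_modules R" by (rule abelian_free_Abelian_group)
  interpret Q: comm_group "K0_quotient R M" by (rule comm_group_K0_quotient)
  have "K0_quotient_class R M \<in> hom (free_modules R) (K0_quotient R M)"
    using hom_compose[OF K0_coset_hom normal.r_coset_hom_Mod[OF K0_span_normal]]
    by (simp add: o_def K0_quotient_class_def[abs_def])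
  then show ?thesis by (simp add: group_hom_def group_hom_axioms_def F.is_group Q.is_group)
qed

lemma K0_quotient_class_surj: "K0_quotient_class R M ` carrier (free_modules R) = carrier (K0_quotient R M)"
  by (auto simp: K0_quotient_class_def K0_def carrier_FactGroup image_image)

lemma K0_quotient_class_exact:
  assumes "X \<in> fg_modules R" "Y \<in> fg_modules R" "Z \<in> fg_modules R" "short_exact R X Y Z f g"
  shows "K0_quotient_class R M (frag_of Y) = K0_quotient_class R M (frag_of X) \<otimes>\<^bsub>K0_quotient R M\<^esub> K0_quotient_class R M (frag_of Z)"
proof -
  interpret q: group_hom "free_modules R" "K0_quotient R M" "K0_quotient_class R M" by (rule group_hom_K0_quotient_class)
  interpret N: normal "K0_kernel R" "free_modules R" by (rule K0_kernel_normal)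
  let ?r = "frag_of Y - frag_of X - frag_of Z"
  have r: "?r \<in> K0_kernel R" unfolding K0_kernel_def K0_relators_def
    using assms by (intro generate.incl) blast
  have c: "frag_of X \<in> carrier (free_modules R)" "frag_of Z \<in> carrier (free_modules R)" using assms by auto
  have rc: "?r \<in> carrier (free_modules R)" by (rule N.mem_carrier[OF r])
  have "K0_quotient_class R M ?r = K0_quotient_class R M \<one>\<^bsub>free_modules R\<^esub>"
    unfolding K0_quotient_class_def
    by (simp only: N.rcos_const[OF q.G.group_axioms r] N.rcos_const[OF q.G.group_axioms N.one_closed])
  then have q1: "K0_quotient_class R M ?r = \<one>\<^bsub>K0_quotient R M\<^esub>" by (simp only: q.hom_one)
  have "frag_of Y = ?r \<otimes>\<^bsub>free_modules R\<^esub> (frag_of X \<otimes>\<^bsub>free_modules R\<^esub> frag_of Z)" by simp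
  then have "K0_quotient_class R M (frag_of Y) = K0_quotient_class R M ?r \<otimes>\<^bsub>K0_quotient R M\<^esub> (K0_quotient_class R M (frag_of X) \<otimes>\<^bsub>K0_quotient R M\<^esub> K0_quotient_class R M (frag_of Z))"
    using q.hom_mult[OF rc q.G.m_closed[OF c]] q.hom_mult[OF c] by (simp only:)
  then show ?thesis
    by (simp only: q1 q.H.l_one[OF q.H.m_closed[OF q.hom_closed[OF c(1)] q.hom_closed[OF c(2)]]])
qed

lemma K0_quotient_class_C_NG:
  assumes "X \<in> C_NG R M"
  shows "K0_quotient_class R M (frag_of X) = \<one>\<^bsub>K0_quotient R M\<^esub>"
proof -
  interpret K: comm_group "K0 R" by (rule comm_group_K0[OF cring])
  interpret S: normal "K0_span R (C_NG R M)" "K0 R" by (rule K0_span_normal)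
  have "K0_class R X \<in> K0_span R (C_NG R M)" unfolding K0_span_def
    using assms by (intro generate.incl) blast
  from S.rcos_const[OF K.group_axioms this] show ?thesis by (simp add: K0_quotient_class_def K0_class_def)
qed

text \<open>
  The classes of modules generate \<open>G\<close> because they generate the free abelian group that maps onto it.
\<close>

lemma K0_quotient_generated:
  assumes H: "subgroup H (K0_quotient R M)" "\<And>X. X \<in> fg_modules R \<Longrightarrow> K0_quotient_class R M (frag_of X) \<in> H"
  shows "H = carrier (K0_quotient R M)"
proof -
  interpret q: group_hom "free_modules R" "K0_quotient R M" "K0_quotient_class R M" by (rule group_hom_K0_quotient_class)
  have "K0_quotient_class R M x \<in> H" if "Poly_Mapping.keys x \<subseteq> fg_modules R" for x using that
  proof (induction rule: free_Abelian_group_induct [consumes 1, case_names zero diff gen])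
    case zero then show ?case using q.hom_one subgroup.one_closed[OF H(1)] by simp
  next
    case (diff x y)
    have c: "x \<in> carrier (free_modules R)" "y \<in> carrier (free_modules R)" using diff by simp_all
    have "K0_quotient_class R M (x \<otimes>\<^bsub>free_modules R\<^esub> inv\<^bsub>free_modules R\<^esub> y) = K0_quotient_class R M x \<otimes>\<^bsub>K0_quotient R M\<^esub> inv\<^bsub>K0_quotient R M\<^esub> K0_quotient_class R M y"
      using c q.hom_mult[OF c(1) q.G.inv_closed[OF c(2)]] q.hom_inv[OF c(2)] by simp
    then have "K0_quotient_class R M (x \<otimes>\<^bsub>free_modules R\<^esub> inv\<^bsub>free_modules R\<^esub> y) \<in> H"
      using diff subgroup.m_closed[OF H(1)] subgroup.m_inv_closed[OF H(1)] by simp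
    then show ?case using c by simp
  next
    case (gen X) then show ?case by (rule H(2))
  qed
  then have "carrier (K0_quotient R M) \<subseteq> H" unfolding K0_quotient_class_surj[symmetric] by auto
  then show ?thesis using subgroup.subset[OF H(1)] by blast
qed

end

theorem theorem2p5:
  fixes R :: "('a, 'c) ring_scheme" and M :: "('a, 'b, 'd) module_scheme"
  assumes "cring R" and "noetherian_ring R" and "semilocal R"
    and "module R M" and "finitely_generated_module R M" and "NCR R M"
  shows "finitely_generated_abelian_group (K0 R Mod K0_span R (C_NG R M))"
proof -
  let ?Q = "K0 R Mod K0_span R (C_NG R M)" and ?cl = "\<lambda>X. K0_quotient_class R M (frag_of X)"
  interpret q: group_hom "free_Abelian_group (fg_modules R)" ?Q "K0_quotient_class R M"
    by (rule group_hom_K0_quotient_class[OF assms(1)])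
  have comm: "comm_group ?Q" by (rule comm_group_K0_quotient[OF assms(1)])
  interpret additive_invariant R M ?Q ?cl
  proof (intro additive_invariant.intro fg_module_over_noetherian.intro additive_invariant_axioms.intro)
    show "left_module R M" using assms(1,4) by (simp add: module_iff_left_module)
    show "?cl X \<in> carrier ?Q" if "X \<in> fg_modules R" for X using that by (intro q.hom_closed) simp
    show "?cl Y = ?cl X \<otimes>\<^bsub>?Q\<^esub> ?cl Z"
      if "X \<in> fg_modules R" "Y \<in> fg_modules R" "Z \<in> fg_modules R" "short_exact R X Y Z f g" for X Y Z f g
      by (rule K0_quotient_class_exact[OF assms(1) that])
    show "?cl X = \<one>\<^bsub>?Q\<^esub>" if "X \<in> C_NG R M" for X by (rule K0_quotient_class_C_NG[OF assms(1) that])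
  qed (fact comm assms)+
  obtain F where F: "finite F" "F \<subseteq> fg_modules R"
    "\<And>X. X \<in> fg_modules R \<Longrightarrow> ?cl X \<in> generate ?Q (?cl ` F)"
    by (rule cl_finitely_generated[OF assms(3)]) (use assms(6) in \<open>simp_all add: NCR_def\<close>)
  have sub: "?cl ` F \<subseteq> carrier ?Q" using F(2) cl_closed by blast
  have "generate ?Q (?cl ` F) = carrier ?Q"
    by (rule K0_quotient_generated[OF assms(1) q.H.generate_is_subgroup[OF sub] F(3)])
  then show ?thesis
    unfolding finitely_generated_abelian_group_def using comm F(1) sub by blast
qed

end
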